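(* Let $(W,S)$ be a finite Coxeter group with longest element $w_0$. There exists a unique element $\tilde w_0$ of $RH_W$ such that (i) $\tilde w_0^2=1$; (ii) $(\tilde w_0)_{|v=1}=w_0$; (iii) $\tilde w_0T_s\tilde w_0^{-1}=T_{w_0sw_0}$ for all $s\in S$.
   Context: $H_W$ is the Hecke algebra of $W$: the quotient of the group ring $\mathbf{Z}[v^{\pm1}]B_W$ of the braid group $B_W$ of $W$ (generators $\beta_s$, $s\in S$, and the braid relations) by the ideal generated by $(\beta_s-v)(\beta_s+v^{-1})$ for $s\in S$. $T_s$ denotes the image of $\beta_s$. $R$ is the completion of $\mathbf{Q}[v^{\pm1}]$ at the ideal $(v-1)$, and $RH_W=R\otimes_{\mathbf{Z}[v^{\pm1}]}H_W$. The subscript $|v=1$ denotes the image under the quotient map $RH_W\to RH_W/(v-1)=\mathbf{Q}W$, $T_s\mapsto s$. *)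

theory Defs
  imports "HOL-Algebra.Algebra" "HOL-Algebra.Algebraic_Closure_Type" "HOL-Library.Poly_Mapping"
begin

section \<open>Groups given by generators and relations\<close>

text \<open>A letter \<open>(s, True)\<close> stands for the generator \<open>s\<close> and \<open>(s, False)\<close> for its formal
  inverse. The presented group consists of the classes of words over \<open>S\<close> modulo the congruence
  generated by free cancellation and the given relations, a relation being a pair of words that
  are to become equal.\<close>

type_synonym 's word = "('s \<times> bool) list"

inductive pres_eq :: "'s set \<Rightarrow> ('s word \<times> 's word) set \<Rightarrow> 's word \<Rightarrow> 's word \<Rightarrow> bool"
  for S :: "'s set" and Rel :: "('s word \<times> 's word) set" where
  refl: "w \<in> lists (S \<times> UNIV) \<Longrightarrow> pres_eq S Rel w w"
| sym: "pres_eq S Rel w w' \<Longrightarrow> pres_eq S Rel w' w"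
| trans: "pres_eq S Rel w w' \<Longrightarrow> pres_eq S Rel w' w'' \<Longrightarrow> pres_eq S Rel w w''"
| cancel: "x \<in> lists (S \<times> UNIV) \<Longrightarrow> y \<in> lists (S \<times> UNIV) \<Longrightarrow> s \<in> S \<Longrightarrow>
    pres_eq S Rel (x @ [(s, b), (s, \<not> b)] @ y) (x @ y)"
| rel: "x \<in> lists (S \<times> UNIV) \<Longrightarrow> y \<in> lists (S \<times> UNIV) \<Longrightarrow> (l, r) \<in> Rel \<Longrightarrow>
    l \<in> lists (S \<times> UNIV) \<Longrightarrow> r \<in> lists (S \<times> UNIV) \<Longrightarrow>
    pres_eq S Rel (x @ l @ y) (x @ r @ y)"

definition pres_class :: "'s set \<Rightarrow> ('s word \<times> 's word) set \<Rightarrow> 's word \<Rightarrow> 's word set" where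
  "pres_class S Rel w = {w'. pres_eq S Rel w w'}"

definition presented_group :: "'s set \<Rightarrow> ('s word \<times> 's word) set \<Rightarrow> 's word set monoid" where
  "presented_group S Rel =
    \<lparr>carrier = pres_class S Rel ` lists (S \<times> UNIV),
     monoid.mult = (\<lambda>A B. \<Union>a\<in>A. \<Union>b\<in>B. pres_class S Rel (a @ b)),
     one = pres_class S Rel []\<rparr>"


section \<open>Coxeter systems\<close>

text \<open>\<open>m(s,t)\<close> is the order of \<open>st\<close>. By the convention of \<^const>\<open>group.ord\<close> it is \<open>0\<close> when
  \<open>st\<close> has infinite order, and then the Coxeter and braid relations for \<open>s, t\<close> below degenerate
  to the trivial relation between empty words, as they should.\<close>

definition cox_m :: "('a, 'b) monoid_scheme \<Rightarrow> 'a \<Rightarrow> 'a \<Rightarrow> nat" where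
  "cox_m W s t = group.ord W (s \<otimes>\<^bsub>W\<^esub> t)"

text \<open>The relations \<open>(st)\<^bsup>m(s,t)\<^esup> = 1\<close>; the case \<open>s = t\<close> gives \<open>s\<^sup>2 = 1\<close>.\<close>

definition coxeter_relations :: "('a, 'b) monoid_scheme \<Rightarrow> 'a set \<Rightarrow> ('a word \<times> 'a word) set" where
  "coxeter_relations W S =
    {(concat (replicate (cox_m W s t) [(s, True), (t, True)]), []) | s t. s \<in> S \<and> t \<in> S}"

definition coxeter_system :: "('a, 'b) monoid_scheme \<Rightarrow> 'a set \<Rightarrow> bool" where
  "coxeter_system W S \<longleftrightarrow>
    group W \<and> S \<subseteq> carrier W \<and> (\<forall>s\<in>S. group.ord W s = 2) \<and>
    (\<exists>f \<in> iso (presented_group S (coxeter_relations W S)) W.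
      \<forall>s\<in>S. f (pres_class S (coxeter_relations W S) [(s, True)]) = s)"

definition cox_length :: "('a, 'b) monoid_scheme \<Rightarrow> 'a set \<Rightarrow> 'a \<Rightarrow> nat" where
  "cox_length W S w =
    (LEAST n. \<exists>ss \<in> lists S. length ss = n \<and> foldr (\<otimes>\<^bsub>W\<^esub>) ss \<one>\<^bsub>W\<^esub> = w)"

definition longest_element :: "('a, 'b) monoid_scheme \<Rightarrow> 'a set \<Rightarrow> 'a \<Rightarrow> bool" where
  "longest_element W S w0 \<longleftrightarrow>
    w0 \<in> carrier W \<and> (\<forall>w \<in> carrier W. cox_length W S w \<le> cox_length W S w0)"

primrec alternating :: "nat \<Rightarrow> 's \<Rightarrow> 's \<Rightarrow> 's word" where
  "alternating 0 s t = []"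
| "alternating (Suc n) s t = (s, True) # alternating n t s"

definition braid_relations :: "('a, 'b) monoid_scheme \<Rightarrow> 'a set \<Rightarrow> ('a word \<times> 'a word) set" where
  "braid_relations W S =
    {(alternating (cox_m W s t) s t, alternating (cox_m W s t) t s) | s t.
      s \<in> S \<and> t \<in> S \<and> s \<noteq> t}"

definition braid_group :: "('a, 'b) monoid_scheme \<Rightarrow> 'a set \<Rightarrow> 'a word set monoid" where
  "braid_group W S = presented_group S (braid_relations W S)"

definition braid_gen :: "('a, 'b) monoid_scheme \<Rightarrow> 'a set \<Rightarrow> 'a \<Rightarrow> 'a word set" where
  "braid_gen W S s = pres_class S (braid_relations W S) [(s, True)]"


section \<open>Monoid rings, tensor products and adic completions\<close>

text \<open>The monoid ring of \<open>G\<close> with coefficients in the type \<open>'k\<close>: finitely supported functions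
  on the carrier of \<open>G\<close> under convolution. (The multiplication of the library on the type of
  finitely supported functions needs the monoid to be a type, and written additively.)\<close>

definition monoid_ring :: "('g, 'b) monoid_scheme \<Rightarrow> ('g \<Rightarrow>\<^sub>0 'k::comm_ring_1) ring" where
  "monoid_ring G =
    \<lparr>carrier = {f. Poly_Mapping.keys f \<subseteq> carrier G},
     monoid.mult = (\<lambda>f g. \<Sum>a\<in>Poly_Mapping.keys f. \<Sum>b\<in>Poly_Mapping.keys g.
       Poly_Mapping.single (a \<otimes>\<^bsub>G\<^esub> b) (Poly_Mapping.lookup f a * Poly_Mapping.lookup g b)),
     one = Poly_Mapping.single \<one>\<^bsub>G\<^esub> 1,
     ring.zero = 0,
     add = (+)\<rparr>"

text \<open>The tensor product \<open>R \<otimes>\<^sub>K H\<close> of two \<open>K\<close>-algebras with structure maps \<open>i\<close> and \<open>j\<close>. As an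
  additive group it is the free abelian group on the pairs \<open>(r, h)\<close> modulo bilinearity and
  \<open>K\<close>-balancedness. With the multiplication \<open>(r, h) (r', h') = (r r', h h')\<close> this free abelian
  group is the monoid ring over \<open>\<int>\<close> of the product of the multiplicative monoids, and when \<open>i\<close>,
  \<open>j\<close> are ring homomorphisms with central image the additive subgroup generated by the relations
  is already a two-sided ideal.\<close>

definition tensor_relations ::
    "('r, 'x) ring_scheme \<Rightarrow> ('h, 'y) ring_scheme \<Rightarrow> ('k \<Rightarrow> 'r) \<Rightarrow> ('k \<Rightarrow> 'h) \<Rightarrow>
      (('r \<times> 'h) \<Rightarrow>\<^sub>0 int) set" where
  "tensor_relations R H i j =
    (let e = (\<lambda>r h. Poly_Mapping.single (r, h) (1::int)) in
      {e (r \<oplus>\<^bsub>R\<^esub> r') h - e r h - e r' h | r r' h.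
         r \<in> carrier R \<and> r' \<in> carrier R \<and> h \<in> carrier H} \<union>
      {e r (h \<oplus>\<^bsub>H\<^esub> h') - e r h - e r h' | r h h'.
         r \<in> carrier R \<and> h \<in> carrier H \<and> h' \<in> carrier H} \<union>
      {e (r \<otimes>\<^bsub>R\<^esub> i k) h - e r (j k \<otimes>\<^bsub>H\<^esub> h) | r k h. r \<in> carrier R \<and> h \<in> carrier H})"

definition tensor_ideal ::
    "('r, 'x) ring_scheme \<Rightarrow> ('h, 'y) ring_scheme \<Rightarrow> ('k \<Rightarrow> 'r) \<Rightarrow> ('k \<Rightarrow> 'h) \<Rightarrow>
      (('r \<times> 'h) \<Rightarrow>\<^sub>0 int) set" where
  "tensor_ideal R H i j = Idl\<^bsub>monoid_ring (R \<times>\<times> H)\<^esub> (tensor_relations R H i j)"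

definition tensor_ring ::
    "('r, 'x) ring_scheme \<Rightarrow> ('h, 'y) ring_scheme \<Rightarrow> ('k \<Rightarrow> 'r) \<Rightarrow> ('k \<Rightarrow> 'h) \<Rightarrow>
      (('r \<times> 'h) \<Rightarrow>\<^sub>0 int) set ring" where
  "tensor_ring R H i j = monoid_ring (R \<times>\<times> H) Quot tensor_ideal R H i j"

definition pure_tensor ::
    "('r, 'x) ring_scheme \<Rightarrow> ('h, 'y) ring_scheme \<Rightarrow> ('k \<Rightarrow> 'r) \<Rightarrow> ('k \<Rightarrow> 'h) \<Rightarrow>
      'r \<Rightarrow> 'h \<Rightarrow> (('r \<times> 'h) \<Rightarrow>\<^sub>0 int) set" where
  "pure_tensor R H i j r h =
    tensor_ideal R H i j +>\<^bsub>monoid_ring (R \<times>\<times> H)\<^esub> Poly_Mapping.single (r, h) 1"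

primrec ideal_power :: "('a, 'b) ring_scheme \<Rightarrow> 'a set \<Rightarrow> nat \<Rightarrow> 'a set" where
  "ideal_power A I 0 = carrier A"
| "ideal_power A I (Suc n) = ideal_prod A I (ideal_power A I n)"

text \<open>The completion is the inverse limit of the rings \<open>A / I\<^sup>n\<close>. A coset of \<open>I\<^bsup>n+1\<^esup>\<close> maps to a
  coset of \<open>I\<^sup>n\<close> under the transition map iff it is contained in it.\<close>

definition adic_completion :: "('a, 'b) ring_scheme \<Rightarrow> 'a set \<Rightarrow> (nat \<Rightarrow> 'a set) ring" where
  "adic_completion A I =
    \<lparr>carrier = {x. (\<forall>n. x n \<in> carrier (A Quot ideal_power A I n)) \<and> (\<forall>n. x (Suc n) \<subseteq> x n)},
     monoid.mult = (\<lambda>x y n. x n \<otimes>\<^bsub>A Quot ideal_power A I n\<^esub> y n),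
     one = (\<lambda>n. \<one>\<^bsub>A Quot ideal_power A I n\<^esub>),
     ring.zero = (\<lambda>n. \<zero>\<^bsub>A Quot ideal_power A I n\<^esub>),
     add = (\<lambda>x y n. x n \<oplus>\<^bsub>A Quot ideal_power A I n\<^esub> y n)\<rparr>"

definition to_completion :: "('a, 'b) ring_scheme \<Rightarrow> 'a set \<Rightarrow> 'a \<Rightarrow> nat \<Rightarrow> 'a set" where
  "to_completion A I a = (\<lambda>n. ideal_power A I n +>\<^bsub>A\<^esub> a)"


section \<open>The Hecke algebra\<close>

text \<open>Laurent polynomials in \<open>v\<close>: the coefficient of \<open>v\<^sup>n\<close> is the value at \<open>n :: int\<close>, and the
  library's ring structure on this type is the convolution product.\<close>

type_synonym 'k laurent = "int \<Rightarrow>\<^sub>0 'k"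

definition v_pow :: "int \<Rightarrow> 'k::comm_ring_1 laurent" where
  "v_pow n = Poly_Mapping.single n 1"

definition braid_ring ::
    "('a, 'b) monoid_scheme \<Rightarrow> 'a set \<Rightarrow> ('a word set \<Rightarrow>\<^sub>0 int laurent) ring" where
  "braid_ring W S = monoid_ring (braid_group W S)"

definition hecke_relation ::
    "('a, 'b) monoid_scheme \<Rightarrow> 'a set \<Rightarrow> 'a \<Rightarrow> 'a word set \<Rightarrow>\<^sub>0 int laurent" where
  "hecke_relation W S s =
    (let \<beta> = Poly_Mapping.single (braid_gen W S s) 1;
         scalar = Poly_Mapping.single \<one>\<^bsub>braid_group W S\<^esub>
     in (\<beta> - scalar (v_pow 1)) \<otimes>\<^bsub>braid_ring W S\<^esub> (\<beta> + scalar (v_pow (- 1))))"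

definition hecke_ideal ::
    "('a, 'b) monoid_scheme \<Rightarrow> 'a set \<Rightarrow> ('a word set \<Rightarrow>\<^sub>0 int laurent) set" where
  "hecke_ideal W S = Idl\<^bsub>braid_ring W S\<^esub> (hecke_relation W S ` S)"

type_synonym 'a hecke_elt = "('a word set \<Rightarrow>\<^sub>0 int laurent) set"

definition hecke_algebra :: "('a, 'b) monoid_scheme \<Rightarrow> 'a set \<Rightarrow> 'a hecke_elt ring" where
  "hecke_algebra W S = braid_ring W S Quot hecke_ideal W S"

definition hecke_scalar :: "('a, 'b) monoid_scheme \<Rightarrow> 'a set \<Rightarrow> int laurent \<Rightarrow> 'a hecke_elt" where
  "hecke_scalar W S k =
    hecke_ideal W S +>\<^bsub>braid_ring W S\<^esub> Poly_Mapping.single \<one>\<^bsub>braid_group W S\<^esub> k"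

definition hecke_T :: "('a, 'b) monoid_scheme \<Rightarrow> 'a set \<Rightarrow> 'a \<Rightarrow> 'a hecke_elt" where
  "hecke_T W S s =
    hecke_ideal W S +>\<^bsub>braid_ring W S\<^esub> Poly_Mapping.single (braid_gen W S s) 1"


section \<open>Extension of scalars to the completion at \<open>v = 1\<close>\<close>

definition Q_laurent :: "rat laurent ring" where
  "Q_laurent = ring_of_type_algebra"

definition v_minus_1_ideal :: "rat laurent set" where
  "v_minus_1_ideal = Idl\<^bsub>Q_laurent\<^esub> {v_pow 1 - 1}"

type_synonym R_elt = "nat \<Rightarrow> rat laurent set"

definition R_ring :: "R_elt ring" where
  "R_ring = adic_completion Q_laurent v_minus_1_ideal"

definition R_scalar :: "int laurent \<Rightarrow> R_elt" where
  "R_scalar k = to_completion Q_laurent v_minus_1_ideal (Poly_Mapping.map of_int k)"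

type_synonym 'a RH_elt = "((R_elt \<times> 'a hecke_elt) \<Rightarrow>\<^sub>0 int) set"

definition RH :: "('a, 'b) monoid_scheme \<Rightarrow> 'a set \<Rightarrow> 'a RH_elt ring" where
  "RH W S = tensor_ring R_ring (hecke_algebra W S) R_scalar (hecke_scalar W S)"

definition RH_tensor ::
    "('a, 'b) monoid_scheme \<Rightarrow> 'a set \<Rightarrow> R_elt \<Rightarrow> 'a hecke_elt \<Rightarrow> 'a RH_elt" where
  "RH_tensor W S = pure_tensor R_ring (hecke_algebra W S) R_scalar (hecke_scalar W S)"

definition RH_T :: "('a, 'b) monoid_scheme \<Rightarrow> 'a set \<Rightarrow> 'a \<Rightarrow> 'a RH_elt" where
  "RH_T W S s = RH_tensor W S \<one>\<^bsub>R_ring\<^esub> (hecke_T W S s)"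

definition RH_v_minus_1_ideal :: "('a, 'b) monoid_scheme \<Rightarrow> 'a set \<Rightarrow> 'a RH_elt set" where
  "RH_v_minus_1_ideal W S =
    Idl\<^bsub>RH W S\<^esub> {RH_tensor W S (R_scalar (v_pow 1 - 1)) \<one>\<^bsub>hecke_algebra W S\<^esub>}"

definition QW :: "('a, 'b) monoid_scheme \<Rightarrow> ('a \<Rightarrow>\<^sub>0 rat) ring" where
  "QW W = monoid_ring W"

definition QW_elt :: "'a \<Rightarrow> 'a \<Rightarrow>\<^sub>0 rat" where
  "QW_elt w = Poly_Mapping.single w 1"

text \<open>The identification \<open>RH\<^sub>W / (v - 1) = \<rat>W\<close> is the ring isomorphism sending the class of \<open>T\<^sub>s\<close>
  to \<open>s\<close>. It is unique (extensionality only fixes the irrelevant values off the carrier): the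
  quotient is generated by the classes of the \<open>T\<^sub>s\<close> as an algebra over \<open>\<rat>\<close>, and a unital ring
  homomorphism between \<open>\<rat>\<close>-algebras is \<open>\<rat>\<close>-linear.\<close>

definition QW_identification ::
    "('a, 'b) monoid_scheme \<Rightarrow> 'a set \<Rightarrow> 'a RH_elt set \<Rightarrow> ('a \<Rightarrow>\<^sub>0 rat)" where
  "QW_identification W S =
    (THE f. f \<in> ring_iso (RH W S Quot RH_v_minus_1_ideal W S) (QW W) \<and>
            f \<in> extensional (carrier (RH W S Quot RH_v_minus_1_ideal W S)) \<and>
            (\<forall>s\<in>S. f (RH_v_minus_1_ideal W S +>\<^bsub>RH W S\<^esub> RH_T W S s) = QW_elt s))"

definition at_v_1 :: "('a, 'b) monoid_scheme \<Rightarrow> 'a set \<Rightarrow> 'a RH_elt \<Rightarrow> ('a \<Rightarrow>\<^sub>0 rat)" where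
  "at_v_1 W S x = QW_identification W S (RH_v_minus_1_ideal W S +>\<^bsub>RH W S\<^esub> x)"

end

theory Submission
  imports Defs
begin

text \<open>Let \<open>K = \<rat>[[X]]\<close> with \<open>X = v - 1\<close>. It maps onto the completion \<open>R\<close>, so \<open>RH\<^sub>W\<close> is a \<open>K\<close>-algebra,
  spanned by the finitely many \<open>T\<^sub>w\<close> by Matsumoto's theorem. A finitely generated \<open>K\<close>-module is
  separated and complete in the \<open>X\<close>-adic topology, so no freeness of the Hecke algebra is needed.
  For existence, \<open>c = T\<^bsub>w\<^sub>0\<^esub>\<^sup>2\<close> is central and specializes to \<open>w\<^sub>0\<^sup>2 = 1\<close>, hence has a central
  square root \<open>r\<close> specializing to \<open>1\<close>, and \<open>T\<^bsub>w\<^sub>0\<^esub> r\<^sup>-\<^sup>1\<close> is the required element. For uniqueness, the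
  product \<open>z\<close> of two solutions is central with \<open>z\<^sup>2 = 1\<close> and \<open>z - 1\<close> divisible by \<open>X\<close>; then
  \<open>z - 1 = - (z - 1)\<^sup>2 / 2\<close> is divisible by every power of \<open>X\<close>, hence zero.\<close>


section \<open>Coxeter groups: the exchange condition and Matsumoto's theorem\<close>

text \<open>The condition at \<open>v = 1\<close> goes through \<open>QW_identification\<close>, a
  definite description, so nothing can be said about \<open>at_v_1\<close> before the isomorphism
  from the quotient to the group algebra is known to exist and to be unique. Existence needs the
  kernel of the specialization to be exactly X RH_W, and this follows from spanning alone: group
  elements are independent in the group algebra, so a combination of the T_w that specializes to 0
  has coefficients with zero constant term and is divisible by X.

  Centrality rests on one identity, T_{w0} T_s = T_{w0 s w0} T_{w0}, obtained by factoring w0 both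
  as (w0 s) s and as (w0 s w0) (w0 s) with lengths adding up. Since s -> w0 s w0 is an involution of
  S, the square of T_{w0} commutes with every T_s, and for the same reason so does the product of
  two solutions.

  The braid group contains inverses of the generators, while Matsumoto's theorem only speaks of
  positive words. The quadratic relation bridges the gap: the inverse of T_s is T_s - (v -
  v^-1).\<close>

declare in_listsD [rule del] in_listsI [rule del]

text \<open>Used whenever exchange removes a letter \<open>r\<close> from a concatenation, to decide
  which factor loses it.\<close>

lemma append_eq_append_Cons_cases:
  assumes "us @ vs = xs @ r # ys"
  shows "(\<exists>ys'. us = xs @ r # ys' \<and> ys = ys' @ vs) \<or> (\<exists>zs. xs = us @ zs \<and> vs = zs @ r # ys)"
  using assms by (auto simp: append_eq_append_conv2 append_eq_Cons_conv Cons_eq_append_conv)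

text \<open>\<open>presentation\<close> is the injectivity of the isomorphism in
  \<open>coxeter_system\<close>, stated for words without formal inverses. As the generators are
  involutions, such words reach every element.\<close>

locale coxeter_group = group W for W (structure) +
  fixes S :: "'a set"
  assumes gens_closed: "S \<subseteq> carrier W"
    and involution: "s \<in> S \<Longrightarrow> s \<otimes> s = \<one>"
    and generated: "w \<in> carrier W \<Longrightarrow> \<exists>us \<in> lists S. foldr (\<otimes>) us \<one> = w"
    and presentation: "us \<in> lists S \<Longrightarrow> vs \<in> lists S \<Longrightarrow> foldr (\<otimes>) us \<one> = foldr (\<otimes>) vs \<one> \<Longrightarrow>
      pres_eq S (coxeter_relations W S) (map (\<lambda>s. (s, True)) us) (map (\<lambda>s. (s, True)) vs)"
begin

abbreviation wprod :: "'a list \<Rightarrow> 'a" where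
  "wprod us \<equiv> foldr (\<otimes>) us \<one>"

abbreviation len :: "'a \<Rightarrow> nat" where
  "len \<equiv> cox_length W S"

lemma gen_closed [simp, intro]: "s \<in> S \<Longrightarrow> s \<in> carrier W"
  using gens_closed by blast

lemma wprod_closed [simp, intro]: "us \<in> lists S \<Longrightarrow> wprod us \<in> carrier W"
  by (induction us) auto

lemma wprod_append: "us \<in> lists S \<Longrightarrow> vs \<in> lists S \<Longrightarrow> wprod (us @ vs) = wprod us \<otimes> wprod vs"
  by (induction us) (auto simp: m_assoc)

declare foldr_append [simp del]

lemma rev_in_lists [simp]: "rev us \<in> lists S \<longleftrightarrow> us \<in> lists S"
  by (simp add: in_lists_conv_set)

lemma gen_cancel [simp]: "s \<in> S \<Longrightarrow> x \<in> carrier W \<Longrightarrow> s \<otimes> (s \<otimes> x) = x"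
  by (simp add: m_assoc[symmetric] involution)

lemma gen_cancel_right: "s \<in> S \<Longrightarrow> x \<in> carrier W \<Longrightarrow> x \<otimes> s \<otimes> s = x"
  by (simp add: m_assoc involution)

lemma inv_gen [simp]: "s \<in> S \<Longrightarrow> inv s = s"
  by (simp add: involution inv_equality)

lemma wprod_rev: "us \<in> lists S \<Longrightarrow> wprod (rev us) = inv (wprod us)"
  by (induction us) (auto simp: wprod_append inv_mult_group)

lemma conj_gen_eq_iff: "s \<in> S \<Longrightarrow> t \<in> carrier W \<Longrightarrow> s \<otimes> t \<otimes> s = s \<longleftrightarrow> t = s"
  by (metis gen_cancel gen_cancel_right gen_closed involution m_closed r_one)

text \<open>The parity of the number of occurrences of \<open>t\<close> among the reflections
  \<open>u\<^sub>1 \<dots> u\<^sub>i \<dots> u\<^sub>1\<close> of a word. It only depends on the value of the word, as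
  the defining relations preserve it.\<close>

primrec par :: "'a list \<Rightarrow> 'a \<Rightarrow> bool" where
  "par [] t = False"
| "par (s # us) t = ((t = s) \<noteq> par us (s \<otimes> t \<otimes> s))"

text \<open>The cocycle rule: \<open>vs\<close> contributes its reflections conjugated by the value
  of \<open>us\<close>, and counts are taken modulo 2.\<close>

lemma par_append:
  assumes "us \<in> lists S" "vs \<in> lists S" "t \<in> carrier W"
  shows "par (us @ vs) t = (par us t \<noteq> par vs (inv (wprod us) \<otimes> t \<otimes> wprod us))"
  using assms by (induction us arbitrary: t) (auto simp: inv_mult_group m_assoc)

lemma alternating_in_lists: "s \<in> S \<Longrightarrow> t \<in> S \<Longrightarrow> map fst (alternating n s t) \<in> lists S"
  by (induction n arbitrary: s t) auto

lemma length_alternating: "length (alternating n s t) = n"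
  by (induction n arbitrary: s t) auto

lemma pow_swap:
  assumes "s \<in> S" "t \<in> S"
  shows "s \<otimes> (t \<otimes> s) [^] (n::nat) = (s \<otimes> t) [^] n \<otimes> s"
proof (induction n)
  case (Suc n)
  have "s \<otimes> (t \<otimes> s) [^] Suc n = (s \<otimes> (t \<otimes> s) [^] n) \<otimes> (t \<otimes> s)"
    using assms by (simp add: m_assoc)
  also have "\<dots> = (s \<otimes> t) [^] n \<otimes> s \<otimes> (t \<otimes> s)" by (simp only: Suc)
  also have "\<dots> = (s \<otimes> t) [^] Suc n \<otimes> s" using assms by (simp add: m_assoc)
  finally show ?case .
qed (use assms in auto)

text \<open>The letter at position \<open>i\<close>, counted from 0, of the alternating word
  contributes the reflection \<open>(s \<otimes> t) [^] i \<otimes> s\<close>.\<close>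

lemma par_alternating:
  assumes "s \<in> S" "t \<in> S" "r \<in> carrier W"
  shows "par (map fst (alternating n s t)) r =
    odd (\<Sum>i<n. of_bool (r = (s \<otimes> t) [^] i \<otimes> s) :: nat)"
  using assms
proof (induction n arbitrary: s t r)
  case (Suc n)
  have "(s \<otimes> r \<otimes> s = (t \<otimes> s) [^] i \<otimes> t) = (r = (s \<otimes> t) [^] Suc i \<otimes> s)" for i
  proof -
    have "(s \<otimes> t) [^] Suc i \<otimes> s = s \<otimes> ((t \<otimes> s) [^] i \<otimes> t) \<otimes> s"
      using Suc.prems pow_swap[of s t i] by (simp add: m_assoc[symmetric])
    moreover have "(s \<otimes> r \<otimes> s = y) = (r = s \<otimes> y \<otimes> s)" if "y \<in> carrier W" for y
      using that Suc.prems by (auto simp: m_assoc involution)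
    ultimately show ?thesis using Suc.prems by simp
  qed
  then show ?case
    using Suc by (simp add: sum.lessThan_Suc_shift del: sum.lessThan_Suc nat_pow_Suc)
qed auto

lemma sum_lessThan_add: "sum f {..<m + n} = sum f {..<m} + (\<Sum>i<n. f (m + i))"
  for f :: "nat \<Rightarrow> nat"
  by (induction n) auto

lemma concat_replicate_alternating:
  "concat (replicate n [(s, True), (t, True)]) = alternating (n + n) s t"
  by (induction n) auto

lemma pow_cox_m: "s \<in> S \<Longrightarrow> t \<in> S \<Longrightarrow> (s \<otimes> t) [^] cox_m W s t = \<one>"
  unfolding cox_m_def by (rule pow_ord_eq_1) auto

text \<open>The relator is an alternating word of length 2m, and its reflections
  \<open>(s \<otimes> t) [^] i \<otimes> s\<close> have period m in \<open>i\<close>, so each of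
  them occurs an even number of times.\<close>

lemma par_relation:
  assumes "s \<in> S" "t \<in> S" "r \<in> carrier W"
  shows "\<not> par (map fst (concat (replicate (cox_m W s t) [(s, True), (t, True)]))) r"
proof -
  let ?m = "cox_m W s t"
  have "(s \<otimes> t) [^] (?m + i) = (s \<otimes> t) [^] i" for i
    using assms by (simp add: nat_pow_mult[symmetric] pow_cox_m)
  then show ?thesis
    by (simp add: concat_replicate_alternating par_alternating[OF assms] sum_lessThan_add)
qed

lemma wprod_relation:
  assumes "s \<in> S" "t \<in> S"
  shows "wprod (map fst (concat (replicate n [(s, True), (t, True)]))) = (s \<otimes> t) [^] n"
proof (induction n)
  case (Suc n)
  then show ?case using assms nat_pow_Suc2[of "s \<otimes> t" n] by (simp add: m_assoc)
qed auto

lemma fst_lists: "w \<in> lists (S \<times> UNIV) \<Longrightarrow> map fst w \<in> lists S"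
  by (induction w) auto

text \<open>\<open>map fst\<close> forgets formal inverses, which is harmless because each generator
  is its own inverse. Both kinds of rewriting remove a factor with trivial value and even parities,
  and by \<open>par_append\<close> this does not affect the rest of the word.\<close>

lemma pres_eq_invariants:
  assumes "pres_eq S (coxeter_relations W S) w w'"
  shows "w \<in> lists (S \<times> UNIV) \<and> w' \<in> lists (S \<times> UNIV) \<and>
    wprod (map fst w) = wprod (map fst w') \<and>
    (\<forall>t \<in> carrier W. par (map fst w) t = par (map fst w') t)"
  using assms
proof (induction rule: pres_eq.induct)
  case (cancel x y s b)
  then have xy: "map fst x \<in> lists S" "map fst y \<in> lists S" "[s, s] \<in> lists S"
    by (auto simp: fst_lists)
  \<comment> \<open>Both letters give the reflection \<open>s\<close>.\<close>
  have neutral: "\<not> par [s, s] r" if "r \<in> carrier W" for r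
    using that cancel(3) conj_gen_eq_iff[of s r] by simp
  have "wprod (map fst x @ [s, s] @ map fst y) = wprod (map fst x @ map fst y)"
    using xy cancel by (simp add: wprod_append m_assoc)
  moreover have "par (map fst x @ [s, s] @ map fst y) t = par (map fst x @ map fst y) t"
    if "t \<in> carrier W" for t
  proof -
    have ll: "[s, s] @ map fst y \<in> lists S" using xy by simp
    show ?thesis
      unfolding par_append[OF xy(1) ll that] par_append[OF xy(1,2) that]
      using neutral[of "inv (wprod (map fst x)) \<otimes> t \<otimes> wprod (map fst x)"] that xy cancel
      by (subst par_append) (auto simp: involution)
  qed
  ultimately show ?case using cancel by auto
next
  case (rel x y l r)
  then obtain s t where st: "s \<in> S" "t \<in> S" "r = []"
    and l: "l = concat (replicate (cox_m W s t) [(s, True), (t, True)])"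
    unfolding coxeter_relations_def by auto
  have wl: "wprod (map fst l) = \<one>"
    unfolding l using st by (subst wprod_relation) (auto simp: pow_cox_m)
  have pl: "\<not> par (map fst l) r" if "r \<in> carrier W" for r
    unfolding l using st that by (intro par_relation)
  have xy: "map fst x \<in> lists S" "map fst y \<in> lists S" "map fst l \<in> lists S"
    using rel by (auto simp: fst_lists)
  have "wprod (map fst x @ map fst l @ map fst y) = wprod (map fst x @ map fst y)"
    using xy wl by (simp add: wprod_append)
  moreover have "par (map fst x @ map fst l @ map fst y) t = par (map fst x @ map fst y) t"
    if "t \<in> carrier W" for t
  proof -
    have ll: "map fst l @ map fst y \<in> lists S" using xy by simp
    show ?thesis
      unfolding par_append[OF xy(1) ll that] par_append[OF xy(1,2) that]
      using pl[of "inv (wprod (map fst x)) \<otimes> t \<otimes> wprod (map fst x)"] that xy wl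
      by (subst par_append) auto
  qed
  ultimately show ?case using rel st by auto
qed auto

text \<open>The one place where the presentation of W enters: parity becomes a function of the group
  element.\<close>

lemma par_cong:
  assumes "us \<in> lists S" "vs \<in> lists S" "wprod us = wprod vs" "t \<in> carrier W"
  shows "par us t = par vs t"
  using pres_eq_invariants[OF presentation[OF assms(1-3)]] assms(4) by (simp add: comp_def)

text \<open>An odd count makes \<open>t\<close> one of the reflections u_1 ... u_i ... u_1 of the
  word, and multiplying the word by it from the left cancels the letter u_i.\<close>

lemma par_deletion:
  assumes "us \<in> lists S" "t \<in> carrier W" "par us t"
  shows "\<exists>xs r ys. us = xs @ r # ys \<and> t \<otimes> wprod us = wprod (xs @ ys)"
  using assms
proof (induction us arbitrary: t rule: list.induct)
  case (Cons s us)
  show ?case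
  proof (cases "t = s")
    case True
    then have "s # us = [] @ s # us \<and> t \<otimes> wprod (s # us) = wprod ([] @ us)"
      using Cons.prems by simp
    then show ?thesis by blast
  next
    case False
    then have "par us (s \<otimes> t \<otimes> s)" using Cons.prems by auto
    then obtain xs r ys where *: "us = xs @ r # ys" "s \<otimes> t \<otimes> s \<otimes> wprod us = wprod (xs @ ys)"
      using Cons.IH[of "s \<otimes> t \<otimes> s"] Cons.prems by auto
    have "t \<otimes> wprod (s # us) = s \<otimes> (s \<otimes> t \<otimes> s \<otimes> wprod us)"
      using Cons.prems by (simp add: m_assoc)
    then have "t \<otimes> wprod (s # us) = wprod ((s # xs) @ ys)" using * by simp
    then show ?thesis using *(1) by (metis append_Cons)
  qed
qed auto

section \<open>Length and the exchange condition\<close>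

lemma len_le: "us \<in> lists S \<Longrightarrow> len (wprod us) \<le> length us"
  unfolding cox_length_def by (rule Least_le) blast

lemma reduced_word_exists:
  assumes "w \<in> carrier W"
  obtains us where "us \<in> lists S" "length us = len w" "wprod us = w"
proof -
  obtain us where "us \<in> lists S" "wprod us = w" using generated[OF assms] by auto
  then have "\<exists>n. \<exists>us \<in> lists S. length us = n \<and> wprod us = w" by blast
  then have "\<exists>us \<in> lists S. length us = len w \<and> wprod us = w"
    unfolding cox_length_def by (rule LeastI_ex)
  then show ?thesis using that by blast
qed

text \<open>If \<open>s\<close> occurred an even number of times among the reflections of
  \<open>us\<close>, it would occur an odd number of times for a reduced word of
  \<open>s \<otimes> wprod us\<close>. Deletion there would produce a word for
  \<open>wprod us\<close> that is too short. The word \<open>us\<close> itself may be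
  non-reduced.\<close>

lemma exchange:
  assumes "s \<in> S" "us \<in> lists S" "len (s \<otimes> wprod us) \<le> len (wprod us)"
  shows "\<exists>xs r ys. us = xs @ r # ys \<and> s \<otimes> wprod us = wprod (xs @ ys)"
proof (rule par_deletion)
  obtain vs where vs: "vs \<in> lists S" "length vs = len (s \<otimes> wprod us)" "wprod vs = s \<otimes> wprod us"
    using reduced_word_exists[of "s \<otimes> wprod us"] assms by auto
  show "par us s"
  proof (rule ccontr)
    assume "\<not> par us s"
    \<comment> \<open>\<open>s # vs\<close> has the same value as \<open>us\<close>, and a leading
      \<open>s\<close> flips the parity at \<open>s\<close>.\<close>
    moreover have "par us s = par (s # vs) s" using assms vs by (intro par_cong) auto
    ultimately have "par vs s" using assms by (simp add: involution)
    then obtain xs r ys where *: "vs = xs @ r # ys" "s \<otimes> wprod vs = wprod (xs @ ys)"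
      using par_deletion[of vs s] assms(1) vs(1) by blast
    then have "wprod us = wprod (xs @ ys)" using assms vs by simp
    moreover have "xs @ ys \<in> lists S" using * vs by auto
    ultimately have "len (wprod us) < length vs" using len_le[of "xs @ ys"] * by simp
    then show False using vs assms by simp
  qed
qed (use assms in auto)

section \<open>Reduced words and alternating words\<close>

definition reduced :: "'a list \<Rightarrow> bool" where
  "reduced us \<longleftrightarrow> us \<in> lists S \<and> length us = len (wprod us)"

lemma reducedI: "us \<in> lists S \<Longrightarrow> length us \<le> len (wprod us) \<Longrightarrow> reduced us"
  unfolding reduced_def using len_le[of us] by simp

lemma reduced_append:
  assumes "reduced (us @ vs)"
  shows "reduced us" "reduced vs"
proof -
  have uv: "us \<in> lists S" "vs \<in> lists S" using assms unfolding reduced_def by auto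
  obtain us' vs' where us': "us' \<in> lists S" "length us' = len (wprod us)" "wprod us' = wprod us"
    and vs': "vs' \<in> lists S" "length vs' = len (wprod vs)" "wprod vs' = wprod vs"
    by (meson uv reduced_word_exists wprod_closed)
  have "wprod (us' @ vs') = wprod (us @ vs)" using uv us' vs' by (simp add: wprod_append)
  then have "length us + length vs \<le> length us' + length vs'"
    using assms len_le[of "us' @ vs'"] us' vs' unfolding reduced_def by simp
  then show "reduced us" "reduced vs"
    using uv us' vs' len_le[of us] len_le[of vs] by (auto simp: reduced_def)
qed

lemma reduced_Cons: "reduced (s # us) \<Longrightarrow> reduced us"
  using reduced_append(2)[of "[s]"] by simp

text \<open>The power is an alternating word of length 2j + 2 ending in \<open>a\<close>. Its last j
  letters cancel one by one against the second factor, leaving j + 2 letters.\<close>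

lemma alternating_recurrence:
  assumes "a \<in> S" "b \<in> S"
  shows "wprod (map fst (alternating (Suc (Suc j)) b a)) =
    (b \<otimes> a) [^] Suc j \<otimes> wprod (map fst (alternating j a b))"
  using assms
proof (induction j arbitrary: a b)
  case (Suc j)
  let ?z = "wprod (map fst (alternating j b a))"
  have z: "?z \<in> carrier W" using Suc.prems alternating_in_lists by blast
  have "wprod (map fst (alternating (Suc (Suc (Suc j))) b a)) =
      b \<otimes> wprod (map fst (alternating (Suc (Suc j)) a b))" by simp
  also have "\<dots> = b \<otimes> ((a \<otimes> b) [^] Suc j \<otimes> ?z)"
    by (subst Suc.IH) (use Suc.prems in auto)
  also have "\<dots> = b \<otimes> (a \<otimes> b) [^] Suc j \<otimes> ?z"
    using Suc.prems z by (simp add: m_assoc)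
  also have "\<dots> = (b \<otimes> a) [^] Suc j \<otimes> b \<otimes> ?z"
    using Suc.prems by (subst pow_swap) auto
  also have "\<dots> = (b \<otimes> a) [^] Suc j \<otimes> (b \<otimes> a) \<otimes> (a \<otimes> ?z)"
    using Suc.prems z by (simp add: m_assoc)
  also have "\<dots> = (b \<otimes> a) [^] Suc (Suc j) \<otimes> wprod (map fst (alternating (Suc j) a b))"
    by simp
  finally show ?case .
qed auto

lemma cox_m_sym: "s \<in> S \<Longrightarrow> t \<in> S \<Longrightarrow> cox_m W s t = cox_m W t s"
  unfolding cox_m_def using ord_inv[of "s \<otimes> t"] by (simp add: inv_mult_group)

text \<open>When \<open>Suc j\<close> is the order, the power in
  \<open>alternating_recurrence\<close> is trivial, and one letter \<open>b\<close> can be moved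
  across the equation. For infinite order both words are empty.\<close>

lemma wprod_braid:
  assumes "a \<in> S" "b \<in> S"
  shows "wprod (map fst (alternating (cox_m W a b) a b)) = wprod (map fst (alternating (cox_m W a b) b a))"
proof (cases "cox_m W a b")
  case (Suc j)
  have "b \<otimes> wprod (map fst (alternating (Suc j) a b)) = wprod (map fst (alternating j a b))"
    using alternating_recurrence[of a b j] assms Suc pow_cox_m[of b a] cox_m_sym[of a b]
      alternating_in_lists[of a b j]
    by simp
  moreover have "wprod (map fst (alternating (Suc j) a b)) \<in> carrier W"
    using alternating_in_lists assms by blast
  ultimately have "wprod (map fst (alternating (Suc j) a b)) = b \<otimes> wprod (map fst (alternating j a b))"
    using assms by (metis gen_cancel)
  then show ?thesis using Suc by simp
qed simp

text \<open>By \<open>alternating_recurrence\<close> a coincidence would make the power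
  \<open>Suc j\<close> of \<open>b \<otimes> a\<close> trivial, although this exponent is positive
  and below the order, or the order is infinite.\<close>

lemma no_alternating_coincidence:
  assumes "a \<in> S" "b \<in> S" "Suc j < cox_m W a b \<or> cox_m W a b = 0"
  shows "wprod (map fst (alternating (Suc (Suc j)) b a)) \<noteq> wprod (map fst (alternating j a b))"
proof
  assume eq: "wprod (map fst (alternating (Suc (Suc j)) b a)) = wprod (map fst (alternating j a b))"
  let ?z = "wprod (map fst (alternating j a b))"
  have z: "?z \<in> carrier W" using assms alternating_in_lists by blast
  have "(b \<otimes> a) [^] Suc j \<otimes> ?z = ?z"
    using alternating_recurrence[OF assms(1,2), of j] eq by simp
  then have "(b \<otimes> a) [^] Suc j = \<one>"
    using z assms by (simp del: nat_pow_Suc)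
  then have "cox_m W a b dvd Suc j"
    using pow_eq_id[of "b \<otimes> a" "Suc j"] assms cox_m_sym[of a b] by (simp add: cox_m_def)
  then show False using assms(3) dvd_imp_le by fastforce
qed

lemma alternating_prefix:
  assumes "map fst (alternating n a b) = xs @ r # ys"
  shows "xs = map fst (alternating (length xs) a b) \<and>
    xs @ [r] = map fst (alternating (Suc (length xs)) a b)"
  using assms
proof (induction n arbitrary: a b xs)
  case (Suc n)
  show ?case
  proof (cases xs)
    case (Cons x xs')
    then show ?thesis using Suc.IH[of b a xs'] Suc.prems by auto
  qed (use Suc.prems in auto)
qed auto

text \<open>Exchange moves the missing letter to the front as long as the alternating prefix is shorter
  than \<open>m(s,t)\<close>, because no letter can be deleted from the prefix itself.\<close>

lemma dihedral_descent:
  assumes "s \<in> S" "t \<in> S" "s \<noteq> t" "w \<in> carrier W"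
    and "len (s \<otimes> w) \<le> len w" "len (t \<otimes> w) \<le> len w"
    and "k \<le> cox_m W s t \<or> cox_m W s t = 0"
  shows "\<exists>a b z. {a, b} = {s, t} \<and> reduced (map fst (alternating k a b) @ z) \<and>
    wprod (map fst (alternating k a b) @ z) = w"
  using assms(7)
proof (induction k)
  case 0
  obtain us where "us \<in> lists S" "length us = len w" "wprod us = w"
    using reduced_word_exists[OF assms(4)] .
  then show ?case unfolding reduced_def by auto
next
  case (Suc k)
  then obtain a b z where ab: "{a, b} = {s, t}"
    and red: "reduced (map fst (alternating k a b) @ z)"
    and w: "wprod (map fst (alternating k a b) @ z) = w" by auto
  let ?p = "map fst (alternating k a b)"
  have S: "a \<in> S" "b \<in> S" using ab assms by auto
  have lists: "?p \<in> lists S" "z \<in> lists S" using red unfolding reduced_def by auto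
  have b: "len (b \<otimes> wprod (?p @ z)) \<le> len (wprod (?p @ z))"
    unfolding w using ab assms by auto
  have m: "cox_m W a b = cox_m W s t" using ab assms cox_m_sym[of s t] by (auto simp: doubleton_eq_iff)
  obtain xs r ys where del: "?p @ z = xs @ r # ys" "b \<otimes> wprod (?p @ z) = wprod (xs @ ys)"
    using exchange[of b "?p @ z"] b lists S by auto
  have xs: "xs \<in> lists S" "r \<in> S" "ys \<in> lists S" using del(1) lists by (metis Cons_in_lists_iff append_in_lists_conv)+
  show ?case
  proof (cases "length xs < k")
    case True
    then have "\<not> (\<exists>zs. xs = ?p @ zs)" by (auto simp: length_alternating)
    then obtain ys' where p: "?p = xs @ r # ys'"
      using append_eq_append_Cons_cases[OF del(1)] by blast
    have "b \<otimes> (wprod (xs @ [r]) \<otimes> wprod ys) = wprod xs \<otimes> wprod ys"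
      using del xs by (simp add: wprod_append m_assoc)
    then have "b \<otimes> wprod (xs @ [r]) \<otimes> wprod ys = wprod xs \<otimes> wprod ys"
      using xs S by (subst m_assoc) (auto simp: wprod_append)
    then have "b \<otimes> wprod (xs @ [r]) = wprod xs"
      using xs S by (subst (asm) right_cancel) (auto simp: wprod_append)
    then have "wprod (map fst (alternating (Suc (Suc (length xs))) b a)) =
        wprod (map fst (alternating (length xs) a b))"
      using alternating_prefix[OF p] by (metis alternating.simps(2) foldr_Cons fst_conv list.simps(9) o_apply)
    then show ?thesis
      using no_alternating_coincidence[of a b "length xs"] S True Suc.prems m by auto
  next
    case False
    then have "\<nexists>ys'. ?p = xs @ r # ys'"
      by (metis append_Cons length_alternating length_append length_map less_add_Suc1 list.size(4) add_Suc_right)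
    then obtain zs where xs': "xs = ?p @ zs" and z: "z = zs @ r # ys"
      using append_eq_append_Cons_cases[OF del(1)] by blast
    \<comment> \<open>Prepending \<open>b\<close> interchanges the roles of \<open>a\<close> and
      \<open>b\<close>, which is why the statement only fixes the unordered pair.\<close>
    let ?q = "map fst (alternating (Suc k) b a) @ zs @ ys"
    have q: "?q \<in> lists S" using lists S xs xs' by auto
    have "wprod ?q = b \<otimes> wprod (xs @ ys)" using xs' by simp
    also have "\<dots> = w" using del(2) w S lists by (metis assms(4) gen_cancel)
    finally have "wprod ?q = w" .
    moreover have "length ?q = length (?p @ z)" using z by simp
    ultimately have "reduced ?q" using red w q unfolding reduced_def by metis
    moreover have "{b, a} = {s, t}" using ab by auto
    ultimately show ?thesis using \<open>wprod ?q = w\<close> by blast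
  qed
qed

text \<open>For infinite order the descent would never stop and would give a reduced word of
  \<open>w\<close> with an alternating prefix longer than \<open>w\<close>.\<close>

lemma length_le_imp_cox_m_nonzero:
  assumes "s \<in> S" "t \<in> S" "s \<noteq> t" "w \<in> carrier W"
    and "len (s \<otimes> w) \<le> len w" "len (t \<otimes> w) \<le> len w"
  shows "cox_m W s t \<noteq> 0"
proof
  assume "cox_m W s t = 0"
  then obtain a b z where "reduced (map fst (alternating (Suc (len w)) a b) @ z)"
    "wprod (map fst (alternating (Suc (len w)) a b) @ z) = w"
    using dihedral_descent[OF assms, of "Suc (len w)"] by auto
  then show False unfolding reduced_def by (simp add: length_alternating)
qed

lemma reduced_Cons_descent:
  assumes "reduced (s # us)"
  shows "s \<in> S" "len (s \<otimes> wprod (s # us)) \<le> len (wprod (s # us))"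
  using assms len_le[of us] unfolding reduced_def by auto

lemma reduced_length_eq:
  "reduced us \<Longrightarrow> reduced vs \<Longrightarrow> wprod us = wprod vs \<Longrightarrow> length us = length vs"
  by (simp add: reduced_def)

text \<open>Induction on the common length. Words with equal first letters reduce to shorter ones.
  If the first letters s and t differ, both are descents, and \<open>dihedral_descent\<close>
  together with \<open>wprod_braid\<close> yields two reduced words of the same element that start
  with the two alternating words of length m(s,t). These differ by one braid relation, and each
  shares its first letter with one of the given words.\<close>

theorem matsumoto:
  assumes "monoid M" and T: "\<And>s. s \<in> S \<Longrightarrow> T s \<in> carrier M"
    and braid: "\<And>s t. s \<in> S \<Longrightarrow> t \<in> S \<Longrightarrow> s \<noteq> t \<Longrightarrow>
      foldr (\<lambda>s. (\<otimes>\<^bsub>M\<^esub>) (T s)) (map fst (alternating (cox_m W s t) s t)) \<one>\<^bsub>M\<^esub> =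
      foldr (\<lambda>s. (\<otimes>\<^bsub>M\<^esub>) (T s)) (map fst (alternating (cox_m W s t) t s)) \<one>\<^bsub>M\<^esub>"
    and "reduced us" "reduced vs" "wprod us = wprod vs"
  shows "foldr (\<lambda>s. (\<otimes>\<^bsub>M\<^esub>) (T s)) us \<one>\<^bsub>M\<^esub> = foldr (\<lambda>s. (\<otimes>\<^bsub>M\<^esub>) (T s)) vs \<one>\<^bsub>M\<^esub>"
  using assms(4-6)
proof (induction "length us" arbitrary: us vs)
  case 0
  then have "us = []" "vs = []" using reduced_length_eq[of us vs] by auto
  then show ?case by simp
next
  case (Suc n)
  interpret M: monoid M by fact
  let ?f = "\<lambda>us. foldr (\<lambda>s. (\<otimes>\<^bsub>M\<^esub>) (T s)) us \<one>\<^bsub>M\<^esub>"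
  have closed: "us \<in> lists S \<Longrightarrow> ?f us \<in> carrier M" for us by (induction us) (auto simp: T)
  have app: "us \<in> lists S \<Longrightarrow> vs \<in> lists S \<Longrightarrow> ?f (us @ vs) = ?f us \<otimes>\<^bsub>M\<^esub> ?f vs" for us vs
    by (induction us) (auto simp: M.m_assoc T closed)
  have same_head: "?f xs = ?f ys"
    if P: "reduced xs" "reduced ys" "wprod xs = wprod ys" "length xs = Suc n" "hd xs = hd ys" for xs ys
  proof -
    have "length ys = Suc n" using P reduced_length_eq[of xs ys] by simp
    then obtain s xs' ys' where xs: "xs = s # xs'" and ys: "ys = s # ys'"
      using P \<open>length ys = Suc n\<close> by (cases xs; cases ys) auto
    have "xs' \<in> lists S" "ys' \<in> lists S" "s \<in> S" using xs ys P unfolding reduced_def by auto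
    then have "wprod xs' = wprod ys'" using P(3) xs ys by (simp)
    then have "?f xs' = ?f ys'" using xs ys P reduced_Cons Suc.hyps(1)[of xs' ys'] by simp
    then show ?thesis using xs ys by simp
  qed
  have len: "length vs = Suc n" using Suc.prems Suc.hyps(2) reduced_length_eq[of us vs] by simp
  obtain s us' t vs' where us: "us = s # us'" and vs: "vs = t # vs'"
    using Suc.hyps(2) len by (cases us; cases vs) auto
  show ?case
  proof (cases "s = t")
    case True
    then show ?thesis using same_head[of us vs] Suc.prems Suc.hyps(2) us vs by simp
  next
    case False
    let ?w = "wprod us" let ?m = "cox_m W s t"
    have s: "s \<in> S" "len (s \<otimes> ?w) \<le> len ?w" using reduced_Cons_descent[of s us'] Suc.prems us by auto
    have t: "t \<in> S" "len (t \<otimes> ?w) \<le> len ?w" using reduced_Cons_descent[of t vs'] Suc.prems vs by auto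
    have w: "?w \<in> carrier W" using Suc.prems unfolding reduced_def by auto
    obtain a b z where ab: "{a, b} = {s, t}" and red: "reduced (map fst (alternating ?m a b) @ z)"
      and wp: "wprod (map fst (alternating ?m a b) @ z) = ?w"
      using dihedral_descent[OF s(1) t(1) False w s(2) t(2), of ?m] by auto
    have S: "a \<in> S" "b \<in> S" "a \<noteq> b" using ab s t False by (auto simp: doubleton_eq_iff)
    have m: "cox_m W a b = ?m" using ab s t cox_m_sym[of s t] by (auto simp: doubleton_eq_iff)
    \<comment> \<open>The alternating words are nonempty, so they have the first letters
      \<open>a\<close> and \<open>b\<close> that \<open>same_head\<close> compares.\<close>
    obtain j where j: "?m = Suc j"
      using length_le_imp_cox_m_nonzero[OF s(1) t(1) False w s(2) t(2)] not0_implies_Suc by blast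
    let ?A = "map fst (alternating ?m a b)" and ?B = "map fst (alternating ?m b a)"
    have l: "?A \<in> lists S" "?B \<in> lists S" "z \<in> lists S"
      using S red unfolding reduced_def by (auto simp: alternating_in_lists)
    have "wprod ?A = wprod ?B" using wprod_braid[of a b] S m by simp
    then have wB: "wprod (?B @ z) = ?w" using wp l by (simp add: wprod_append)
    then have redB: "reduced (?B @ z)"
      using red wp l unfolding reduced_def by (simp add: length_alternating)
    have AB: "?f (?A @ z) = ?f (?B @ z)" using braid[of a b] S m l by (simp add: app)
    have lA: "length (?A @ z) = Suc n" "length (?B @ z) = Suc n"
      using red redB wp wB Suc.prems(1) Suc.hyps(2) reduced_length_eq by metis+
    have hd: "hd (?A @ z) = a" "hd (?B @ z) = b" using j by auto
    have end_eq: "?f us = ?f xs \<and> ?f vs = ?f ys"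
      if "reduced xs" "reduced ys" "wprod xs = ?w" "wprod ys = ?w" "hd xs = s" "hd ys = t" for xs ys
      using same_head[of us xs] same_head[of vs ys] that us vs len Suc.prems Suc.hyps(2) by simp
    consider "a = s" "b = t" | "a = t" "b = s" using ab by (auto simp: doubleton_eq_iff)
    then show ?thesis
    proof cases
      case 1
      then show ?thesis using end_eq[of "?A @ z" "?B @ z", OF red redB wp wB] hd AB by simp
    next
      case 2
      then show ?thesis using end_eq[of "?B @ z" "?A @ z", OF redB red wB wp] hd AB by simp
    qed
  qed
qed

section \<open>Lengths relative to the longest element\<close>

lemma len_inv: "w \<in> carrier W \<Longrightarrow> len (inv w) = len w"
proof -
  have "len (inv w) \<le> len w" if w: "w \<in> carrier W" for w
  proof -
    obtain us where "us \<in> lists S" "length us = len w" "wprod us = w"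
      using reduced_word_exists[OF w] .
    then show ?thesis using len_le[of "rev us"] by (auto simp: wprod_rev rev_in_lists)
  qed
  from this[of w] this[of "inv w"] show "w \<in> carrier W \<Longrightarrow> ?thesis" by simp
qed

text \<open>Exchange removes a letter, so multiplication by a generator never preserves the
  length.\<close>

lemma len_gen_mult_less:
  assumes "s \<in> S" "w \<in> carrier W" "len (s \<otimes> w) \<le> len w"
  shows "len (s \<otimes> w) < len w"
proof -
  obtain us where us: "us \<in> lists S" "length us = len w" "wprod us = w"
    using reduced_word_exists[OF assms(2)] .
  then obtain xs r ys where "us = xs @ r # ys" "s \<otimes> wprod us = wprod (xs @ ys)"
    using exchange[of s us] assms by auto
  then show ?thesis using len_le[of "xs @ ys"] us by auto
qed

text \<open>Induction from the right end of \<open>us\<close>. Every generator is a descent of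
  \<open>w0\<close>, so exchange frees a letter of \<open>us @ vs\<close> to make room for
  \<open>s\<close> in front. The letter cannot come from \<open>us\<close>, since
  \<open>s # us\<close> is reduced, so it comes from \<open>vs\<close>.\<close>

lemma longest_element_prefix:
  assumes "longest_element W S w0" "us \<in> lists S" "reduced us"
  shows "\<exists>vs. reduced (us @ vs) \<and> wprod (us @ vs) = w0"
  using assms(2,3)
proof (induction us rule: list.induct)
  case Nil
  obtain us where "us \<in> lists S" "length us = len w0" "wprod us = w0"
    using reduced_word_exists[of w0] assms(1) unfolding longest_element_def by auto
  then show ?case unfolding reduced_def by auto
next
  case (Cons s us)
  then obtain vs where vs: "reduced (us @ vs)" "wprod (us @ vs) = w0" using reduced_Cons by auto
  have s: "s \<in> S" "us \<in> lists S" "vs \<in> lists S" using Cons.prems vs unfolding reduced_def by auto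
  have "w0 \<in> carrier W" "len (s \<otimes> w0) \<le> len w0"
    using assms(1) s unfolding longest_element_def by auto
  then obtain xs r ys where del: "us @ vs = xs @ r # ys" "s \<otimes> w0 = wprod (xs @ ys)"
    using exchange[of s "us @ vs"] vs s by auto
  show ?case
  proof (cases "length xs < length us")
    case True
    then obtain ys' where us: "us = xs @ r # ys'" and ys: "ys = ys' @ vs"
      using append_eq_append_Cons_cases[OF del(1)] by auto
    have l: "xs \<in> lists S" "ys' \<in> lists S" using us s by auto
    have "s \<otimes> wprod us \<otimes> wprod vs = wprod (xs @ ys') \<otimes> wprod vs"
      using del(2) ys vs(2)[symmetric] s l by (simp add: wprod_append m_assoc)
    then have "s \<otimes> wprod us = wprod (xs @ ys')" using s l by (subst (asm) right_cancel) auto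
    then have "len (wprod (s # us)) \<le> length (xs @ ys')" using len_le[of "xs @ ys'"] l by simp
    then show ?thesis using Cons.prems(2) us unfolding reduced_def by simp
  next
    case False
    then obtain zs where xs: "xs = us @ zs" and vs': "vs = zs @ r # ys"
      using append_eq_append_Cons_cases[OF del(1)] by auto
    let ?q = "(s # us) @ zs @ ys"
    have q: "?q \<in> lists S" using s vs' by auto
    have "wprod ?q = s \<otimes> (s \<otimes> w0)" using del(2) xs by simp
    then have "wprod ?q = w0" using s \<open>w0 \<in> carrier W\<close> by simp
    moreover have "length ?q = length (us @ vs)" using vs' by simp
    ultimately have "reduced ?q" using vs q unfolding reduced_def by metis
    then show ?thesis using \<open>wprod ?q = w0\<close> by blast
  qed
qed

text \<open>Start a reduced word of \<open>w0\<close> with a reduced word of the inverse of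
  \<open>w\<close>; what remains is a reduced word of \<open>w \<otimes> w0\<close>.\<close>

lemma len_mult_longest:
  assumes "longest_element W S w0" "w \<in> carrier W"
  shows "len (w \<otimes> w0) + len w = len w0"
proof -
  obtain us where us: "us \<in> lists S" "length us = len (inv w)" "wprod us = inv w"
    using reduced_word_exists[of "inv w"] assms(2) by auto
  then obtain vs where vs: "reduced (us @ vs)" "wprod (us @ vs) = w0"
    using longest_element_prefix[OF assms(1), of us] unfolding reduced_def by auto
  then have "reduced vs" using reduced_append(2) by blast
  then have l: "vs \<in> lists S" "reduced vs" unfolding reduced_def by auto
  have "w \<otimes> w0 = w \<otimes> (inv w \<otimes> wprod vs)"
    using vs(2) us l by (simp add: wprod_append)
  also have "\<dots> = wprod vs" using assms l us by (simp add: m_assoc[symmetric])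
  finally have "len (w \<otimes> w0) = length vs" using l(2) unfolding reduced_def by simp
  then show ?thesis using vs us len_inv[OF assms(2)] unfolding reduced_def by simp
qed

lemma len_eq_0:
  assumes "w \<in> carrier W" "len w = 0"
  shows "w = \<one>"
proof -
  obtain us where "us \<in> lists S" "length us = len w" "wprod us = w"
    using reduced_word_exists[OF assms(1)] .
  then show ?thesis using assms(2) by auto
qed

lemma longest_element_involution:
  assumes "longest_element W S w0"
  shows "w0 \<otimes> w0 = \<one>"
proof -
  have "w0 \<in> carrier W" using assms unfolding longest_element_def by auto
  then show ?thesis using len_mult_longest[OF assms, of w0] len_eq_0 by auto
qed

lemma len_longest_mult_gen:
  assumes "longest_element W S w0" "s \<in> S"
  shows "len s = 1" "len (w0 \<otimes> s) + 1 = len w0"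
proof -
  have w0: "w0 \<in> carrier W" using assms unfolding longest_element_def by auto
  have inv: "inv w0 = w0" using longest_element_involution[OF assms(1)] w0 by (simp add: inv_equality)
  \<comment> \<open>The strict drop at \<open>w0\<close> also shows that \<open>s\<close> is not the
    identity.\<close>
  have "len (s \<otimes> w0) < len w0"
    using len_gen_mult_less[OF assms(2) w0] assms w0 unfolding longest_element_def by auto
  then have "len s \<noteq> 0" using len_mult_longest[OF assms(1), of s] assms by auto
  moreover have "len s \<le> 1" using len_le[of "[s]"] assms by simp
  ultimately show "len s = 1" by simp
  then have "len (s \<otimes> w0) + 1 = len w0" using len_mult_longest[OF assms(1), of s] assms by auto
  moreover have "len (w0 \<otimes> s) = len (s \<otimes> w0)"
    using len_inv[of "s \<otimes> w0"] assms w0 inv by (simp add: inv_mult_group)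
  ultimately show "len (w0 \<otimes> s) + 1 = len w0" by simp
qed

text \<open>\<open>len_mult_longest\<close> for \<open>w0 \<otimes> s\<close> gives the conjugate
  the length len w0 - len (w0 s) = 1.\<close>

lemma longest_element_conj_gen:
  assumes "longest_element W S w0" "s \<in> S"
  shows "w0 \<otimes> s \<otimes> w0 \<in> S"
proof -
  have w0: "w0 \<in> carrier W" using assms unfolding longest_element_def by auto
  have "len (w0 \<otimes> s \<otimes> w0) = 1"
    using len_mult_longest[OF assms(1), of "w0 \<otimes> s"] len_longest_mult_gen[OF assms] assms w0 by simp
  moreover obtain us where "us \<in> lists S" "length us = len (w0 \<otimes> s \<otimes> w0)" "wprod us = w0 \<otimes> s \<otimes> w0"
    using reduced_word_exists[of "w0 \<otimes> s \<otimes> w0"] w0 assms by auto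
  ultimately show ?thesis by (cases us) auto
qed

end


section \<open>Presented groups\<close>

lemma pres_eq_in_lists:
  "pres_eq S Rel w w' \<Longrightarrow> w \<in> lists (S \<times> UNIV) \<and> w' \<in> lists (S \<times> UNIV)"
  by (induction rule: pres_eq.induct) (auto simp: in_lists_conv_set)

lemma pres_class_eq_iff:
  assumes "w \<in> lists (S \<times> UNIV)"
  shows "pres_class S Rel w = pres_class S Rel w' \<longleftrightarrow> pres_eq S Rel w w'"
proof
  assume "pres_class S Rel w = pres_class S Rel w'"
  moreover have "w \<in> pres_class S Rel w" using assms by (simp add: pres_class_def pres_eq.refl)
  ultimately show "pres_eq S Rel w w'" by (simp add: pres_class_def pres_eq.sym)
next
  assume "pres_eq S Rel w w'"
  then show "pres_class S Rel w = pres_class S Rel w'"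
    unfolding pres_class_def using pres_eq.sym pres_eq.trans by blast
qed

lemma pres_eq_context:
  assumes "pres_eq S Rel w w'" "x \<in> lists (S \<times> UNIV)" "y \<in> lists (S \<times> UNIV)"
  shows "pres_eq S Rel (x @ w @ y) (x @ w' @ y)"
  using assms
proof (induction rule: pres_eq.induct)
  case (cancel x' y' s b)
  then show ?case using pres_eq.cancel[of "x @ x'" S "y' @ y" s Rel b] by simp
next
  case (rel x' y' l r)
  then show ?case using pres_eq.rel[of "x @ x'" S "y' @ y" l r Rel] by simp
qed (auto intro: pres_eq.refl pres_eq.sym pres_eq.trans)

lemma pres_eq_append:
  assumes "pres_eq S Rel w w'" "pres_eq S Rel u u'"
  shows "pres_eq S Rel (w @ u) (w' @ u')"
proof (rule pres_eq.trans)
  show "pres_eq S Rel (w @ u) (w' @ u)"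
    using pres_eq_context[OF assms(1), of "[]" u] pres_eq_in_lists[OF assms(2)] by simp
  show "pres_eq S Rel (w' @ u) (w' @ u')"
    using pres_eq_context[OF assms(2), of w' "[]"] pres_eq_in_lists[OF assms(1)] by simp
qed

text \<open>The product is defined as a union over all representatives; by
  \<open>pres_eq_append\<close> all classes in that union coincide.\<close>

lemma presented_group_mult:
  assumes "w \<in> lists (S \<times> UNIV)" "u \<in> lists (S \<times> UNIV)"
  shows "pres_class S Rel w \<otimes>\<^bsub>presented_group S Rel\<^esub> pres_class S Rel u = pres_class S Rel (w @ u)"
proof -
  have "pres_class S Rel (a @ b) = pres_class S Rel (w @ u)"
    if "a \<in> pres_class S Rel w" "b \<in> pres_class S Rel u" for a b
    using that pres_eq_append[of S Rel w a u b] assms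
    by (subst eq_commute, subst pres_class_eq_iff) (auto simp: pres_class_def)
  then have "(\<Union>a\<in>pres_class S Rel w. \<Union>b\<in>pres_class S Rel u. pres_class S Rel (a @ b)) =
      (\<Union>a\<in>pres_class S Rel w. \<Union>b\<in>pres_class S Rel u. pres_class S Rel (w @ u))"
    by (intro SUP_cong HOL.refl)
  also have "\<dots> = pres_class S Rel (w @ u)"
  proof -
    have "pres_class S Rel w \<noteq> {}" "pres_class S Rel u \<noteq> {}"
      using assms by (auto simp: pres_class_def intro: pres_eq.refl)
    then show ?thesis by simp
  qed
  finally show ?thesis by (simp add: presented_group_def)
qed

lemma presented_group_carrier:
  "carrier (presented_group S Rel) = pres_class S Rel ` lists (S \<times> UNIV)"
  "\<one>\<^bsub>presented_group S Rel\<^esub> = pres_class S Rel []"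
  by (simp_all add: presented_group_def)

lemma monoid_presented_group: "monoid (presented_group S Rel)"
  by (rule monoidI) (auto simp: presented_group_carrier presented_group_mult)

lemma presented_group_cancel:
  assumes "s \<in> S"
  shows "pres_class S Rel [(s, b)] \<otimes>\<^bsub>presented_group S Rel\<^esub> pres_class S Rel [(s, \<not> b)] =
    \<one>\<^bsub>presented_group S Rel\<^esub>"
  using assms pres_eq.cancel[of "[]" S "[]" s Rel b]
  by (simp add: presented_group_mult presented_group_carrier pres_class_eq_iff)

text \<open>The isomorphism sends a word to the product of its letters with signs forgotten.
  Surjectivity then gives generation, and injectivity gives \<open>presentation\<close>.\<close>

lemma coxeter_system_imp_coxeter_group:
  fixes W (structure)
  assumes "coxeter_system W S"
  shows "coxeter_group W S"
proof -
  interpret group W using assms by (simp add: coxeter_system_def)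
  let ?R = "coxeter_relations W S"
  let ?P = "presented_group S ?R"
  interpret P: monoid ?P by (rule monoid_presented_group)
  have S: "S \<subseteq> carrier W" and ord: "\<And>s. s \<in> S \<Longrightarrow> ord s = 2"
    using assms by (auto simp: coxeter_system_def)
  have inv: "s \<otimes> s = \<one>" if "s \<in> S" for s
    using pow_ord_eq_1[of s] ord[OF that] S that by (auto simp: numeral_2_eq_2)
  obtain f where f: "f \<in> iso ?P W" and fs: "\<And>s. s \<in> S \<Longrightarrow> f (pres_class S ?R [(s, True)]) = s"
    using assms by (auto simp: coxeter_system_def)
  have hom: "f \<in> hom ?P W" and inj: "inj_on f (carrier ?P)" and surj: "f ` carrier ?P = carrier W"
    using f by (auto simp: iso_def bij_betw_def)
  \<comment> \<open>Membership in \<open>hom\<close> only gives multiplicativity; the image of the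
    identity is an idempotent of a group.\<close>
  have one: "f \<one>\<^bsub>?P\<^esub> = \<one>"
    using hom_mult[OF hom, of "\<one>\<^bsub>?P\<^esub>" "\<one>\<^bsub>?P\<^esub>"] hom_in_carrier[OF hom, of "\<one>\<^bsub>?P\<^esub>"] by simp
  have letter: "f (pres_class S ?R [(s, b)]) = s" if "s \<in> S" for s b
  proof (cases b)
    case False
    have *: "pres_class S ?R [(s, c)] \<in> carrier ?P" for c
      using that by (auto simp: presented_group_carrier)
    have "s \<otimes> f (pres_class S ?R [(s, False)]) = \<one>"
      using hom_mult[OF hom *[of True] *[of False]] presented_group_cancel[OF that, of ?R True] fs[OF that] one
      by simp
    then have "s \<otimes> s \<otimes> f (pres_class S ?R [(s, False)]) = s"
      using hom_in_carrier[OF hom *[of False]] S that by (auto simp: m_assoc)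
    then show ?thesis
      using False inv[OF that] hom_in_carrier[OF hom *[of False]] by simp
  qed (use fs that in simp)
  have f_eq: "f (pres_class S ?R w) = foldr (\<otimes>) (map fst w) \<one>" if "w \<in> lists (S \<times> UNIV)" for w
    using that
  proof (induction w)
    case Nil
    then show ?case using one by (simp add: presented_group_carrier)
  next
    case (Cons x w)
    then obtain s b where x: "x = (s, b)" "s \<in> S" by auto
    have "pres_class S ?R (x # w) = pres_class S ?R [(s, b)] \<otimes>\<^bsub>?P\<^esub> pres_class S ?R w"
      using Cons x by (simp add: presented_group_mult in_lists_conv_set)
    then have "f (pres_class S ?R (x # w)) = s \<otimes> f (pres_class S ?R w)"
      using Cons x hom_mult[OF hom, of "pres_class S ?R [(s, b)]" "pres_class S ?R w"] letter[of s b]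
      by (simp add: presented_group_carrier)
    then show ?case using Cons x by simp
  qed
  show ?thesis
  proof
    show "S \<subseteq> carrier W" by fact
    show "\<And>s. s \<in> S \<Longrightarrow> s \<otimes> s = \<one>" by fact
    show "\<exists>us \<in> lists S. foldr (\<otimes>) us \<one> = w" if "w \<in> carrier W" for w
    proof -
      obtain u where u: "u \<in> lists (S \<times> UNIV)" "w = f (pres_class S ?R u)"
        using surj \<open>w \<in> carrier W\<close> by (auto simp: presented_group_carrier)
      then have "map fst u \<in> lists S" by (auto simp: in_lists_conv_set)
      then show ?thesis using u f_eq by auto
    qed
    show "pres_eq S ?R (map (\<lambda>s. (s, True)) us) (map (\<lambda>s. (s, True)) vs)"
      if "us \<in> lists S" "vs \<in> lists S" "foldr (\<otimes>) us \<one> = foldr (\<otimes>) vs \<one>" for us vs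
    proof -
      let ?u = "map (\<lambda>s. (s, True)) us" and ?v = "map (\<lambda>s. (s, True)) vs"
      have l: "?u \<in> lists (S \<times> UNIV)" "?v \<in> lists (S \<times> UNIV)"
        using that by (auto simp: in_lists_conv_set)
      have "f (pres_class S ?R ?u) = f (pres_class S ?R ?v)"
        using that(3) by (simp add: f_eq[OF l(1)] f_eq[OF l(2)] comp_def)
      then have "pres_class S ?R ?u = pres_class S ?R ?v"
        by (rule inj_onD[OF inj]) (use l in \<open>simp_all add: presented_group_carrier\<close>)
      then show ?thesis using l by (simp add: pres_class_eq_iff)
    qed
  qed
qed


section \<open>Monoid rings\<close>

abbreviation (input) "keys \<equiv> Poly_Mapping.keys"
abbreviation (input) "lookup \<equiv> Poly_Mapping.lookup"
abbreviation (input) "single \<equiv> Poly_Mapping.single"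

lemma monoid_ring_simps [simp]:
  "carrier (monoid_ring G) = {f. keys f \<subseteq> carrier G}"
  "\<one>\<^bsub>monoid_ring G\<^esub> = single \<one>\<^bsub>G\<^esub> 1"
  "\<zero>\<^bsub>monoid_ring G\<^esub> = 0"
  "f \<oplus>\<^bsub>monoid_ring G\<^esub> g = f + g"
  by (simp_all add: monoid_ring_def)

lemma poly_mapping_sum_single:
  assumes "finite A" "keys f \<subseteq> A"
  shows "f = (\<Sum>a\<in>A. single a (lookup f a))"
proof (rule poly_mapping_eqI)
  fix k
  have "(\<Sum>a\<in>A. lookup (single a (lookup f a)) k) =
      (\<Sum>a\<in>A. if a = k then lookup f k else 0)"
    by (intro sum.cong) (auto simp: lookup_single)
  also have "\<dots> = lookup f k" using assms by (auto simp: in_keys_iff)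
  finally show "lookup f k =
      lookup (\<Sum>a\<in>A. single a (lookup f a)) k"
    by (simp add: lookup_sum)
qed

lemma keys_add_subset:
  "keys f \<subseteq> A \<Longrightarrow> keys g \<subseteq> A \<Longrightarrow> keys (f + g) \<subseteq> A"
  using Poly_Mapping.keys_add[of f g] by blast

lemma poly_mapping_keys_induct [consumes 1, case_names zero single add]:
  fixes f :: "'g \<Rightarrow>\<^sub>0 'k::comm_monoid_add"
  assumes "keys f \<subseteq> A"
    and "P 0"
    and "\<And>a x. a \<in> A \<Longrightarrow> P (single a x)"
    and "\<And>f g. keys f \<subseteq> A \<Longrightarrow> keys g \<subseteq> A \<Longrightarrow> P f \<Longrightarrow> P g \<Longrightarrow> P (f + g)"
  shows "P f"
proof -
  have "keys (\<Sum>a\<in>B. single a (lookup f a)) \<subseteq> A \<and>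
      P (\<Sum>a\<in>B. single a (lookup f a))" if "finite B" "B \<subseteq> A" for B
    using that
  proof (induction B rule: finite_induct)
    case (insert b B)
    have "keys (single b (lookup f b)) \<subseteq> A"
      using insert.prems by auto
    moreover have "P (single b (lookup f b))"
      using insert.prems assms(3) by auto
    ultimately show ?case
      using insert assms(4) by (simp add: keys_add_subset)
  qed (use assms(2) in auto)
  from this[of "keys f"] show ?thesis
    using assms(1) by (simp add: poly_mapping_sum_single[of "keys f" f, symmetric])
qed

text \<open>\<open>\<psi> a x\<close> is the intended image of the term x a. The coefficient is an
  argument of \<open>\<psi>\<close> rather than a factor, because the lift may change the
  coefficient ring.\<close>

definition pm_lift :: "('g \<Rightarrow> 'k \<Rightarrow> 'x) \<Rightarrow> ('g \<Rightarrow>\<^sub>0 'k::zero) \<Rightarrow> 'x::comm_monoid_add" where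
  "pm_lift \<psi> f = (\<Sum>a\<in>keys f. \<psi> a (lookup f a))"

context
  fixes \<psi> :: "'g \<Rightarrow> 'k::ab_group_add \<Rightarrow> 'x::ab_group_add"
  assumes additive: "\<And>a x y. \<psi> a (x + y) = \<psi> a x + \<psi> a y"
begin

lemma pm_lift_coeff_zero: "\<psi> a 0 = 0"
  using additive[of a 0 0] by simp

lemma pm_lift_superset:
  assumes "finite A" "keys f \<subseteq> A"
  shows "pm_lift \<psi> f = (\<Sum>a\<in>A. \<psi> a (lookup f a))"
  unfolding pm_lift_def using assms
  by (intro sum.mono_neutral_left) (auto simp: pm_lift_coeff_zero in_keys_iff)

lemma pm_lift_single: "pm_lift \<psi> (single a x) = \<psi> a x"
  by (subst pm_lift_superset[of "{a}"]) auto

lemma pm_lift_zero: "pm_lift \<psi> 0 = 0"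
  by (simp add: pm_lift_def)

lemma pm_lift_add: "pm_lift \<psi> (f + g) = pm_lift \<psi> f + pm_lift \<psi> g"
proof -
  let ?A = "keys f \<union> keys g"
  have "pm_lift \<psi> h = (\<Sum>a\<in>?A. \<psi> a (lookup h a))" if "h \<in> {f, g, f + g}" for h
    using that Poly_Mapping.keys_add[of f g] by (intro pm_lift_superset) auto
  then show ?thesis by (simp add: lookup_add additive sum.distrib)
qed

end

text \<open>Convolution as an iterated lift, so that distributivity on both sides becomes an
  instance of \<open>pm_lift_add\<close>.\<close>

lemma monoid_ring_mult_alt:
  "f \<otimes>\<^bsub>monoid_ring G\<^esub> g =
    pm_lift (\<lambda>a x. pm_lift (\<lambda>b y. single (a \<otimes>\<^bsub>G\<^esub> b) (x * y)) g) f"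
  by (simp add: monoid_ring_def pm_lift_def)

lemma monoid_ring_add_right:
  "f \<otimes>\<^bsub>monoid_ring G\<^esub> (g + h) = f \<otimes>\<^bsub>monoid_ring G\<^esub> g + f \<otimes>\<^bsub>monoid_ring G\<^esub> h"
  unfolding monoid_ring_mult_alt
  by (subst pm_lift_add) (auto simp: single_add algebra_simps pm_lift_def sum.distrib)

lemma monoid_ring_add_left:
  "(f + g) \<otimes>\<^bsub>monoid_ring G\<^esub> h = f \<otimes>\<^bsub>monoid_ring G\<^esub> h + g \<otimes>\<^bsub>monoid_ring G\<^esub> h"
  unfolding monoid_ring_mult_alt
  by (subst pm_lift_add) (auto simp: single_add algebra_simps pm_lift_def sum.distrib)

lemma monoid_ring_zero_mult [simp]:
  "0 \<otimes>\<^bsub>monoid_ring G\<^esub> h = 0" "h \<otimes>\<^bsub>monoid_ring G\<^esub> 0 = 0"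
  by (simp_all add: monoid_ring_def)

lemma monoid_ring_diff_left:
  "(f - g) \<otimes>\<^bsub>monoid_ring G\<^esub> h = f \<otimes>\<^bsub>monoid_ring G\<^esub> h - g \<otimes>\<^bsub>monoid_ring G\<^esub> h"
  using monoid_ring_add_left[of G "f - g" g h] by (simp add: algebra_simps)

lemma monoid_ring_single_mult:
  "single a x \<otimes>\<^bsub>monoid_ring G\<^esub> single b y =
    single (a \<otimes>\<^bsub>G\<^esub> b) (x * y)"
proof -
  have "pm_lift (\<lambda>b y. single (a \<otimes>\<^bsub>G\<^esub> b) (x * y)) (single b y) =
      single (a \<otimes>\<^bsub>G\<^esub> b) (x * y)"
    by (rule pm_lift_single) (simp add: single_add distrib_left)
  then show ?thesis
    unfolding monoid_ring_mult_alt
    by (subst pm_lift_single) (simp_all add: pm_lift_def single_add distrib_right sum.distrib)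
qed

lemma ring_monoid_ring:
  assumes "monoid G"
  shows "ring (monoid_ring G :: ('g \<Rightarrow>\<^sub>0 'k::comm_ring_1) ring)"
proof (rule ringI)
  interpret monoid G by fact
  let ?R = "monoid_ring G :: ('g \<Rightarrow>\<^sub>0 'k) ring"
  show "abelian_group ?R"
  proof (rule abelian_groupI)
    fix x assume "x \<in> carrier ?R"
    then show "\<exists>y\<in>carrier ?R. y \<oplus>\<^bsub>?R\<^esub> x = \<zero>\<^bsub>?R\<^esub>"
      by (intro bexI[of _ "- x"]) (auto simp: in_keys_iff)
  qed (auto simp: algebra_simps keys_add_subset)
  have closed: "x \<otimes>\<^bsub>?R\<^esub> y \<in> carrier ?R" if "x \<in> carrier ?R" "y \<in> carrier ?R" for x y
  proof -
    have "keys x \<subseteq> carrier G" "keys y \<subseteq> carrier G" using that by auto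
    then show ?thesis
    proof (induction x rule: poly_mapping_keys_induct)
      case (single a c)
      from single(2) show ?case
      proof (induction y rule: poly_mapping_keys_induct)
        case (add f g)
        then show ?case by (simp add: monoid_ring_add_right keys_add_subset)
      qed (use single in \<open>auto simp: monoid_ring_single_mult\<close>)
    next
      case (add f g)
      then show ?case by (simp add: monoid_ring_add_left keys_add_subset)
    qed auto
  qed
  show "monoid ?R"
  proof (rule monoidI)
    fix x y z assume xyz: "x \<in> carrier ?R" "y \<in> carrier ?R" "z \<in> carrier ?R"
    then have k: "keys x \<subseteq> carrier G" "keys y \<subseteq> carrier G"
      "keys z \<subseteq> carrier G" by auto
    show "x \<otimes>\<^bsub>?R\<^esub> y \<otimes>\<^bsub>?R\<^esub> z = x \<otimes>\<^bsub>?R\<^esub> (y \<otimes>\<^bsub>?R\<^esub> z)"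
      using k(1)
    proof (induction x rule: poly_mapping_keys_induct)
      case (single a c)
      show ?case using k(2)
      proof (induction y rule: poly_mapping_keys_induct)
        case (single b d)
        show ?case using k(3)
          by (induction z rule: poly_mapping_keys_induct)
            (use single \<open>a \<in> carrier G\<close> in \<open>auto simp: monoid_ring_single_mult monoid_ring_add_right m_assoc mult.assoc\<close>)
      qed (auto simp: monoid_ring_add_left monoid_ring_add_right)
    qed (auto simp: monoid_ring_add_left)
  next
    fix x assume "x \<in> carrier ?R"
    then have k: "keys x \<subseteq> carrier G" by auto
    then show "\<one>\<^bsub>?R\<^esub> \<otimes>\<^bsub>?R\<^esub> x = x"
      by (induction x rule: poly_mapping_keys_induct)
        (auto simp: monoid_ring_single_mult monoid_ring_add_right)
    from k show "x \<otimes>\<^bsub>?R\<^esub> \<one>\<^bsub>?R\<^esub> = x"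
      by (induction x rule: poly_mapping_keys_induct)
        (auto simp: monoid_ring_single_mult monoid_ring_add_left)
  qed (use closed in auto)
qed (auto simp: monoid_ring_add_left monoid_ring_add_right)

lemma monoid_ring_a_inv:
  fixes f :: "'g \<Rightarrow>\<^sub>0 'k::comm_ring_1"
  assumes "monoid G" "f \<in> carrier (monoid_ring G)"
  shows "\<ominus>\<^bsub>monoid_ring G\<^esub> f = - f"
proof -
  interpret ring "monoid_ring G :: ('g \<Rightarrow>\<^sub>0 'k) ring" by (rule ring_monoid_ring) fact
  show ?thesis using assms by (intro minus_equality) (auto simp: in_keys_iff)
qed

text \<open>The universal property of the monoid ring. The target is again a monoid ring because
  \<open>pm_lift\<close> sums with the addition of a type.\<close>

lemma pm_lift_ring_hom:
  fixes \<psi> :: "'g \<Rightarrow> 'k::comm_ring_1 \<Rightarrow> ('h \<Rightarrow>\<^sub>0 'l::comm_ring_1)"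
  assumes "monoid G" "monoid H"
    and add: "\<And>a x y. \<psi> a (x + y) = \<psi> a x + \<psi> a y"
    and closed: "\<And>a x. a \<in> carrier G \<Longrightarrow> \<psi> a x \<in> carrier (monoid_ring H)"
    and mult: "\<And>a b x y. a \<in> carrier G \<Longrightarrow> b \<in> carrier G \<Longrightarrow>
      \<psi> (a \<otimes>\<^bsub>G\<^esub> b) (x * y) = \<psi> a x \<otimes>\<^bsub>monoid_ring H\<^esub> \<psi> b y"
    and one: "\<psi> \<one>\<^bsub>G\<^esub> 1 = \<one>\<^bsub>monoid_ring H\<^esub>"
  shows "pm_lift \<psi> \<in> ring_hom (monoid_ring G) (monoid_ring H)"
proof (rule ring_hom_memI)
  interpret H: ring "monoid_ring H :: ('h \<Rightarrow>\<^sub>0 'l) ring" by (rule ring_monoid_ring) fact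
  note lift = pm_lift_single[of \<psi>, OF add] pm_lift_add[of \<psi>, OF add] pm_lift_zero[of \<psi>, OF add]
  fix f :: "'g \<Rightarrow>\<^sub>0 'k" assume "f \<in> carrier (monoid_ring G)"
  then have f: "keys f \<subseteq> carrier G" by simp
  then show "pm_lift \<psi> f \<in> carrier (monoid_ring H)"
  proof (induction f rule: poly_mapping_keys_induct)
    case (add f g)
    then show ?case by (simp add: lift keys_add_subset)
  qed (use closed lift in auto)
  fix g :: "'g \<Rightarrow>\<^sub>0 'k" assume "g \<in> carrier (monoid_ring G)"
  then have g: "keys g \<subseteq> carrier G" by simp
  show "pm_lift \<psi> (f \<otimes>\<^bsub>monoid_ring G\<^esub> g) = pm_lift \<psi> f \<otimes>\<^bsub>monoid_ring H\<^esub> pm_lift \<psi> g"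
    using f
  proof (induction f rule: poly_mapping_keys_induct)
    case (single a x)
    show ?case using g
      by (induction g rule: poly_mapping_keys_induct)
        (use single in \<open>auto simp: monoid_ring_single_mult monoid_ring_add_right lift mult\<close>)
  qed (auto simp: monoid_ring_add_left lift)
  show "pm_lift \<psi> (f \<oplus>\<^bsub>monoid_ring G\<^esub> g) = pm_lift \<psi> f \<oplus>\<^bsub>monoid_ring H\<^esub> pm_lift \<psi> g"
    by (simp add: lift)
next
  show "pm_lift \<psi> \<one>\<^bsub>monoid_ring G\<^esub> = \<one>\<^bsub>monoid_ring H\<^esub>"
    using one by (simp add: pm_lift_single[of \<psi>, OF add])
qed

text \<open>The kernel of \<open>h\<close> is an ideal containing \<open>E\<close>, hence contains
  the ideal generated by it. This serves both the Hecke algebra and the tensor product, which are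
  defined as quotients by generated ideals.\<close>

lemma genideal_quot_lift:
  assumes "ring B" "ring A" "h \<in> ring_hom B A" "E \<subseteq> carrier B"
    and "\<And>x. x \<in> E \<Longrightarrow> h x = \<zero>\<^bsub>A\<^esub>"
  obtains g where "g \<in> ring_hom (B Quot (Idl\<^bsub>B\<^esub> E)) A"
    and "\<And>x. x \<in> carrier B \<Longrightarrow> g (Idl\<^bsub>B\<^esub> E +>\<^bsub>B\<^esub> x) = h x"
proof -
  interpret B: ring B by fact
  interpret A: ring A by fact
  interpret h: ring_hom_ring B A h by (rule ring_hom_ringI2) fact+
  define I where "I = Idl\<^bsub>B\<^esub> E"
  interpret I: ideal I B unfolding I_def by (rule B.genideal_ideal) fact
  have "E \<subseteq> a_kernel B A h" using assms(4,5) unfolding a_kernel_def' by blast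
  then have ker: "I \<subseteq> a_kernel B A h" unfolding I_def by (rule B.genideal_minimal[OF h.kernel_is_ideal])
  define g where "g Y = the_elem (h ` Y)" for Y
  have g: "g (I +>\<^bsub>B\<^esub> x) = h x" if x: "x \<in> carrier B" for x
  proof -
    have "h (i \<oplus>\<^bsub>B\<^esub> x) = h x" if "i \<in> I" for i
    proof -
      have "i \<in> a_kernel B A h" using that ker by blast
      then have "i \<in> carrier B" "h i = \<zero>\<^bsub>A\<^esub>" unfolding a_kernel_def' by auto
      then show ?thesis using x by simp
    qed
    then have "h ` (I +>\<^bsub>B\<^esub> x) \<subseteq> {h x}" by (auto simp: a_r_coset_def')
    moreover have "h ` (I +>\<^bsub>B\<^esub> x) \<noteq> {}"
      using I.a_rcos_self[OF x] by auto
    ultimately have "h ` (I +>\<^bsub>B\<^esub> x) = {h x}" by (simp only: subset_singleton_iff simp_thms)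
    then show ?thesis by (simp add: g_def)
  qed
  have rep: "\<exists>x\<in>carrier B. Y = I +>\<^bsub>B\<^esub> x" if "Y \<in> carrier (B Quot I)" for Y
    using that by (auto simp: FactRing_simps)
  have "g \<in> ring_hom (B Quot I) A"
  proof (rule ring_hom_memI)
    fix Y Z assume Y: "Y \<in> carrier (B Quot I)" and Z: "Z \<in> carrier (B Quot I)"
    obtain y z where y: "y \<in> carrier B" "Y = I +>\<^bsub>B\<^esub> y" and z: "z \<in> carrier B" "Z = I +>\<^bsub>B\<^esub> z"
      using rep[OF Y] rep[OF Z] by auto
    show "g (Y \<otimes>\<^bsub>B Quot I\<^esub> Z) = g Y \<otimes>\<^bsub>A\<^esub> g Z"
      using y z ring_hom_mult[OF I.rcos_ring_hom, of y z, symmetric] by (simp add: g)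
    show "g (Y \<oplus>\<^bsub>B Quot I\<^esub> Z) = g Y \<oplus>\<^bsub>A\<^esub> g Z"
      using y z ring_hom_add[OF I.rcos_ring_hom, of y z, symmetric] by (simp add: g)
  next
    fix Y assume "Y \<in> carrier (B Quot I)"
    then show "g Y \<in> carrier A" using rep g by fastforce
  next
    show "g \<one>\<^bsub>B Quot I\<^esub> = \<one>\<^bsub>A\<^esub>"
      using ring_hom_one[OF I.rcos_ring_hom, symmetric] by (simp add: g)
  qed
  then show ?thesis using g that unfolding I_def by blast
qed


section \<open>Finitely generated algebras over power series\<close>

text \<open>The module structure is given by a ring homomorphism with central image. Injectivity is
  not part of the notion, so torsion is allowed.\<close>

locale fps_algebra = ring A for A (structure) +
  fixes \<phi> :: "'k::field_char_0 fps \<Rightarrow> 'a"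
  assumes scalar_closed [simp, intro]: "\<phi> f \<in> carrier A"
    and scalar_one: "\<phi> 1 = \<one>"
    and scalar_add: "\<phi> (f + g) = \<phi> f \<oplus> \<phi> g"
    and scalar_mult: "\<phi> (f * g) = \<phi> f \<otimes> \<phi> g"
    and scalar_central: "x \<in> carrier A \<Longrightarrow> x \<otimes> \<phi> f = \<phi> f \<otimes> x"
begin

text \<open>Cancellation rules for the situation that sorting with \<open>a_ac\<close> leaves
  behind, where a third term stands between \<open>x\<close> and its negative.\<close>

lemma neg_cancel:
  assumes "x \<in> carrier A" "y \<in> carrier A"
  shows "x \<oplus> (y \<oplus> \<ominus> x) = y" "\<ominus> x \<oplus> (y \<oplus> x) = y"
    and "z \<in> carrier A \<Longrightarrow> x \<oplus> (y \<oplus> (\<ominus> x \<oplus> z)) = y \<oplus> z"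
    and "z \<in> carrier A \<Longrightarrow> \<ominus> x \<oplus> (y \<oplus> (x \<oplus> z)) = y \<oplus> z"
  using assms by (simp_all add: a_lcomm[of x y] a_lcomm[of "\<ominus> x" y] r_neg l_neg r_neg r_neg1 r_neg2)

lemma diff_add_cancel: "x \<in> carrier A \<Longrightarrow> y \<in> carrier A \<Longrightarrow> x \<oplus> (y \<ominus> x) = y"
  by (simp add: minus_eq neg_cancel)

lemma add_diff_cancel: "x \<in> carrier A \<Longrightarrow> y \<in> carrier A \<Longrightarrow> x \<oplus> y \<ominus> x = y"
  by (simp add: minus_eq a_assoc neg_cancel)

definition scale :: "'k fps \<Rightarrow> 'a \<Rightarrow> 'a" where
  "scale f x = \<phi> f \<otimes> x"

lemma scale_closed [simp, intro]: "x \<in> carrier A \<Longrightarrow> scale f x \<in> carrier A"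
  by (simp add: scale_def)

lemma scale_add_left: "x \<in> carrier A \<Longrightarrow> scale (f + g) x = scale f x \<oplus> scale g x"
  by (simp add: scale_def scalar_add l_distr)

lemma scale_add_right: "x \<in> carrier A \<Longrightarrow> y \<in> carrier A \<Longrightarrow> scale f (x \<oplus> y) = scale f x \<oplus> scale f y"
  by (simp add: scale_def r_distr)

lemma scale_scale: "x \<in> carrier A \<Longrightarrow> scale f (scale g x) = scale (f * g) x"
  by (simp add: scale_def scalar_mult m_assoc)

lemma scale_one [simp]: "x \<in> carrier A \<Longrightarrow> scale 1 x = x"
  by (simp add: scale_def scalar_one)

lemma scale_zero_right [simp]: "scale f \<zero> = \<zero>"
  by (simp add: scale_def)

lemma scale_zero_left [simp]: "x \<in> carrier A \<Longrightarrow> scale 0 x = \<zero>"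
  using scale_add_left[of x 0 0] by (simp add: add.l_cancel_one')

lemma scale_minus_one: "x \<in> carrier A \<Longrightarrow> scale (- 1) x = \<ominus> x"
  using scale_add_left[of x "- 1" 1] by (intro minus_equality[symmetric]) auto

lemma scale_minus_right: "x \<in> carrier A \<Longrightarrow> scale f (\<ominus> x) = \<ominus> scale f x"
  by (simp add: scale_def r_minus)

lemma scale_mult_left: "x \<in> carrier A \<Longrightarrow> y \<in> carrier A \<Longrightarrow> scale f x \<otimes> y = scale f (x \<otimes> y)"
  by (simp add: scale_def m_assoc)

lemma scale_mult_right:
  assumes "x \<in> carrier A" "y \<in> carrier A"
  shows "x \<otimes> scale f y = scale f (x \<otimes> y)"
proof -
  have "x \<otimes> scale f y = x \<otimes> \<phi> f \<otimes> y" using assms by (simp add: scale_def m_assoc)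
  also have "\<dots> = scale f (x \<otimes> y)" using assms by (simp add: scale_def scalar_central m_assoc)
  finally show ?thesis .
qed

section \<open>Submodules and finite spans over the power series ring\<close>

definition submod :: "'a set \<Rightarrow> bool" where
  "submod N \<longleftrightarrow> N \<subseteq> carrier A \<and> \<zero> \<in> N \<and> (\<forall>x\<in>N. \<forall>y\<in>N. x \<oplus> y \<in> N) \<and> (\<forall>f. \<forall>x\<in>N. scale f x \<in> N)"

lemma submod_minus:
  assumes "submod N" "x \<in> N"
  shows "\<ominus> x \<in> N"
proof -
  have "scale (- 1) x \<in> N" "x \<in> carrier A" using assms unfolding submod_def by auto
  then show ?thesis by (simp add: scale_minus_one)
qed

text \<open>Recursion over a list of generators lets the proofs peel off one generator at a
  time.\<close>

primrec lspan :: "'a list \<Rightarrow> 'a set" where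
  "lspan [] = {\<zero>}"
| "lspan (b # bs) = {scale f b \<oplus> x | f x. x \<in> lspan bs}"

lemma lspan_subset: "set bs \<subseteq> carrier A \<Longrightarrow> lspan bs \<subseteq> carrier A"
  by (induction bs) auto

lemma submod_adjoin:
  assumes "submod N" "b \<in> carrier A"
  shows "submod {scale f b \<oplus> x | f x. x \<in> N}"
proof -
  have N: "N \<subseteq> carrier A" "\<zero> \<in> N" "\<And>x y. x \<in> N \<Longrightarrow> y \<in> N \<Longrightarrow> x \<oplus> y \<in> N"
    "\<And>f x. x \<in> N \<Longrightarrow> scale f x \<in> N"
    using assms unfolding submod_def by auto
  have "\<zero> = scale 0 b \<oplus> \<zero>" using assms by simp
  then have zero: "\<exists>f x. \<zero> = scale f b \<oplus> x \<and> x \<in> N" using N by blast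
  have add: "\<exists>h z. (scale f b \<oplus> x) \<oplus> (scale g b \<oplus> y) = scale h b \<oplus> z \<and> z \<in> N"
    if "x \<in> N" "y \<in> N" for f g x y
  proof -
    have "x \<in> carrier A" "y \<in> carrier A" using that N by auto
    then have "(scale f b \<oplus> x) \<oplus> (scale g b \<oplus> y) = scale (f + g) b \<oplus> (x \<oplus> y)"
      using assms by (simp add: scale_add_left a_ac)
    then show ?thesis using that N by blast
  qed
  have sc: "\<exists>h z. scale g (scale f b \<oplus> x) = scale h b \<oplus> z \<and> z \<in> N" if "x \<in> N" for f g x
  proof -
    have "x \<in> carrier A" using that N by auto
    then have "scale g (scale f b \<oplus> x) = scale (g * f) b \<oplus> scale g x"
      using assms by (simp add: scale_add_right scale_scale)
    then show ?thesis using that N by blast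
  qed
  show ?thesis unfolding submod_def
  proof (intro conjI ballI allI)
    show "{scale f b \<oplus> x | f x. x \<in> N} \<subseteq> carrier A" using N(1) assms(2) by auto
  qed (use zero add sc in \<open>(simp, blast)+\<close>)
qed

lemma submod_lspan: "set bs \<subseteq> carrier A \<Longrightarrow> submod (lspan bs)"
proof (induction bs)
  case Nil
  then show ?case by (simp add: submod_def)
next
  case (Cons b bs)
  then show ?case using submod_adjoin[of "lspan bs" b] by simp
qed

text \<open>Krull's intersection theorem for a finitely generated module over the discrete valuation
  ring of power series: every submodule is closed in the adic topology. Passing to the submodule
  generated by \<open>N\<close> and \<open>b\<close> reduces to multiples of \<open>b\<close>, and these to \<open>X\<^sup>j b\<close>.\<close>

lemma submod_closed:
  assumes "set bs \<subseteq> carrier A" "submod N"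
    and "\<And>m. \<exists>n\<in>N. \<exists>y\<in>lspan bs. x = scale (fps_X ^ m) y \<oplus> n"
  shows "x \<in> N"
  using assms
proof (induction bs arbitrary: N x)
  case Nil
  then obtain n where "n \<in> N" "x = scale (fps_X ^ 0) \<zero> \<oplus> n" by fastforce
  moreover have "n \<in> carrier A" using \<open>n \<in> N\<close> Nil unfolding submod_def by auto
  ultimately show ?case by simp
next
  case (Cons b bs)
  have b: "b \<in> carrier A" and bs: "set bs \<subseteq> carrier A" using Cons.prems by auto
  have L: "lspan bs \<subseteq> carrier A" using lspan_subset[OF bs] .
  have SL: "\<And>f y. y \<in> lspan bs \<Longrightarrow> scale f y \<in> lspan bs"
    using submod_lspan[OF bs] unfolding submod_def by auto
  have N: "N \<subseteq> carrier A" "\<And>x y. x \<in> N \<Longrightarrow> y \<in> N \<Longrightarrow> x \<oplus> y \<in> N"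
    "\<And>f x. x \<in> N \<Longrightarrow> scale f x \<in> N"
    using Cons.prems(2) unfolding submod_def by auto
  let ?N' = "{scale f b \<oplus> x | f x. x \<in> N}"
  have dec: "\<exists>n\<in>N. \<exists>y\<in>lspan bs. \<exists>f. x = scale (fps_X ^ m) (scale f b \<oplus> y) \<oplus> n" for m
    using Cons.prems(3)[of m] by fastforce
  have "x \<in> ?N'"
  proof (rule Cons.IH[OF bs submod_adjoin[OF Cons.prems(2) b]])
    fix m
    obtain n y f where *: "n \<in> N" "y \<in> lspan bs" "x = scale (fps_X ^ m) (scale f b \<oplus> y) \<oplus> n"
      using dec[of m] by auto
    have c: "n \<in> carrier A" "y \<in> carrier A" using * L N by auto
    have "x = scale (fps_X ^ m) y \<oplus> (scale (fps_X ^ m * f) b \<oplus> n)"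
      using c b *(3) by (simp add: scale_add_right scale_scale a_ac)
    then show "\<exists>n\<in>?N'. \<exists>y\<in>lspan bs. x = scale (fps_X ^ m) y \<oplus> n" using * by blast
  qed
  then obtain k n0 where x: "x = scale k b \<oplus> n0" "n0 \<in> N" by auto
  have n0: "n0 \<in> carrier A" using x N by auto
  have "scale k b \<in> N"
  proof (cases "k = 0")
    case True
    then show ?thesis using b Cons.prems(2) unfolding submod_def by simp
  next
    case False
    define j where "j = subdegree k"
    define u where "u = fps_shift j k"
    have k: "k = fps_X ^ j * u"
      unfolding j_def u_def using subdegree_decompose[of k] by (simp add: mult.commute)
    have u0: "fps_nth u 0 \<noteq> 0" unfolding u_def j_def using False by simp
    \<comment> \<open>Two expressions for \<open>x\<close> are compared: the exact one with
      coefficient \<open>k\<close> of \<open>b\<close>, and an approximate one with a coefficient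
      divisible by a high power of X. Their difference is X^j times a unit times \<open>b\<close>,
      up to \<open>N\<close> and a small error in the span of the other generators.\<close>
    have "scale (fps_X ^ j) b \<in> N"
    proof (rule Cons.IH[OF bs Cons.prems(2)])
      fix m
      obtain n y f where *: "n \<in> N" "y \<in> lspan bs"
        "x = scale (fps_X ^ (j + Suc m)) (scale f b \<oplus> y) \<oplus> n"
        using dec[of "j + Suc m"] by auto
      have c: "n \<in> carrier A" "y \<in> carrier A" using * L N by auto
      \<comment> \<open>The extra \<open>Suc\<close> in the precision keeps the constant term of
        \<open>u'\<close> equal to that of \<open>u\<close> even for \<open>m = 0\<close>, so
        \<open>u'\<close> is invertible.\<close>
      define u' where "u' = u - fps_X ^ Suc m * f"
      have u': "inverse u' * u' = 1"
        using u0 by (intro inverse_mult_eq_1) (simp add: u'_def)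
      have ku: "k = fps_X ^ j * u' + fps_X ^ (j + Suc m) * f"
        by (simp add: k u'_def algebra_simps power_add)
      let ?y = "scale (fps_X ^ (j + Suc m)) y" and ?fb = "scale (fps_X ^ (j + Suc m) * f) b"
      let ?ub = "scale (fps_X ^ j * u') b"
      have "?ub \<oplus> ?fb \<oplus> n0 = ?fb \<oplus> ?y \<oplus> n"
        using x(1) *(3) c b by (simp add: ku scale_add_left scale_add_right scale_scale)
      then have "?fb \<oplus> (?ub \<oplus> n0) = ?fb \<oplus> (?y \<oplus> n)"
        using c b n0 by (simp add: a_ac)
      then have "?ub \<oplus> n0 = ?y \<oplus> n" using c b n0 by simp
      then have "?ub \<oplus> n0 \<oplus> \<ominus> n0 = ?y \<oplus> n \<oplus> \<ominus> n0" by simp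
      then have "?ub = ?y \<oplus> n \<oplus> \<ominus> n0" using c b n0 by (simp add: a_assoc r_neg)
      then have "scale (inverse u') ?ub = scale (inverse u') (?y \<oplus> (n \<oplus> \<ominus> n0))"
        using c n0 by (simp add: a_assoc)
      moreover have "inverse u' * (fps_X ^ j * u') = fps_X ^ j"
        using u' by (metis mult.commute mult.left_commute mult.right_neutral)
      moreover have "inverse u' * fps_X ^ (j + Suc m) = fps_X ^ m * (fps_X ^ Suc j * inverse u')"
        by (simp add: power_add mult_ac)
      ultimately have "scale (fps_X ^ j) b =
          scale (fps_X ^ m) (scale (fps_X ^ Suc j * inverse u') y) \<oplus> scale (inverse u') (n \<oplus> \<ominus> n0)"
        using c b n0 by (simp only: scale_scale scale_add_right scale_closed a_closed a_inv_closed)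
      moreover have "scale (inverse u') (n \<oplus> \<ominus> n0) \<in> N"
        using * x N submod_minus[OF Cons.prems(2)] by blast
      ultimately show "\<exists>n\<in>N. \<exists>y\<in>lspan bs. scale (fps_X ^ j) b = scale (fps_X ^ m) y \<oplus> n"
        using SL[OF *(2)] by blast
    qed
    then have "scale u (scale (fps_X ^ j) b) \<in> N" using N by blast
    then show ?thesis using b k by (simp add: scale_scale mult.commute)
  qed
  then show ?case using x N by auto
qed

text \<open>The tail sums \<open>L n = y n + X y (n+1) + X\<^sup>2 y (n+2) + \<dots>\<close> of a power series in \<open>X\<close>.\<close>

lemma lspan_series:
  assumes "set bs \<subseteq> carrier A" "\<And>n. y n \<in> lspan bs"
  shows "\<exists>L. \<forall>n::nat. L n \<in> lspan bs \<and> L n = y n \<oplus> scale fps_X (L (Suc n))"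
  using assms
proof (induction bs arbitrary: y)
  case Nil
  then show ?case by (intro exI[of _ "\<lambda>_. \<zero>"]) auto
next
  case (Cons b bs)
  then have b: "b \<in> carrier A" and bs: "set bs \<subseteq> carrier A" by auto
  have L: "lspan bs \<subseteq> carrier A" using lspan_subset[OF bs] .
  have "\<forall>n. \<exists>f z. y n = scale f b \<oplus> z \<and> z \<in> lspan bs" using Cons.prems(2) by auto
  then obtain f z where y: "\<And>n. y n = scale (f n) b \<oplus> z n" and z: "\<And>n. z n \<in> lspan bs" by metis
  obtain M where M: "\<And>n. M n \<in> lspan bs" "\<And>n. M n = z n \<oplus> scale fps_X (M (Suc n))"
    using Cons.IH[of z, OF bs z] by blast
  \<comment> \<open>The coefficient of \<open>b\<close>, namely f n + X f (n+1) + X^2 f (n+2) + ...;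
    in degree \<open>i\<close> only the terms with \<open>j \<le> i\<close> contribute.\<close>
  define F where "F n = Abs_fps (\<lambda>i. \<Sum>j\<le>i. fps_nth (f (n + j)) (i - j))" for n
  have F: "F n = f n + fps_X * F (Suc n)" for n
  proof (rule fps_ext)
    fix i show "fps_nth (F n) i = fps_nth (f n + fps_X * F (Suc n)) i"
      by (cases i) (simp_all add: F_def sum.atMost_Suc_shift del: sum.atMost_Suc)
  qed
  have "scale (F n) b \<oplus> M n = y n \<oplus> scale fps_X (scale (F (Suc n)) b \<oplus> M (Suc n))" for n
  proof -
    have c: "z n \<in> carrier A" "M (Suc n) \<in> carrier A" using z M(1) L by auto
    have "scale (F n) b \<oplus> M n =
        (scale (f n) b \<oplus> scale (fps_X * F (Suc n)) b) \<oplus> (z n \<oplus> scale fps_X (M (Suc n)))"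
      using b by (subst F[of n], subst M(2)[of n]) (simp add: scale_add_left)
    also have "\<dots> = y n \<oplus> scale fps_X (scale (F (Suc n)) b \<oplus> M (Suc n))"
      using b c by (simp add: y scale_add_right scale_scale a_ac)
    finally show ?thesis .
  qed
  moreover have "scale (F n) b \<oplus> M n \<in> lspan (b # bs)" for n using M(1)[of n] by auto
  ultimately have "\<forall>n. scale (F n) b \<oplus> M n \<in> lspan (b # bs) \<and>
      scale (F n) b \<oplus> M n = y n \<oplus> scale fps_X (scale (F (Suc n)) b \<oplus> M (Suc n))" by blast
  then show ?case by (rule exI[of _ "\<lambda>n. scale (F n) b \<oplus> M n"])
qed

section \<open>The X-adic filtration of the algebra\<close>

definition adic :: "nat \<Rightarrow> 'a set" where
  "adic n = scale (fps_X ^ n) ` carrier A"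

lemma adic_closed: "x \<in> adic n \<Longrightarrow> x \<in> carrier A"
  by (auto simp: adic_def)

lemma adic_add:
  assumes "x \<in> adic n" "y \<in> adic n"
  shows "x \<oplus> y \<in> adic n"
  using assms by (auto simp: adic_def scale_add_right[symmetric])

lemma adic_minus: "x \<in> adic n \<Longrightarrow> \<ominus> x \<in> adic n"
  by (auto simp: adic_def scale_minus_right[symmetric])

lemma adic_diff: "x \<in> adic n \<Longrightarrow> y \<in> adic n \<Longrightarrow> x \<ominus> y \<in> adic n"
  by (simp add: minus_eq adic_add adic_minus)

lemma adic_mult:
  assumes "x \<in> adic m" "y \<in> adic n"
  shows "x \<otimes> y \<in> adic (m + n)"
proof -
  obtain x' y' where "x = scale (fps_X ^ m) x'" "y = scale (fps_X ^ n) y'"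
    and c: "x' \<in> carrier A" "y' \<in> carrier A" using assms by (auto simp: adic_def)
  then have "x \<otimes> y = scale (fps_X ^ (m + n)) (x' \<otimes> y')"
    by (simp add: scale_mult_left scale_mult_right scale_scale power_add mult.commute)
  then show ?thesis using c by (auto simp: adic_def)
qed

lemma adic_zero: "adic 0 = carrier A"
  unfolding adic_def by force

lemma adic_mult_right: "x \<in> carrier A \<Longrightarrow> y \<in> adic n \<Longrightarrow> x \<otimes> y \<in> adic n"
  using adic_mult[of x 0 y n] by (simp add: adic_zero)

lemma adic_mult_left: "x \<in> adic n \<Longrightarrow> y \<in> carrier A \<Longrightarrow> x \<otimes> y \<in> adic n"
  using adic_mult[of x n y 0] by (simp add: adic_zero)

lemma adic_scale:
  assumes "x \<in> adic n"
  shows "scale f x \<in> adic n"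
proof -
  obtain x' where "x = scale (fps_X ^ n) x'" "x' \<in> carrier A" using assms by (auto simp: adic_def)
  then have "scale f x = scale (fps_X ^ n) (scale f x')" "scale f x' \<in> carrier A"
    by (simp_all add: scale_scale mult.commute)
  then show ?thesis by (auto simp: adic_def)
qed

lemma adic_mono:
  assumes "m \<le> n" "x \<in> adic n"
  shows "x \<in> adic m"
proof -
  obtain x' where x: "x = scale (fps_X ^ n) x'" "x' \<in> carrier A" using assms by (auto simp: adic_def)
  have "x = scale (fps_X ^ m) (scale (fps_X ^ (n - m)) x')"
    using assms(1) x by (simp add: scale_scale power_add[symmetric])
  then show ?thesis using x by (auto simp: adic_def)
qed

end

section \<open>Separation, completeness and square roots near 1\<close>

locale finite_fps_algebra = fps_algebra A \<phi>
  for A (structure) and \<phi> :: "'k::field_char_0 fps \<Rightarrow> 'a" +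
  fixes bs :: "'a list"
  assumes generators: "set bs \<subseteq> carrier A" "carrier A = lspan bs"
begin

text \<open>The zero submodule is closed.\<close>

lemma adic_separated:
  assumes "\<And>n. x \<in> adic n"
  shows "x = \<zero>"
proof -
  have "x \<in> {\<zero>}"
  proof (rule submod_closed[OF generators(1)])
    show "submod {\<zero>}" by (simp add: submod_def)
    show "\<exists>n\<in>{\<zero>}. \<exists>y\<in>lspan bs. x = scale (fps_X ^ m) y \<oplus> n" for m
    proof -
      obtain y where "y \<in> carrier A" "x = scale (fps_X ^ m) y" using assms[of m] by (auto simp: adic_def)
      then have "x = scale (fps_X ^ m) y \<oplus> \<zero>" "y \<in> lspan bs" by (simp_all flip: generators(2))
      then show ?thesis by blast
    qed
  qed
  then show ?thesis by simp
qed

text \<open>Write the increments as X^n y n. The limit is s 0 plus the sum of all increments, and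
  its distance from \<open>s n\<close> is X^n times the tail supplied by
  \<open>lspan_series\<close>.\<close>

lemma adic_complete:
  assumes s: "\<And>n. s n \<in> carrier A" "\<And>n. s (Suc n) \<ominus> s n \<in> adic n"
  shows "\<exists>l\<in>carrier A. \<forall>n. l \<ominus> s n \<in> adic n"
proof -
  have "\<forall>n. \<exists>y\<in>carrier A. s (Suc n) \<ominus> s n = scale (fps_X ^ n) y"
    using s(2) by (auto simp: adic_def image_iff)
  then obtain y where y: "\<And>n. y n \<in> carrier A" "\<And>n. s (Suc n) \<ominus> s n = scale (fps_X ^ n) (y n)"
    by metis
  obtain L where L: "\<And>n. L n \<in> carrier A" "\<And>n. L n = y n \<oplus> scale fps_X (L (Suc n))"
    using lspan_series[of bs y] generators(1) y(1) unfolding generators(2) by blast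
  have "s 0 \<oplus> L 0 = s n \<oplus> scale (fps_X ^ n) (L n)" for n
  proof (induction n)
    case (Suc n)
    have "s n \<oplus> scale (fps_X ^ n) (L n) =
        s n \<oplus> (scale (fps_X ^ n) (y n) \<oplus> scale (fps_X ^ n) (scale fps_X (L (Suc n))))"
      using L(1) y(1) by (subst L(2)[of n]) (simp add: scale_add_right)
    also have "\<dots> = s n \<oplus> (s (Suc n) \<ominus> s n) \<oplus> scale (fps_X ^ Suc n) (L (Suc n))"
      using L(1)[of "Suc n"] s(1) y(1) by (simp add: a_assoc scale_scale y(2)[symmetric] mult.commute)
    also have "\<dots> = s (Suc n) \<oplus> scale (fps_X ^ Suc n) (L (Suc n))"
      using s(1) by (simp only: diff_add_cancel)
    finally show ?case using Suc by simp
  qed (use L(1) in simp)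
  then have "(s 0 \<oplus> L 0) \<ominus> s n = scale (fps_X ^ n) (L n)" for n
    using s(1)[of n] L(1)[of n] by (metis add_diff_cancel scale_closed)
  then have "(s 0 \<oplus> L 0) \<ominus> s n \<in> adic n" for n
    using L(1) by (simp add: adic_def)
  moreover have "s 0 \<oplus> L 0 \<in> carrier A" using s(1) L(1) by simp
  ultimately show ?thesis by blast
qed

lemma scale_half_add:
  assumes "x \<in> carrier A"
  shows "scale (fps_const (1/2)) x \<oplus> scale (fps_const (1/2)) x = x"
proof -
  have "fps_const (1/2) + fps_const (1/2) = (1 :: 'k fps)"
    by (simp only: fps_const_add) simp
  then show ?thesis using assms by (simp add: scale_add_left[symmetric])
qed

text \<open>Newton's step for the square root, with the factor 1 / (2s) frozen at its value 1/2 for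
  s = 1. Every term on the right has a factor \<open>h\<close> and a second factor that is small
  when \<open>s\<close> is close to 1, so the error gains a power of X. No commutativity between
  \<open>s\<close> and \<open>h\<close> is assumed.\<close>

lemma newton_identity:
  assumes "s \<in> carrier A" "h \<in> carrier A" "c \<in> carrier A" "s \<otimes> s \<ominus> c = h \<oplus> h"
  shows "(s \<ominus> h) \<otimes> (s \<ominus> h) \<ominus> c = h \<otimes> h \<ominus> (s \<ominus> \<one>) \<otimes> h \<ominus> h \<otimes> (s \<ominus> \<one>)"
proof -
  have "(s \<ominus> h) \<otimes> (s \<ominus> h) \<ominus> c = (s \<otimes> s \<ominus> c) \<oplus> h \<otimes> h \<ominus> s \<otimes> h \<ominus> h \<otimes> s"
    using assms(1-3) by (simp add: minus_eq l_distr r_distr l_minus r_minus minus_add a_ac)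
  also have "\<dots> = h \<otimes> h \<ominus> (s \<ominus> \<one>) \<otimes> h \<ominus> h \<otimes> (s \<ominus> \<one>)"
    unfolding assms(4)
    using assms(1-3) by (simp add: minus_eq l_distr r_distr l_minus r_minus minus_add a_ac)
  finally show ?thesis .
qed

lemma commute_diff:
  assumes "x \<in> carrier A" "y \<in> carrier A" "z \<in> carrier A" "x \<otimes> z = z \<otimes> x" "y \<otimes> z = z \<otimes> y"
  shows "(x \<ominus> y) \<otimes> z = z \<otimes> (x \<ominus> y)"
  using assms by (simp add: minus_eq l_distr r_distr l_minus r_minus)

text \<open>The iterates \<open>s - (s\<^sup>2 - c) / 2\<close> starting at \<open>1\<close> are polynomials in \<open>c\<close>, so they commute with the
  centralizer of \<open>c\<close>. Working with \<open>(c - 1) / X\<close> instead would lose this if there were torsion.\<close>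

lemma square_root:
  assumes c: "c \<in> carrier A" "c \<ominus> \<one> \<in> adic 1"
  obtains r where "r \<in> carrier A" "r \<otimes> r = c" "r \<ominus> \<one> \<in> adic 1"
    and "\<And>z. z \<in> carrier A \<Longrightarrow> c \<otimes> z = z \<otimes> c \<Longrightarrow> r \<otimes> z = z \<otimes> r"
proof -
  define step where "step x = x \<ominus> scale (fps_const (1/2)) (x \<otimes> x \<ominus> c)" for x
  define s where "s n = (step ^^ n) \<one>" for n
  have s_Suc: "s (Suc n) = step (s n)" for n by (simp add: s_def)
  have s_closed: "s n \<in> carrier A" for n
    by (induction n) (use c in \<open>simp_all add: s_def step_def\<close>)
  define h where "h n = scale (fps_const (1/2)) (s n \<otimes> s n \<ominus> c)" for n
  have h_closed: "h n \<in> carrier A" for n using s_closed c by (simp add: h_def)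
  have s_step: "s (Suc n) = s n \<ominus> h n" for n by (simp add: s_Suc step_def h_def)
  have hh: "s n \<otimes> s n \<ominus> c = h n \<oplus> h n" for n
    using s_closed c by (simp add: h_def scale_half_add)
  \<comment> \<open>The exponent is one ahead of the index, since the starting value 1 already has
    an error \<open>\<one> \<ominus> c\<close> divisible by X.\<close>
  have inv: "s n \<ominus> \<one> \<in> adic 1 \<and> s n \<otimes> s n \<ominus> c \<in> adic (Suc n)" for n
  proof (induction n)
    case 0
    have "\<one> \<ominus> c = \<ominus> (c \<ominus> \<one>)" using c by (simp add: minus_eq minus_add a_comm)
    then show ?case using c adic_minus[of "c \<ominus> \<one>" 1] adic_diff[OF c(2) c(2)]
      by (simp add: s_def minus_eq r_neg)
  next
    case (Suc n)
    have h: "h n \<in> adic (Suc n)" using Suc adic_scale by (simp add: h_def)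
    have "s (Suc n) \<ominus> \<one> = (s n \<ominus> \<one>) \<ominus> h n"
      using s_closed h_closed by (simp add: s_step minus_eq a_ac)
    moreover have "h n \<in> adic 1" using h by (rule adic_mono[rotated]) simp
    ultimately have 1: "s (Suc n) \<ominus> \<one> \<in> adic 1" using Suc adic_diff by auto
    have "s (Suc n) \<otimes> s (Suc n) \<ominus> c =
        h n \<otimes> h n \<ominus> (s n \<ominus> \<one>) \<otimes> h n \<ominus> h n \<otimes> (s n \<ominus> \<one>)"
      using newton_identity[OF s_closed h_closed c(1) hh] by (simp add: s_step)
    moreover have "h n \<otimes> h n \<in> adic (Suc (Suc n))"
      using adic_mult[OF h \<open>h n \<in> adic 1\<close>] by simp
    moreover have "(s n \<ominus> \<one>) \<otimes> h n \<in> adic (Suc (Suc n))" "h n \<otimes> (s n \<ominus> \<one>) \<in> adic (Suc (Suc n))"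
      using adic_mult[of "s n \<ominus> \<one>" 1 "h n" "Suc n"] adic_mult[of "h n" "Suc n" "s n \<ominus> \<one>" 1] Suc h by auto
    ultimately show ?case using 1 by (simp add: adic_diff)
  qed
  have comm: "s n \<otimes> z = z \<otimes> s n" if z: "z \<in> carrier A" "c \<otimes> z = z \<otimes> c" for n z
  proof (induction n)
    case (Suc n)
    have "(s n \<otimes> s n) \<otimes> z = z \<otimes> (s n \<otimes> s n)"
      using Suc z s_closed[of n] by (metis m_assoc)
    then have "(s n \<otimes> s n \<ominus> c) \<otimes> z = z \<otimes> (s n \<otimes> s n \<ominus> c)"
      using z s_closed c by (intro commute_diff) auto
    then have "h n \<otimes> z = z \<otimes> h n"
      using z s_closed c by (simp add: h_def scale_mult_left scale_mult_right)
    then show ?case using Suc z s_closed h_closed unfolding s_step by (intro commute_diff) auto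
  qed (use z in \<open>simp add: s_def\<close>)
  have "s (Suc n) \<ominus> s n \<in> adic n" for n
  proof -
    have "h n \<in> adic n"
      using inv[of n] adic_scale adic_mono[of n "Suc n"] unfolding h_def by auto
    moreover have "s (Suc n) \<ominus> s n = \<ominus> h n"
      using s_closed h_closed by (simp add: s_step minus_eq a_ac r_neg r_neg1 r_neg2 neg_cancel minus_add)
    ultimately show ?thesis by (simp add: adic_minus)
  qed
  then obtain r where r: "r \<in> carrier A" "\<And>n. r \<ominus> s n \<in> adic n"
    using adic_complete[of s] s_closed by blast
  have rs: "r = s n \<oplus> (r \<ominus> s n)" for n using r s_closed by (simp add: diff_add_cancel)
  show ?thesis
  proof
    show "r \<in> carrier A" by fact
    have "r \<otimes> r \<ominus> c \<in> adic n" for n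
    proof -
      have d: "r \<ominus> s n \<in> adic n" "r \<ominus> s n \<in> carrier A" using r adic_closed by auto
      have "r \<otimes> r \<ominus> c = r \<otimes> (r \<ominus> s n) \<oplus> (r \<ominus> s n) \<otimes> s n \<oplus> (s n \<otimes> s n \<ominus> c)"
        using r(1) s_closed[of n] c(1)
        by (simp add: minus_eq l_distr r_distr l_minus r_minus a_ac r_neg r_neg1 r_neg2 neg_cancel)
      moreover have "s n \<otimes> s n \<ominus> c \<in> adic n" using inv[of n] adic_mono[of n "Suc n"] by auto
      ultimately show ?thesis
        using d r(1) s_closed by (simp add: adic_add adic_mult_left adic_mult_right)
    qed
    then have "r \<otimes> r \<ominus> c = \<zero>" by (rule adic_separated)
    then show "r \<otimes> r = c" using r c by simp
    have "r \<ominus> \<one> = (r \<ominus> s 1) \<oplus> (s 1 \<ominus> \<one>)"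
      using r(1) s_closed[of 1] by (simp add: minus_eq a_ac r_neg r_neg1 r_neg2 neg_cancel minus_add)
    then show "r \<ominus> \<one> \<in> adic 1" using r(2)[of 1] inv[of 1] by (simp add: adic_add)
    \<comment> \<open>The iterates commute with \<open>z\<close>, so the commutator of
      \<open>z\<close> with the limit equals that with \<open>r \<ominus> s n\<close> and lies in
      every \<open>adic n\<close>.\<close>
    show "r \<otimes> z = z \<otimes> r" if z: "z \<in> carrier A" "c \<otimes> z = z \<otimes> c" for z
    proof -
      have "r \<otimes> z \<ominus> z \<otimes> r \<in> adic n" for n
      proof -
        have "r \<otimes> z \<ominus> z \<otimes> r = (r \<ominus> s n) \<otimes> z \<ominus> z \<otimes> (r \<ominus> s n)"
          using r(1) s_closed[of n] z(1) comm[OF z, of n]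
          by (simp add: minus_eq l_distr r_distr l_minus r_minus minus_add a_ac r_neg r_neg1 r_neg2 neg_cancel)
        then show ?thesis using r(2)[of n] z by (simp add: adic_diff adic_mult_left adic_mult_right)
      qed
      then have "r \<otimes> z \<ominus> z \<otimes> r = \<zero>" by (rule adic_separated)
      then show ?thesis using r z by simp
    qed
  qed
qed

lemma involution_near_one:
  assumes "z \<in> carrier A" "z \<otimes> z = \<one>" "z \<ominus> \<one> \<in> adic 1"
  shows "z = \<one>"
proof -
  define y where "y = z \<ominus> \<one>"
  have y: "y \<in> carrier A" "y \<in> adic 1" using assms by (auto simp: y_def)
  have "y \<otimes> y = \<ominus> (y \<oplus> y)"
    using assms(1,2)
    by (simp add: y_def minus_eq l_distr r_distr l_minus r_minus minus_add a_ac)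
  then have "\<ominus> (y \<otimes> y) = y \<oplus> y" using y by simp
  then have "scale (fps_const (1/2)) (\<ominus> (y \<otimes> y)) = y"
    using y scale_half_add[of y] by (simp add: scale_add_right)
  then have step: "y \<in> adic (Suc n)" if "y \<in> adic n" for n
    using adic_mult[OF that y(2)] adic_minus[of "y \<otimes> y" "n + 1"]
      adic_scale[of "\<ominus> (y \<otimes> y)" "n + 1" "fps_const (1/2)"] by simp
  have "y \<in> adic n" for n by (induction n) (use y step in \<open>auto simp: adic_zero\<close>)
  then have "y = \<zero>" by (rule adic_separated)
  then show ?thesis using assms by (simp add: y_def)
qed

end


section \<open>The completion at \<open>v = 1\<close>\<close>

text \<open>Evaluation at v = 1, as the sum of the coefficients.\<close>

definition aug :: "'k::comm_ring_1 laurent \<Rightarrow> 'k" where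
  "aug = pm_lift (\<lambda>_ x. x)"

lemma aug_add: "aug (p + q) = aug p + aug q"
  by (simp add: aug_def pm_lift_add)

lemma aug_single [simp]: "aug (single n x) = x"
  by (simp add: aug_def pm_lift_single)

lemma aug_zero [simp]: "aug 0 = 0"
  by (simp add: aug_def pm_lift_zero)

lemma aug_one [simp]: "aug 1 = 1"
  using aug_single[of 0 1] by (simp del: aug_single)

lemma aug_diff: "aug (p - q) = aug p - aug q"
  using aug_add[of "p - q" q] by simp

lemma aug_mult: "aug (p * q) = aug p * aug q"
proof -
  have "keys p \<subseteq> UNIV" by simp
  then show ?thesis
  proof (induction p rule: poly_mapping_keys_induct)
    case (single n x)
    have "keys q \<subseteq> UNIV" by simp
    then show ?case
      by (induction q rule: poly_mapping_keys_induct)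
        (simp_all add: mult_single aug_add distrib_left)
  qed (simp_all add: distrib_right aug_add)
qed

lemma lookup_map_of_int:
  "lookup (Poly_Mapping.map of_int p) k = of_int (lookup p k)"
  by (simp add: Poly_Mapping.map.rep_eq when_def)

lemma map_of_int_add: "Poly_Mapping.map of_int (p + q) =
    (Poly_Mapping.map of_int p + Poly_Mapping.map of_int q :: 'k::comm_ring_1 laurent)"
  by (rule poly_mapping_eqI) (simp add: lookup_add lookup_map_of_int)

lemma map_of_int_zero [simp]: "Poly_Mapping.map of_int 0 = (0 :: 'k::comm_ring_1 laurent)"
  by (rule poly_mapping_eqI) (simp add: lookup_map_of_int)

lemma aug_map_of_int: "aug (Poly_Mapping.map of_int p) = of_int (aug p)"
proof -
  have "keys p \<subseteq> UNIV" by simp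
  then show ?thesis
    by (induction p rule: poly_mapping_keys_induct) (simp_all add: map_of_int_add aug_add)
qed

lemma v_pow_add: "v_pow (m + n) = v_pow m * v_pow n"
  by (simp add: v_pow_def mult_single)

lemma v_pow_0 [simp]: "v_pow 0 = 1"
  by (simp add: v_pow_def)

text \<open>Induction for nonnegative exponents; a negative one is reduced to its opposite by the
  unit v^n.\<close>

lemma v_minus_1_dvd_v_pow: "v_pow 1 - 1 dvd (v_pow n - 1 :: 'k::comm_ring_1 laurent)"
proof -
  have nat: "v_pow 1 - 1 dvd (v_pow (int n) - 1 :: 'k laurent)" for n
  proof (induction n)
    case (Suc n)
    have "v_pow (int (Suc n)) - 1 = v_pow 1 * (v_pow (int n) - 1) + (v_pow 1 - 1 :: 'k laurent)"
      using v_pow_add[of 1 "int n"] by (simp add: algebra_simps)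
    then show ?case using Suc by (simp only: dvd_add dvd_mult dvd_refl)
  qed simp
  show ?thesis
  proof (cases n)
    case (nonneg m)
    then show ?thesis using nat by simp
  next
    case (neg m)
    let ?k = "int (Suc m)"
    have "v_pow ?k * v_pow (- ?k) = (1 :: 'k laurent)"
      using v_pow_add[of ?k "- ?k"] by simp
    then have "v_pow (- ?k) - 1 = - v_pow (- ?k) * (v_pow ?k - 1 :: 'k laurent)"
      by (simp add: right_diff_distrib mult.commute del: of_nat_Suc)
    moreover have "n = - ?k" using neg by simp
    ultimately show ?thesis using nat[of "Suc m"] by (simp only: dvd_mult)
  qed
qed

text \<open>Together with \<open>aug_v_minus_1_dvd\<close> this identifies the ideal (v - 1) with
  the kernel of evaluation at 1.\<close>

lemma v_minus_1_dvd_aug: "v_pow 1 - 1 dvd p - single 0 (aug p)"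
proof -
  have "keys p \<subseteq> UNIV" by simp
  then show ?thesis
  proof (induction p rule: poly_mapping_keys_induct)
    case (single n x)
    have "single n x - single 0 x =
        single 0 x * (v_pow n - 1)"
      by (simp add: v_pow_def algebra_simps mult_single)
    then show ?case by (simp only: aug_single dvd_mult v_minus_1_dvd_v_pow)
  next
    case (add f g)
    have "f + g - single 0 (aug (f + g)) =
        (f - single 0 (aug f)) + (g - single 0 (aug g))"
      by (simp add: aug_add single_add)
    then show ?case using add by (simp only: dvd_add)
  qed simp
qed

lemma aug_v_minus_1_dvd: "v_pow 1 - 1 dvd p \<Longrightarrow> aug p = 0"
  by (auto simp: dvd_def aug_mult aug_diff v_pow_def)

abbreviation vm1 :: "rat laurent" where
  "vm1 \<equiv> v_pow 1 - 1"

section \<open>Powers of the ideal (v - 1) and their inverse limit\<close>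

lemma Q_laurent_simps [simp]:
  "carrier Q_laurent = UNIV" "x \<otimes>\<^bsub>Q_laurent\<^esub> y = x * y" "\<one>\<^bsub>Q_laurent\<^esub> = 1"
  "\<zero>\<^bsub>Q_laurent\<^esub> = 0" "x \<oplus>\<^bsub>Q_laurent\<^esub> y = x + y"
  by (simp_all add: Q_laurent_def ring_of_type_algebra_def)

interpretation Q_laurent: cring Q_laurent
  unfolding Q_laurent_def by (rule cring_from_type_algebra)

lemma v_minus_1_ideal_eq: "v_minus_1_ideal = {x. vm1 dvd x}"
  unfolding v_minus_1_ideal_def
  by (subst Q_laurent.cgenideal_eq_genideal[symmetric])
    (auto simp: cgenideal_def dvd_def mult.commute)

abbreviation vm1_power :: "nat \<Rightarrow> rat laurent set" where
  "vm1_power \<equiv> ideal_power Q_laurent v_minus_1_ideal"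

lemma ideal_vm1: "ideal v_minus_1_ideal Q_laurent"
  unfolding v_minus_1_ideal_def by (rule Q_laurent.genideal_ideal) simp

lemma ideal_vm1_power: "ideal (vm1_power n) Q_laurent"
  by (induction n) (simp_all add: Q_laurent.oneideal[simplified] Q_laurent.ideal_prod_is_ideal ideal_vm1)

lemma vm1_power_eq: "vm1_power n = {x. vm1 ^ n dvd x}"
proof (induction n)
  case (Suc n)
  have "x \<in> ideal_prod Q_laurent {x. vm1 dvd x} {x. vm1 ^ n dvd x} \<longleftrightarrow> vm1 ^ Suc n dvd x" for x
  proof
    assume "x \<in> ideal_prod Q_laurent {x. vm1 dvd x} {x. vm1 ^ n dvd x}"
    then show "vm1 ^ Suc n dvd x"
      by (induction rule: ideal_prod.induct) (simp_all add: mult_dvd_mono)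
  next
    assume "vm1 ^ Suc n dvd x"
    then obtain y where "x = vm1 \<otimes>\<^bsub>Q_laurent\<^esub> (vm1 ^ n * y)" by (auto simp: dvd_def mult.assoc)
    then show "x \<in> ideal_prod Q_laurent {x. vm1 dvd x} {x. vm1 ^ n dvd x}"
      using ideal_prod.prod[of vm1 "{x. vm1 dvd x}" "vm1 ^ n * y" "{x. vm1 ^ n dvd x}" Q_laurent]
      by simp
  qed
  then have "ideal_prod Q_laurent {x. vm1 dvd x} {x. vm1 ^ n dvd x} = {x. vm1 ^ Suc n dvd x}" by blast
  then show ?case by (simp only: ideal_power.simps Suc) (simp only: v_minus_1_ideal_eq)
qed simp

definition vm1_coset :: "nat \<Rightarrow> rat laurent \<Rightarrow> rat laurent set" where
  "vm1_coset n a = vm1_power n +>\<^bsub>Q_laurent\<^esub> a"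

lemma vm1_coset_alt: "vm1_coset n a = {x. vm1 ^ n dvd x - a}"
proof -
  have "x \<in> vm1_coset n a \<longleftrightarrow> (\<exists>h. vm1 ^ n dvd h \<and> x = h + a)" for x
    by (simp add: vm1_coset_def a_r_coset_def' vm1_power_eq)
  moreover have "(\<exists>h. vm1 ^ n dvd h \<and> x = h + a) \<longleftrightarrow> vm1 ^ n dvd x - a" for x
    by (auto intro: exI[of _ "x - a"])
  ultimately show ?thesis by auto
qed

lemma vm1_coset_eq_iff: "vm1_coset n a = vm1_coset n b \<longleftrightarrow> vm1 ^ n dvd a - b"
proof
  assume "vm1_coset n a = vm1_coset n b"
  moreover have "a \<in> vm1_coset n a" by (simp add: vm1_coset_alt)
  ultimately show "vm1 ^ n dvd a - b" by (simp add: vm1_coset_alt)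
next
  assume ab: "vm1 ^ n dvd a - b"
  have "vm1 ^ n dvd x - a \<longleftrightarrow> vm1 ^ n dvd x - b" for x
    using dvd_add[OF _ ab, of "x - a"] dvd_diff[OF _ ab, of "x - b"] by auto
  then show "vm1_coset n a = vm1_coset n b" by (simp add: vm1_coset_alt)
qed

text \<open>The condition on representatives that makes their cosets an element of the inverse
  limit. On such sequences the operations of the completion are termwise.\<close>

definition coherent :: "(nat \<Rightarrow> rat laurent) \<Rightarrow> bool" where
  "coherent a \<longleftrightarrow> (\<forall>n. vm1 ^ n dvd a (Suc n) - a n)"

definition R_of :: "(nat \<Rightarrow> rat laurent) \<Rightarrow> R_elt" where
  "R_of a = (\<lambda>n. vm1_coset n (a n))"

lemma vm1_coset_ops:
  "vm1_coset n a \<otimes>\<^bsub>Q_laurent Quot vm1_power n\<^esub> vm1_coset n b = vm1_coset n (a * b)"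
  "vm1_coset n a \<oplus>\<^bsub>Q_laurent Quot vm1_power n\<^esub> vm1_coset n b = vm1_coset n (a + b)"
  "\<one>\<^bsub>Q_laurent Quot vm1_power n\<^esub> = vm1_coset n 1"
  "\<zero>\<^bsub>Q_laurent Quot vm1_power n\<^esub> = vm1_coset n 0"
proof -
  interpret ideal "vm1_power n" Q_laurent by (rule ideal_vm1_power)
  interpret h: ring_hom_ring Q_laurent "Q_laurent Quot vm1_power n" "(+>\<^bsub>Q_laurent\<^esub>) (vm1_power n)"
    by (rule rcos_ring_hom_ring)
  show "vm1_coset n a \<otimes>\<^bsub>Q_laurent Quot vm1_power n\<^esub> vm1_coset n b = vm1_coset n (a * b)"
    "vm1_coset n a \<oplus>\<^bsub>Q_laurent Quot vm1_power n\<^esub> vm1_coset n b = vm1_coset n (a + b)"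
    "\<one>\<^bsub>Q_laurent Quot vm1_power n\<^esub> = vm1_coset n 1"
    "\<zero>\<^bsub>Q_laurent Quot vm1_power n\<^esub> = vm1_coset n 0"
    using h.hom_mult[of a b] h.hom_add[of a b] h.hom_one h.hom_zero by (simp_all add: vm1_coset_def)
qed

lemma R_ring_ops:
  "R_of a \<otimes>\<^bsub>R_ring\<^esub> R_of b = R_of (\<lambda>n. a n * b n)"
  "R_of a \<oplus>\<^bsub>R_ring\<^esub> R_of b = R_of (\<lambda>n. a n + b n)"
  "\<one>\<^bsub>R_ring\<^esub> = R_of (\<lambda>_. 1)"
  "\<zero>\<^bsub>R_ring\<^esub> = R_of (\<lambda>_. 0)"
  by (simp_all add: R_ring_def adic_completion_def R_of_def vm1_coset_ops)

lemma carrier_vm1_quot: "carrier (Q_laurent Quot vm1_power n) = range (vm1_coset n)"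
  by (auto simp: FactRing_def A_RCOSETS_def' vm1_coset_def)

lemma vm1_coset_subset_iff: "vm1_coset (Suc n) a \<subseteq> vm1_coset n b \<longleftrightarrow> vm1 ^ n dvd a - b"
proof
  assume "vm1_coset (Suc n) a \<subseteq> vm1_coset n b"
  moreover have "a \<in> vm1_coset (Suc n) a" by (simp add: vm1_coset_alt)
  ultimately have "a \<in> vm1_coset n b" by blast
  then show "vm1 ^ n dvd a - b" by (simp add: vm1_coset_alt)
next
  assume ab: "vm1 ^ n dvd a - b"
  have "vm1 ^ n dvd x - b" if "vm1 ^ Suc n dvd x - a" for x
  proof -
    have "vm1 ^ n dvd x - a" using that by (rule power_le_dvd) simp
    then show ?thesis using dvd_add[OF _ ab, of "x - a"] by simp
  qed
  then show "vm1_coset (Suc n) a \<subseteq> vm1_coset n b" by (auto simp: vm1_coset_alt)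
qed

lemma carrier_R_ring: "carrier R_ring = R_of ` {a. coherent a}"
proof (intro equalityI subsetI)
  fix x assume "x \<in> carrier R_ring"
  then have x: "\<And>n. x n \<in> range (vm1_coset n)" "\<And>n. x (Suc n) \<subseteq> x n"
    by (auto simp: R_ring_def adic_completion_def carrier_vm1_quot)
  have "\<forall>n. \<exists>a. x n = vm1_coset n a" using x(1) by blast
  then obtain a where a: "\<And>n. x n = vm1_coset n (a n)" by metis
  then have "x = R_of a" by (simp add: R_of_def fun_eq_iff)
  moreover have "coherent a" using x(2) by (simp add: a coherent_def vm1_coset_subset_iff)
  ultimately show "x \<in> R_of ` {a. coherent a}" by blast
next
  fix x assume "x \<in> R_of ` {a. coherent a}"
  then obtain a where a: "x = R_of a" "coherent a" by auto
  then have "vm1_coset (Suc n) (a (Suc n)) \<subseteq> vm1_coset n (a n)" for n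
    by (simp add: coherent_def vm1_coset_subset_iff)
  then show "x \<in> carrier R_ring"
    by (simp add: a(1) R_ring_def adic_completion_def carrier_vm1_quot R_of_def)
qed

lemma coherent_const: "coherent (\<lambda>_. a)"
  by (simp add: coherent_def)

lemma coherent_add: "coherent a \<Longrightarrow> coherent b \<Longrightarrow> coherent (\<lambda>n. a n + b n)"
  unfolding coherent_def by (metis add_diff_add dvd_add)

lemma coherent_mult:
  assumes "coherent a" "coherent b"
  shows "coherent (\<lambda>n. a n * b n)"
  unfolding coherent_def
proof
  fix n
  have "a (Suc n) * b (Suc n) - a n * b n = (a (Suc n) - a n) * b (Suc n) + a n * (b (Suc n) - b n)"
    by (simp add: algebra_simps)
  then show "vm1 ^ n dvd a (Suc n) * b (Suc n) - a n * b n"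
    using assms unfolding coherent_def by (simp only: dvd_add dvd_mult dvd_mult2)
qed

lemma cring_R_ring: "cring R_ring"
proof (rule cringI)
  show "abelian_group R_ring"
  proof (rule abelian_groupI)
    fix x assume "x \<in> carrier R_ring"
    then obtain a where a: "coherent a" "x = R_of a" by (auto simp: carrier_R_ring)
    have "R_of (\<lambda>n. -1 * a n) \<in> carrier R_ring"
      using coherent_mult[OF coherent_const a(1), of "-1"] by (auto simp: carrier_R_ring)
    then show "\<exists>y\<in>carrier R_ring. y \<oplus>\<^bsub>R_ring\<^esub> x = \<zero>\<^bsub>R_ring\<^esub>"
      by (rule bexI[rotated]) (simp add: a R_ring_ops)
  qed (auto simp: carrier_R_ring R_ring_ops coherent_add coherent_const add_ac)
  show "comm_monoid R_ring"
    by (rule comm_monoidI)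
      (auto simp: carrier_R_ring R_ring_ops coherent_mult coherent_const mult_ac)
qed (auto simp: carrier_R_ring R_ring_ops distrib_right)

lemma R_scalar_eq: "R_scalar k = R_of (\<lambda>_. Poly_Mapping.map of_int k)"
  by (simp add: R_scalar_def to_completion_def R_of_def vm1_coset_def)

lemma R_scalar_closed [simp, intro]: "R_scalar k \<in> carrier R_ring"
  by (auto simp: R_scalar_eq carrier_R_ring coherent_const)

text \<open>Evaluation at v = 1 on the completion. It is read off at level 1, the quotient by (v -
  1), since level 0 is the zero ring; the chosen representative does not affect the value of
  \<open>aug\<close>.\<close>

definition R_ev :: "R_elt \<Rightarrow> rat" where
  "R_ev x = aug (SOME a. a \<in> x 1)"

lemma R_ev_R_of: "R_ev (R_of a) = aug (a 1)"
proof -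
  have "a 1 \<in> R_of a 1" by (simp add: R_of_def vm1_coset_alt)
  then have "(SOME b. b \<in> R_of a 1) \<in> R_of a 1" by (rule someI)
  then have "vm1 dvd (SOME b. b \<in> R_of a 1) - a 1" by (simp add: R_of_def vm1_coset_alt)
  then show ?thesis using aug_v_minus_1_dvd unfolding R_ev_def by (fastforce simp: aug_diff)
qed

lemma R_ev_hom:
  assumes "x \<in> carrier R_ring" "y \<in> carrier R_ring"
  shows "R_ev (x \<otimes>\<^bsub>R_ring\<^esub> y) = R_ev x * R_ev y" "R_ev (x \<oplus>\<^bsub>R_ring\<^esub> y) = R_ev x + R_ev y"
  using assms by (auto simp: carrier_R_ring R_ring_ops R_ev_R_of aug_mult aug_add)

lemma R_ev_one: "R_ev \<one>\<^bsub>R_ring\<^esub> = 1"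
  by (simp add: R_ring_ops R_ev_R_of)

lemma R_ev_scalar: "R_ev (R_scalar k) = of_int (aug k)"
  by (simp add: R_scalar_eq R_ev_R_of aug_map_of_int)

section \<open>Power series in X = v - 1 as elements of the completion\<close>

definition fps_trunc :: "rat fps \<Rightarrow> nat \<Rightarrow> rat laurent" where
  "fps_trunc f n = (\<Sum>k<n. single 0 (fps_nth f k) * vm1 ^ k)"

text \<open>Substitution of v - 1 for X: truncation below degree n represents the result modulo (v -
  1)^n.\<close>

definition R_of_fps :: "rat fps \<Rightarrow> R_elt" where
  "R_of_fps f = R_of (fps_trunc f)"

lemma coherent_fps_trunc: "coherent (fps_trunc f)"
  by (simp add: coherent_def fps_trunc_def)

lemma R_of_fps_closed [simp, intro]: "R_of_fps f \<in> carrier R_ring"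
  by (auto simp: R_of_fps_def carrier_R_ring coherent_fps_trunc)

lemma R_of_eqI: "(\<And>n. vm1 ^ n dvd a n - b n) \<Longrightarrow> R_of a = R_of b"
  unfolding R_of_def by (rule ext) (simp add: vm1_coset_eq_iff)

lemma fps_trunc_add: "fps_trunc (f + g) n = fps_trunc f n + fps_trunc g n"
  by (simp add: fps_trunc_def single_add distrib_right sum.distrib)

lemma fps_trunc_const_mult:
  "fps_trunc (fps_const c * f) n = single 0 c * fps_trunc f n"
  by (simp add: fps_trunc_def sum_distrib_left mult.assoc[symmetric] mult_single)

lemma fps_trunc_X_mult: "fps_trunc (fps_X * f) (Suc n) = vm1 * fps_trunc f n"
  unfolding fps_trunc_def sum.lessThan_Suc_shift by (simp add: sum_distrib_left mult_ac)

text \<open>Splitting off the constant term, f = c + X h, expresses the error at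
  \<open>Suc n\<close> by v - 1 times the error for \<open>h\<close> at \<open>n\<close> and by the
  top term of the truncation of \<open>g\<close>.\<close>

lemma fps_trunc_mult: "vm1 ^ n dvd fps_trunc (f * g) n - fps_trunc f n * fps_trunc g n"
proof (induction n arbitrary: f)
  case (Suc n)
  define c where "c = fps_nth f 0"
  define h where "h = fps_shift 1 f"
  have f: "f = fps_const c + fps_X * h"
    unfolding c_def h_def by (rule fps_ext) (simp add: fps_X_mult_nth split: nat_diff_split)
  have one: "fps_trunc (fps_const c) (Suc n) = single 0 c"
    unfolding fps_trunc_def sum.lessThan_Suc_shift by simp
  have "f * g = fps_const c * g + fps_X * (h * g)" by (subst f) (simp add: algebra_simps)
  then have fg: "fps_trunc (f * g) (Suc n) =
      single 0 c * fps_trunc g (Suc n) + vm1 * fps_trunc (h * g) n"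
    by (simp only: fps_trunc_add fps_trunc_const_mult fps_trunc_X_mult)
  have f': "fps_trunc f (Suc n) = single 0 c + vm1 * fps_trunc h n"
    by (subst f) (simp only: fps_trunc_add one fps_trunc_X_mult)
  have "fps_trunc (f * g) (Suc n) - fps_trunc f (Suc n) * fps_trunc g (Suc n) =
      vm1 * (fps_trunc (h * g) n - fps_trunc h n * fps_trunc g n) -
      vm1 * fps_trunc h n * (fps_trunc g (Suc n) - fps_trunc g n)"
    unfolding fg f' by (simp add: algebra_simps)
  moreover have "vm1 ^ Suc n dvd vm1 * (fps_trunc (h * g) n - fps_trunc h n * fps_trunc g n)"
    unfolding power_Suc using Suc by (intro mult_dvd_mono dvd_refl) auto
  moreover have "vm1 ^ Suc n dvd vm1 * fps_trunc h n * (fps_trunc g (Suc n) - fps_trunc g n)"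
    unfolding power_Suc using coherent_fps_trunc[of g]
    by (intro mult_dvd_mono) (auto simp only: coherent_def dvd_triv_left)
  ultimately show ?case by (simp only: dvd_diff)
qed simp

lemma R_of_fps_hom:
  "R_of_fps (f + g) = R_of_fps f \<oplus>\<^bsub>R_ring\<^esub> R_of_fps g"
  "R_of_fps (f * g) = R_of_fps f \<otimes>\<^bsub>R_ring\<^esub> R_of_fps g"
  "R_of_fps 1 = \<one>\<^bsub>R_ring\<^esub>"
proof -
  show "R_of_fps (f + g) = R_of_fps f \<oplus>\<^bsub>R_ring\<^esub> R_of_fps g"
    by (simp add: R_of_fps_def R_ring_ops fps_trunc_add[abs_def])
  show "R_of_fps (f * g) = R_of_fps f \<otimes>\<^bsub>R_ring\<^esub> R_of_fps g"
    unfolding R_of_fps_def R_ring_ops by (intro R_of_eqI fps_trunc_mult)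
  have "vm1 ^ n dvd fps_trunc 1 n - 1" for n
    by (cases n) (simp_all add: fps_trunc_def sum.lessThan_Suc_shift del: sum.lessThan_Suc)
  then show "R_of_fps 1 = \<one>\<^bsub>R_ring\<^esub>" unfolding R_of_fps_def R_ring_ops by (rule R_of_eqI)
qed

lemma R_of_fps_X: "R_of_fps fps_X = R_scalar (v_pow 1 - 1)"
proof -
  have map: "Poly_Mapping.map of_int (v_pow 1 - 1 :: int laurent) = vm1"
    by (rule poly_mapping_eqI) (simp add: Poly_Mapping.map.rep_eq lookup_minus v_pow_def lookup_single lookup_one when_def)
  have "vm1 ^ n dvd fps_trunc fps_X n - vm1" for n
  proof (cases n)
    case (Suc m)
    have "fps_trunc (fps_X * 1) (Suc m) = vm1 * fps_trunc 1 m" by (rule fps_trunc_X_mult)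
    then have X: "fps_trunc fps_X n = vm1 * fps_trunc 1 m" using Suc by simp
    show ?thesis
    proof (cases m)
      case 0
      \<comment> \<open>Here n = 1: the truncation of X is 0, which still agrees with v - 1 modulo v
        - 1.\<close>
      then have "fps_trunc fps_X n - vm1 = vm1 ^ n * (- 1)" using X Suc by (simp add: fps_trunc_def)
      then show ?thesis by (simp only: dvd_triv_left)
    next
      case (Suc k)
      then have "fps_trunc 1 m = 1"
        by (simp add: fps_trunc_def sum.lessThan_Suc_shift del: sum.lessThan_Suc)
      then show ?thesis using X by simp
    qed
  qed simp
  then show ?thesis unfolding R_of_fps_def R_scalar_eq map by (rule R_of_eqI)
qed

lemma R_ev_R_of_fps: "R_ev (R_of_fps f) = fps_nth f 0"
  by (simp add: R_of_fps_def R_ev_R_of fps_trunc_def)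

text \<open>The coefficients are the (v - 1)-adic digits of \<open>x\<close>, found one at a time.
  If the remainder at stage n is (v - 1)^n d, the next digit is d evaluated at v = 1.\<close>

lemma R_of_fps_surj:
  assumes "x \<in> carrier R_ring"
  obtains f where "x = R_of_fps f"
proof -
  obtain a where a: "coherent a" "x = R_of a" using assms by (auto simp: carrier_R_ring)
  \<comment> \<open>The condition at \<open>n = 0\<close> fixes the start at 0, which divisibility
    by the zeroth power would leave open. Thus \<open>s n\<close> is exactly a truncation.\<close>
  have "\<exists>s. \<forall>n. vm1 ^ n dvd a n - s n \<and> (\<exists>q. s (Suc n) = s n + single 0 q * vm1 ^ n) \<and> (n = 0 \<longrightarrow> s n = 0)"
  proof -
    have "\<exists>s. \<forall>n. (vm1 ^ n dvd a n - s n \<and> (n = 0 \<longrightarrow> s n = 0)) \<and>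
        (\<exists>q. s (Suc n) = s n + single 0 q * vm1 ^ n)"
    proof (rule dependent_nat_choice)
      show "\<exists>s. vm1 ^ 0 dvd a 0 - s \<and> (0 = 0 \<longrightarrow> s = 0)" by auto
    next
      fix s n assume "vm1 ^ n dvd a n - s \<and> (n = 0 \<longrightarrow> s = 0)"
      then have "vm1 ^ n dvd (a (Suc n) - a n) + (a n - s)"
        using a(1) unfolding coherent_def by (intro dvd_add) auto
      then obtain d where d: "a (Suc n) - s = vm1 ^ n * d" by (auto simp: dvd_def)
      have "a (Suc n) - (s + single 0 (aug d) * vm1 ^ n) =
          vm1 ^ n * (d - single 0 (aug d))"
        using d by (simp add: algebra_simps)
      then have "vm1 ^ Suc n dvd a (Suc n) - (s + single 0 (aug d) * vm1 ^ n)"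
        using v_minus_1_dvd_aug[of d] by (simp add: mult_dvd_mono mult.commute[of vm1])
      then show "\<exists>s'. (vm1 ^ Suc n dvd a (Suc n) - s' \<and> (Suc n = 0 \<longrightarrow> s' = 0)) \<and>
          (\<exists>q. s' = s + single 0 q * vm1 ^ n)" by blast
    qed
    then show ?thesis by blast
  qed
  then obtain s where s: "\<And>n. vm1 ^ n dvd a n - s n" "s 0 = 0"
    "\<And>n. \<exists>q. s (Suc n) = s n + single 0 q * vm1 ^ n" by blast
  then obtain q where q: "\<And>n. s (Suc n) = s n + single 0 (q n) * vm1 ^ n" by metis
  have "s n = fps_trunc (Abs_fps q) n" for n
    by (induction n) (simp_all add: s(2) q fps_trunc_def)
  then have "x = R_of_fps (Abs_fps q)"
    unfolding a(2) R_of_fps_def using s(1) by (intro R_of_eqI) simp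
  then show ?thesis using that by blast
qed


section \<open>Tensor products\<close>

lemma pm_lift_diff:
  fixes \<psi> :: "'g \<Rightarrow> 'k::ab_group_add \<Rightarrow> 'x::ab_group_add"
  assumes "\<And>a x y. \<psi> a (x + y) = \<psi> a x + \<psi> a y"
  shows "pm_lift \<psi> (f - g) = pm_lift \<psi> f - pm_lift \<psi> g"
  using pm_lift_add[of \<psi> "f - g" g, OF assms] by simp

lemma monoid_ring_scalar_central:
  assumes "monoid G" "f \<in> carrier (monoid_ring G)"
  shows "f \<otimes>\<^bsub>monoid_ring G\<^esub> single \<one>\<^bsub>G\<^esub> c =
    single \<one>\<^bsub>G\<^esub> c \<otimes>\<^bsub>monoid_ring G\<^esub> f"
proof -
  interpret monoid G by fact
  have "keys f \<subseteq> carrier G" using assms by simp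
  then show ?thesis
    by (induction f rule: poly_mapping_keys_induct)
      (simp_all add: monoid_ring_single_mult monoid_ring_add_left monoid_ring_add_right mult.commute)
qed

lemma (in ring) diff_diff_eq_zero:
  assumes "x \<in> carrier R" "y \<in> carrier R" "z \<in> carrier R" "x \<ominus> y \<ominus> z = \<zero>"
  shows "x = y \<oplus> z"
proof -
  have "x \<ominus> y = z" using assms by simp
  then have "y \<oplus> (x \<oplus> \<ominus> y) = y \<oplus> z" by (simp add: minus_eq)
  then show ?thesis using assms(1-3) by (simp add: a_lcomm r_neg)
qed

locale tensor_data = R: cring R + H: ring H
  for R :: "('r, 'x) ring_scheme" and H :: "('h, 'y) ring_scheme" +
  fixes i :: "'k \<Rightarrow> 'r" and j :: "'k \<Rightarrow> 'h"
  assumes i_closed [simp]: "i k \<in> carrier R" and j_closed [simp]: "j k \<in> carrier H"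
begin

abbreviation M :: "('r \<times> 'h \<Rightarrow>\<^sub>0 int) ring" where
  "M \<equiv> monoid_ring (R \<times>\<times> H)"

abbreviation T :: "('r \<times> 'h \<Rightarrow>\<^sub>0 int) set ring" where
  "T \<equiv> tensor_ring R H i j"

abbreviation pt :: "'r \<Rightarrow> 'h \<Rightarrow> ('r \<times> 'h \<Rightarrow>\<^sub>0 int) set" where
  "pt \<equiv> pure_tensor R H i j"

lemma monoid_DirProd: "monoid (R \<times>\<times> H)"
  by (rule DirProd_monoid) (rule R.monoid_axioms H.monoid_axioms)+

sublocale M: ring M
  by (rule ring_monoid_ring[OF monoid_DirProd])

lemma single_closed: "r \<in> carrier R \<Longrightarrow> h \<in> carrier H \<Longrightarrow> single (r, h) c \<in> carrier M"
  by auto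

lemma M_diff_closed: "f \<in> carrier M \<Longrightarrow> g \<in> carrier M \<Longrightarrow> f - g \<in> carrier M"
  using M.a_closed[of f "\<ominus>\<^bsub>M\<^esub> g"] monoid_ring_a_inv[OF monoid_DirProd, of g]
  by simp

lemma tensor_relations_closed: "tensor_relations R H i j \<subseteq> carrier M"
  unfolding tensor_relations_def Let_def
  by (auto simp del: monoid_ring_simps intro!: M_diff_closed single_closed)

sublocale I: ideal "tensor_ideal R H i j" M
  unfolding tensor_ideal_def by (rule M.genideal_ideal[OF tensor_relations_closed])

sublocale T: ring T
  unfolding tensor_ring_def by (rule I.quotient_is_ring)

sublocale q: ring_hom_ring M T "\<lambda>f. tensor_ideal R H i j +>\<^bsub>M\<^esub> f"
  unfolding tensor_ring_def by (rule I.rcos_ring_hom_ring)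

lemma q_diff:
  assumes "f \<in> carrier M" "g \<in> carrier M"
  shows "tensor_ideal R H i j +>\<^bsub>M\<^esub> (f - g) =
    (tensor_ideal R H i j +>\<^bsub>M\<^esub> f) \<ominus>\<^bsub>T\<^esub> (tensor_ideal R H i j +>\<^bsub>M\<^esub> g)"
proof -
  have "f - g = f \<oplus>\<^bsub>M\<^esub> \<ominus>\<^bsub>M\<^esub> g" using monoid_ring_a_inv[OF monoid_DirProd assms(2)] by simp
  then show ?thesis
    using assms by (simp only: q.hom_add q.hom_a_inv M.a_inv_closed T.minus_eq)
qed

lemma q_relation:
  assumes "x \<in> tensor_relations R H i j"
  shows "tensor_ideal R H i j +>\<^bsub>M\<^esub> x = \<zero>\<^bsub>T\<^esub>"
proof -
  have "x \<in> tensor_ideal R H i j"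
    using M.genideal_self[OF tensor_relations_closed] assms unfolding tensor_ideal_def by blast
  then show ?thesis using I.a_rcos_const[of x] by (simp add: tensor_ring_def FactRing_def)
qed

lemma pt_closed [simp, intro]: "r \<in> carrier R \<Longrightarrow> h \<in> carrier H \<Longrightarrow> pt r h \<in> carrier T"
  unfolding pure_tensor_def by (intro q.hom_closed single_closed)

lemma pt_mult:
  assumes "r \<in> carrier R" "h \<in> carrier H" "r' \<in> carrier R" "h' \<in> carrier H"
  shows "pt r h \<otimes>\<^bsub>T\<^esub> pt r' h' = pt (r \<otimes>\<^bsub>R\<^esub> r') (h \<otimes>\<^bsub>H\<^esub> h')"
  unfolding pure_tensor_def using assms
  by (subst q.hom_mult[symmetric]) (auto simp: monoid_ring_single_mult)

lemma pt_one: "pt \<one>\<^bsub>R\<^esub> \<one>\<^bsub>H\<^esub> = \<one>\<^bsub>T\<^esub>"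
  unfolding pure_tensor_def using q.hom_one by simp

lemma pt_add_left:
  assumes "r \<in> carrier R" "r' \<in> carrier R" "h \<in> carrier H"
  shows "pt (r \<oplus>\<^bsub>R\<^esub> r') h = pt r h \<oplus>\<^bsub>T\<^esub> pt r' h"
proof -
  let ?e = "\<lambda>r h. single (r, h) (1::int)"
  have "?e (r \<oplus>\<^bsub>R\<^esub> r') h - ?e r h - ?e r' h \<in> tensor_relations R H i j"
    using assms unfolding tensor_relations_def Let_def by blast
  from q_relation[OF this] have "pt (r \<oplus>\<^bsub>R\<^esub> r') h \<ominus>\<^bsub>T\<^esub> pt r h \<ominus>\<^bsub>T\<^esub> pt r' h = \<zero>\<^bsub>T\<^esub>"
    unfolding pure_tensor_def using assms
    by (simp only: q_diff M_diff_closed single_closed R.a_closed H.a_closed)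
  then show ?thesis using assms by (intro T.diff_diff_eq_zero) simp_all
qed

lemma pt_add_right:
  assumes "r \<in> carrier R" "h \<in> carrier H" "h' \<in> carrier H"
  shows "pt r (h \<oplus>\<^bsub>H\<^esub> h') = pt r h \<oplus>\<^bsub>T\<^esub> pt r h'"
proof -
  let ?e = "\<lambda>r h. single (r, h) (1::int)"
  have "?e r (h \<oplus>\<^bsub>H\<^esub> h') - ?e r h - ?e r h' \<in> tensor_relations R H i j"
    using assms unfolding tensor_relations_def Let_def by blast
  from q_relation[OF this] have "pt r (h \<oplus>\<^bsub>H\<^esub> h') \<ominus>\<^bsub>T\<^esub> pt r h \<ominus>\<^bsub>T\<^esub> pt r h' = \<zero>\<^bsub>T\<^esub>"
    unfolding pure_tensor_def using assms
    by (simp only: q_diff M_diff_closed single_closed R.a_closed H.a_closed)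
  then show ?thesis using assms by (intro T.diff_diff_eq_zero) simp_all
qed

lemma pt_balanced:
  assumes "r \<in> carrier R" "h \<in> carrier H"
  shows "pt (r \<otimes>\<^bsub>R\<^esub> i k) h = pt r (j k \<otimes>\<^bsub>H\<^esub> h)"
proof -
  let ?e = "\<lambda>r h. single (r, h) (1::int)"
  have "?e (r \<otimes>\<^bsub>R\<^esub> i k) h - ?e r (j k \<otimes>\<^bsub>H\<^esub> h) \<in> tensor_relations R H i j"
    using assms unfolding tensor_relations_def Let_def by blast
  from q_relation[OF this] have "pt (r \<otimes>\<^bsub>R\<^esub> i k) h \<ominus>\<^bsub>T\<^esub> pt r (j k \<otimes>\<^bsub>H\<^esub> h) = \<zero>\<^bsub>T\<^esub>"
    unfolding pure_tensor_def using assms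
    by (subst (asm) q_diff) (simp_all del: monoid_ring_simps add: single_closed)
  then show ?thesis using assms by simp
qed

text \<open>An element of the tensor ring is a finite integer combination of pure tensors. The
  integer coefficients account for the \<open>minus\<close> case.\<close>

lemma tensor_induct [consumes 1, case_names pure zero add minus]:
  assumes "x \<in> carrier T"
    and "\<And>r h. r \<in> carrier R \<Longrightarrow> h \<in> carrier H \<Longrightarrow> P (pt r h)"
    and "P \<zero>\<^bsub>T\<^esub>"
    and "\<And>x y. x \<in> carrier T \<Longrightarrow> y \<in> carrier T \<Longrightarrow> P x \<Longrightarrow> P y \<Longrightarrow> P (x \<oplus>\<^bsub>T\<^esub> y)"
    and "\<And>x. x \<in> carrier T \<Longrightarrow> P x \<Longrightarrow> P (\<ominus>\<^bsub>T\<^esub> x)"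
  shows "P x"
proof -
  let ?q = "\<lambda>f. tensor_ideal R H i j +>\<^bsub>M\<^esub> f"
  obtain f where f: "f \<in> carrier M" "x = ?q f"
    using assms(1) unfolding tensor_ring_def FactRing_def A_RCOSETS_def' by auto
  have q_add: "?q (f + g) = ?q f \<oplus>\<^bsub>T\<^esub> ?q g" if "f \<in> carrier M" "g \<in> carrier M" for f g
    using q.hom_add[OF that] by simp
  have "P (?q f)" if "keys f \<subseteq> carrier R \<times> carrier H" for f
    using that
  proof (induction f rule: poly_mapping_keys_induct)
    case zero
    then show ?case using assms(3) q.hom_zero by simp
  next
    case (single a n)
    then obtain r h where a: "a = (r, h)" "r \<in> carrier R" "h \<in> carrier H" by auto
    have s: "single a m \<in> carrier M" for m using a single_closed by blast
    have nat: "P (?q (single a (int m)))" for m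
    proof (induction m)
      case 0
      then show ?case using assms(3) q.hom_zero by simp
    next
      case (Suc m)
      have "single a (int (Suc m)) =
          single a 1 + single a (int m)"
        by (simp add: single_add[symmetric])
      moreover have "P (?q (single a 1))"
        using assms(2)[OF a(2,3)] a(1) by (simp add: pure_tensor_def)
      ultimately show ?case using assms(4) Suc s q.hom_closed[OF s] by (simp only: q_add)
    qed
    show ?case
    proof (cases n)
      case (nonneg m)
      then show ?thesis using nat by simp
    next
      case (neg m)
      have "?q (0 - single a (int (Suc m))) =
          ?q 0 \<ominus>\<^bsub>T\<^esub> ?q (single a (int (Suc m)))"
        by (intro q_diff s) simp
      moreover have "?q 0 = \<zero>\<^bsub>T\<^esub>" using q.hom_zero by simp
      moreover have "single a n = 0 - single a (int (Suc m))"
        using neg by (simp only: single_uminus diff_0)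
      ultimately have "?q (single a n) = \<ominus>\<^bsub>T\<^esub> ?q (single a (int (Suc m)))"
        using q.hom_closed[OF s] by (simp only: T.minus_eq T.l_zero T.a_inv_closed)
      then show ?thesis using assms(5)[OF q.hom_closed[OF s] nat] by (simp only:)
    qed
  next
    case (add f g)
    then have "f \<in> carrier M" "g \<in> carrier M" by auto
    then show ?case
      using add.IH assms(4) q.hom_closed by (simp only: q_add)
  qed
  then show ?thesis using f by simp
qed

text \<open>The universal property of the tensor product of algebras: \<open>\<mu>\<close> lifts
  first to the monoid ring on pairs, and then factors through the three families of
  relations.\<close>

lemma tensor_lift:
  fixes K :: "('w, 'z) monoid_scheme" and \<mu> :: "'r \<Rightarrow> 'h \<Rightarrow> ('w \<Rightarrow>\<^sub>0 'l::comm_ring_1)"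
  assumes K: "monoid K"
    and closed: "\<And>r h. r \<in> carrier R \<Longrightarrow> h \<in> carrier H \<Longrightarrow> \<mu> r h \<in> carrier (monoid_ring K)"
    and mult: "\<And>r h r' h'. r \<in> carrier R \<Longrightarrow> h \<in> carrier H \<Longrightarrow> r' \<in> carrier R \<Longrightarrow> h' \<in> carrier H \<Longrightarrow>
      \<mu> (r \<otimes>\<^bsub>R\<^esub> r') (h \<otimes>\<^bsub>H\<^esub> h') = \<mu> r h \<otimes>\<^bsub>monoid_ring K\<^esub> \<mu> r' h'"
    and one: "\<mu> \<one>\<^bsub>R\<^esub> \<one>\<^bsub>H\<^esub> = \<one>\<^bsub>monoid_ring K\<^esub>"
    and add_left: "\<And>r r' h. r \<in> carrier R \<Longrightarrow> r' \<in> carrier R \<Longrightarrow> h \<in> carrier H \<Longrightarrow>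
      \<mu> (r \<oplus>\<^bsub>R\<^esub> r') h = \<mu> r h + \<mu> r' h"
    and add_right: "\<And>r h h'. r \<in> carrier R \<Longrightarrow> h \<in> carrier H \<Longrightarrow> h' \<in> carrier H \<Longrightarrow>
      \<mu> r (h \<oplus>\<^bsub>H\<^esub> h') = \<mu> r h + \<mu> r h'"
    and balanced: "\<And>r h k. r \<in> carrier R \<Longrightarrow> h \<in> carrier H \<Longrightarrow>
      \<mu> (r \<otimes>\<^bsub>R\<^esub> i k) h = \<mu> r (j k \<otimes>\<^bsub>H\<^esub> h)"
  obtains F where "F \<in> ring_hom T (monoid_ring K)"
    and "\<And>r h. r \<in> carrier R \<Longrightarrow> h \<in> carrier H \<Longrightarrow> F (pt r h) = \<mu> r h"
proof -
  interpret K: ring "monoid_ring K :: ('w \<Rightarrow>\<^sub>0 'l) ring" by (rule ring_monoid_ring[OF K])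
  let ?sc = "\<lambda>c. single \<one>\<^bsub>K\<^esub> c :: 'w \<Rightarrow>\<^sub>0 'l"
  \<comment> \<open>The integer multiple is written as multiplication by a central scalar of the
    target, so multiplicativity follows from associativity and centrality.\<close>
  define \<psi> where "\<psi> = (\<lambda>(r, h) n. ?sc (of_int n) \<otimes>\<^bsub>monoid_ring K\<^esub> \<mu> r h)"
  interpret Km: monoid K by (rule K)
  have sc: "?sc c \<in> carrier (monoid_ring K)" for c by simp
  have sc_mult: "?sc (c * d) = ?sc c \<otimes>\<^bsub>monoid_ring K\<^esub> ?sc d" for c d
    by (simp add: monoid_ring_single_mult)
  have add: "\<psi> a (x + y) = \<psi> a x + \<psi> a y" for a x y
    by (cases a) (simp add: \<psi>_def single_add monoid_ring_add_left)
  have hom: "pm_lift \<psi> \<in> ring_hom M (monoid_ring K)"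
  proof (rule pm_lift_ring_hom[OF monoid_DirProd K add])
    fix a b :: "'r \<times> 'h" and x y :: int
    assume a: "a \<in> carrier (R \<times>\<times> H)" and b: "b \<in> carrier (R \<times>\<times> H)"
    obtain r h r' h' where ab: "a = (r, h)" "b = (r', h')" by (cases a; cases b)
    have c: "r \<in> carrier R" "h \<in> carrier H" "r' \<in> carrier R" "h' \<in> carrier H" using a b ab by auto
    show "\<psi> a x \<in> carrier (monoid_ring K)"
      unfolding \<psi>_def ab prod.case using closed[OF c(1,2)] sc by (rule K.m_closed[rotated])
    have "?sc (of_int x * of_int y) \<otimes>\<^bsub>monoid_ring K\<^esub> (\<mu> r h \<otimes>\<^bsub>monoid_ring K\<^esub> \<mu> r' h') =
        ?sc (of_int x) \<otimes>\<^bsub>monoid_ring K\<^esub> \<mu> r h \<otimes>\<^bsub>monoid_ring K\<^esub>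
          (?sc (of_int y) \<otimes>\<^bsub>monoid_ring K\<^esub> \<mu> r' h')" (is "?l = ?r")
    proof -
      note cl = closed[OF c(1,2)] closed[OF c(3,4)] sc[of "of_int x"] sc[of "of_int y"]
      have "?r = ?sc (of_int x) \<otimes>\<^bsub>monoid_ring K\<^esub> (\<mu> r h \<otimes>\<^bsub>monoid_ring K\<^esub> ?sc (of_int y)) \<otimes>\<^bsub>monoid_ring K\<^esub> \<mu> r' h'"
        using cl by (simp only: K.m_assoc K.m_closed)
      also have "\<mu> r h \<otimes>\<^bsub>monoid_ring K\<^esub> ?sc (of_int y) = ?sc (of_int y) \<otimes>\<^bsub>monoid_ring K\<^esub> \<mu> r h"
        by (rule monoid_ring_scalar_central[OF K cl(1)])
      also have "?sc (of_int x) \<otimes>\<^bsub>monoid_ring K\<^esub> (?sc (of_int y) \<otimes>\<^bsub>monoid_ring K\<^esub> \<mu> r h) \<otimes>\<^bsub>monoid_ring K\<^esub> \<mu> r' h' = ?l"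
        unfolding sc_mult using cl by (simp only: K.m_assoc K.m_closed)
      finally show ?thesis by (rule HOL.sym)
    qed
    then show "\<psi> (a \<otimes>\<^bsub>R \<times>\<times> H\<^esub> b) (x * y) = \<psi> a x \<otimes>\<^bsub>monoid_ring K\<^esub> \<psi> b y"
      by (simp add: ab \<psi>_def mult[OF c])
  next
    show "\<psi> \<one>\<^bsub>R \<times>\<times> H\<^esub> 1 = \<one>\<^bsub>monoid_ring K\<^esub>"
      by (simp add: \<psi>_def one monoid_ring_single_mult)
  qed
  have e: "pm_lift \<psi> (single (r, h) 1) = \<mu> r h"
    if "r \<in> carrier R" "h \<in> carrier H" for r h
  proof -
    have "pm_lift \<psi> (single (r, h) 1) = \<one>\<^bsub>monoid_ring K\<^esub> \<otimes>\<^bsub>monoid_ring K\<^esub> \<mu> r h"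
      unfolding pm_lift_single[of \<psi>, OF add] by (simp add: \<psi>_def)
    then show ?thesis using closed[OF that] by (simp only: K.l_one)
  qed
  have "pm_lift \<psi> x = \<zero>\<^bsub>monoid_ring K\<^esub>" if "x \<in> tensor_relations R H i j" for x
    using that unfolding tensor_relations_def Let_def
    by (elim UnE CollectE exE conjE)
      (simp_all add: pm_lift_diff[of \<psi>, OF add] e add_left add_right balanced)
  then obtain F where F: "F \<in> ring_hom (M Quot (Idl\<^bsub>M\<^esub> (tensor_relations R H i j))) (monoid_ring K)"
    "\<And>x. x \<in> carrier M \<Longrightarrow> F (Idl\<^bsub>M\<^esub> (tensor_relations R H i j) +>\<^bsub>M\<^esub> x) = pm_lift \<psi> x"
    using genideal_quot_lift[OF M.ring_axioms K.ring_axioms hom tensor_relations_closed] by blast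
  show ?thesis
  proof
    show "F \<in> ring_hom T (monoid_ring K)" using F(1) by (simp only: tensor_ring_def tensor_ideal_def)
    show "F (pt r h) = \<mu> r h" if "r \<in> carrier R" "h \<in> carrier H" for r h
      using F(2)[OF single_closed[OF that]] e[OF that] by (simp only: pure_tensor_def tensor_ideal_def)
  qed
qed

end


section \<open>The completed Hecke algebra\<close>

context coxeter_group
begin

section \<open>The Hecke algebra as a quotient of the braid group ring\<close>

abbreviation bcl :: "'a word \<Rightarrow> 'a word set" where
  "bcl \<equiv> pres_class S (braid_relations W S)"

abbreviation hk :: "('a word set \<Rightarrow>\<^sub>0 int laurent) \<Rightarrow> 'a hecke_elt" where
  "hk f \<equiv> hecke_ideal W S +>\<^bsub>braid_ring W S\<^esub> f"

lemma monoid_braid_group: "monoid (braid_group W S)"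
  by (simp add: braid_group_def monoid_presented_group)

lemma ring_braid_ring: "ring (braid_ring W S)"
  unfolding braid_ring_def by (rule ring_monoid_ring[OF monoid_braid_group])

lemma bcl_closed [simp]: "w \<in> lists (S \<times> UNIV) \<Longrightarrow> bcl w \<in> carrier (braid_group W S)"
  by (simp add: braid_group_def presented_group_carrier)

lemma bcl_mult:
  "w \<in> lists (S \<times> UNIV) \<Longrightarrow> u \<in> lists (S \<times> UNIV) \<Longrightarrow> bcl w \<otimes>\<^bsub>braid_group W S\<^esub> bcl u = bcl (w @ u)"
  by (simp add: braid_group_def presented_group_mult)

lemma one_braid_group: "\<one>\<^bsub>braid_group W S\<^esub> = bcl []"
  by (simp add: braid_group_def presented_group_carrier)

lemma braid_single_closed [simp]:
  "w \<in> lists (S \<times> UNIV) \<Longrightarrow> single (bcl w) k \<in> carrier (braid_ring W S)"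
  by (simp add: braid_ring_def)

lemma braid_single_mult:
  "w \<in> lists (S \<times> UNIV) \<Longrightarrow> u \<in> lists (S \<times> UNIV) \<Longrightarrow>
    single (bcl w) k \<otimes>\<^bsub>braid_ring W S\<^esub> single (bcl u) l =
    single (bcl (w @ u)) (k * l)"
  by (simp add: braid_ring_def monoid_ring_single_mult bcl_mult)

lemma hecke_relation_eq:
  assumes "s \<in> S"
  shows "hecke_relation W S s = single (bcl [(s, True), (s, True)]) 1 -
    single (bcl [(s, True)]) (v_pow 1 - v_pow (- 1)) - single (bcl []) 1"
proof -
  have s: "[(s, True)] \<in> lists (S \<times> UNIV)" "[] \<in> lists (S \<times> UNIV)" using assms by auto
  have "v_pow 1 * v_pow (- 1) = (1 :: int laurent)" using v_pow_add[of 1 "- 1"] by simp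
  then show ?thesis
    unfolding hecke_relation_def Let_def braid_gen_def one_braid_group braid_ring_def
      monoid_ring_diff_left monoid_ring_add_right
    unfolding braid_ring_def[symmetric] braid_single_mult[OF s(1) s(1)] braid_single_mult[OF s(1) s(2)]
      braid_single_mult[OF s(2) s(1)] braid_single_mult[OF s(2) s(2)]
    by (simp add: single_diff)
qed

lemma hecke_relation_closed: "hecke_relation W S ` S \<subseteq> carrier (braid_ring W S)"
proof
  fix x assume "x \<in> hecke_relation W S ` S"
  then obtain s where s: "s \<in> S" "x = hecke_relation W S s" by auto
  interpret ring "braid_ring W S" by (rule ring_braid_ring)
  have diff: "f - g \<in> carrier (braid_ring W S)"
    if "f \<in> carrier (braid_ring W S)" "g \<in> carrier (braid_ring W S)" for f g
    using that a_closed[of f "\<ominus>\<^bsub>braid_ring W S\<^esub> g"] monoid_ring_a_inv[OF monoid_braid_group, of g]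
    by (simp add: braid_ring_def)
  show "x \<in> carrier (braid_ring W S)"
    unfolding s(2) hecke_relation_eq[OF s(1)] using s(1) by (intro diff braid_single_closed) auto
qed

lemma ideal_hecke: "ideal (hecke_ideal W S) (braid_ring W S)"
  unfolding hecke_ideal_def by (rule ring.genideal_ideal[OF ring_braid_ring hecke_relation_closed])

lemma ring_hecke_algebra: "ring (hecke_algebra W S)"
  unfolding hecke_algebra_def by (rule ideal.quotient_is_ring[OF ideal_hecke])

lemma hk_hom: "ring_hom_ring (braid_ring W S) (hecke_algebra W S) hk"
  unfolding hecke_algebra_def by (rule ideal.rcos_ring_hom_ring[OF ideal_hecke])

lemma hk_single_closed [simp]:
  "w \<in> lists (S \<times> UNIV) \<Longrightarrow> hk (single (bcl w) k) \<in> carrier (hecke_algebra W S)"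
  using ring_hom_closed[OF ring_hom_ring.homh[OF hk_hom]] by simp

lemma hk_single_mult:
  assumes "w \<in> lists (S \<times> UNIV)" "u \<in> lists (S \<times> UNIV)"
  shows "hk (single (bcl w) k) \<otimes>\<^bsub>hecke_algebra W S\<^esub> hk (single (bcl u) l) =
    hk (single (bcl (w @ u)) (k * l))"
  unfolding braid_single_mult[OF assms, symmetric]
  by (rule ring_hom_mult[OF ring_hom_ring.homh[OF hk_hom], symmetric]) (use assms in simp_all)

lemma hecke_scalar_eq: "hecke_scalar W S k = hk (single (bcl []) k)"
  by (simp add: hecke_scalar_def one_braid_group)

lemma hecke_scalar_closed: "hecke_scalar W S k \<in> carrier (hecke_algebra W S)"
  by (simp add: hecke_scalar_eq)

lemma hecke_one: "\<one>\<^bsub>hecke_algebra W S\<^esub> = hk (single (bcl []) 1)"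
  using ring_hom_one[OF ring_hom_ring.homh[OF hk_hom]]
  by (simp add: braid_ring_def one_braid_group)

lemma hecke_zero: "\<zero>\<^bsub>hecke_algebra W S\<^esub> = hecke_ideal W S"
  by (simp add: hecke_algebra_def FactRing_def)

lemma hecke_quadratic:
  assumes "s \<in> S"
  shows "hk (single (bcl [(s, True), (s, True)]) 1) =
    hk (single (bcl [(s, True)]) (v_pow 1 - v_pow (- 1))) \<oplus>\<^bsub>hecke_algebra W S\<^esub>
    \<one>\<^bsub>hecke_algebra W S\<^esub>"
proof -
  interpret h: ring_hom_ring "braid_ring W S" "hecke_algebra W S" hk by (rule hk_hom)
  interpret J: ideal "hecke_ideal W S" "braid_ring W S" by (rule ideal_hecke)
  let ?x = "single (bcl [(s, True)]) (v_pow 1 - v_pow (- 1)) :: 'a word set \<Rightarrow>\<^sub>0 int laurent"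
  let ?one = "single (bcl []) 1 :: 'a word set \<Rightarrow>\<^sub>0 int laurent"
  have c: "?x \<in> carrier (braid_ring W S)" "?one \<in> carrier (braid_ring W S)"
    "hecke_relation W S s \<in> carrier (braid_ring W S)"
    using assms hecke_relation_closed by (auto intro: braid_single_closed)
  have "hecke_relation W S s \<in> hecke_ideal W S"
    using h.R.genideal_self[OF hecke_relation_closed] assms unfolding hecke_ideal_def by blast
  then have "hk (hecke_relation W S s) = hecke_ideal W S" by (rule J.a_rcos_const)
  also have "\<dots> = \<zero>\<^bsub>hecke_algebra W S\<^esub>" by (rule hecke_zero[symmetric])
  finally have "hk (hecke_relation W S s) = \<zero>\<^bsub>hecke_algebra W S\<^esub>" .
  moreover have "single (bcl [(s, True), (s, True)]) 1 =
      hecke_relation W S s \<oplus>\<^bsub>braid_ring W S\<^esub> (?x \<oplus>\<^bsub>braid_ring W S\<^esub> ?one)"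
    unfolding hecke_relation_eq[OF assms] by (simp add: braid_ring_def)
  ultimately show ?thesis using c by (simp add: hecke_one)
qed

section \<open>Scalars and braid words in the extended algebra\<close>

sublocale RHt: tensor_data R_ring "hecke_algebra W S" R_scalar "hecke_scalar W S"
  using cring_R_ring ring_hecke_algebra
  by (simp add: tensor_data_def tensor_data_axioms_def hecke_scalar_closed)

lemmas ring_RH = RHt.T.ring_axioms[folded RH_def]
lemmas RH_tensor_closed = RHt.pt_closed[folded RH_def RH_tensor_def]
lemmas RH_tensor_mult = RHt.pt_mult[folded RH_def RH_tensor_def]
lemmas RH_tensor_one = RHt.pt_one[folded RH_def RH_tensor_def]
lemmas RH_tensor_add_left = RHt.pt_add_left[folded RH_def RH_tensor_def]
lemmas RH_tensor_add_right = RHt.pt_add_right[folded RH_def RH_tensor_def]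
lemmas RH_tensor_balanced = RHt.pt_balanced[folded RH_tensor_def]
lemmas RH_tensor_induct [consumes 1, case_names pure zero add minus] = RHt.tensor_induct[folded RH_def RH_tensor_def]
lemmas RH_tensor_lift = RHt.tensor_lift[folded RH_def RH_tensor_def]

abbreviation H :: "'a RH_elt ring" where
  "H \<equiv> RH W S"

abbreviation RH_mult :: "'a RH_elt \<Rightarrow> 'a RH_elt \<Rightarrow> 'a RH_elt" (infixl \<open>\<bullet>\<close> 70) where
  "x \<bullet> y \<equiv> x \<otimes>\<^bsub>H\<^esub> y"

definition phi :: "rat fps \<Rightarrow> 'a RH_elt" where
  "phi f = RH_tensor W S (R_of_fps f) \<one>\<^bsub>hecke_algebra W S\<^esub>"

lemma phi_closed [simp]: "phi f \<in> carrier H"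
  unfolding phi_def by (intro RH_tensor_closed) auto

lemma phi_central:
  assumes "x \<in> carrier H"
  shows "x \<bullet> phi f = phi f \<bullet> x"
proof -
  interpret A: ring H by (rule ring_RH)
  show ?thesis using assms
  proof (induction x rule: RH_tensor_induct)
    case (pure r h)
    then show ?case
      unfolding phi_def by (simp add: RH_tensor_mult RHt.R.m_comm)
  next
    case zero then show ?case by simp
  next
    case (add x y) then show ?case by (simp add: A.l_distr A.r_distr)
  next
    case (minus x) then show ?case by (simp add: A.l_minus A.r_minus)
  qed
qed

sublocale A: fps_algebra H phi
proof -
  interpret A: ring H by (rule ring_RH)
  show "fps_algebra H phi"
  proof
    show "phi 1 = \<one>\<^bsub>H\<^esub>" by (simp add: phi_def R_of_fps_hom RH_tensor_one)
    show "phi (f + g) = phi f \<oplus>\<^bsub>H\<^esub> phi g" for f g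
      by (simp add: phi_def R_of_fps_hom RH_tensor_add_left)
    show "phi (f * g) = phi f \<bullet> phi g" for f g
      by (simp add: phi_def R_of_fps_hom RH_tensor_mult)
  qed (simp_all add: phi_central)
qed

text \<open>The image of an arbitrary braid word, formal inverses included.\<close>

definition tau :: "'a word \<Rightarrow> 'a RH_elt" where
  "tau w = RH_tensor W S \<one>\<^bsub>R_ring\<^esub> (hk (single (bcl w) 1))"

lemma tau_closed [simp]: "w \<in> lists (S \<times> UNIV) \<Longrightarrow> tau w \<in> carrier H"
  unfolding tau_def by (intro RH_tensor_closed) auto

lemma tau_Nil: "tau [] = \<one>\<^bsub>H\<^esub>"
  by (simp add: tau_def hecke_one[symmetric] RH_tensor_one)

lemma tau_append:
  "u \<in> lists (S \<times> UNIV) \<Longrightarrow> w \<in> lists (S \<times> UNIV) \<Longrightarrow> tau (u @ w) = tau u \<bullet> tau w"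
  by (simp add: tau_def RH_tensor_mult hk_single_mult)

lemma tau_gen: "tau [(s, True)] = RH_T W S s"
  by (simp add: tau_def RH_T_def hecke_T_def braid_gen_def)

lemma tau_cong:
  assumes "pres_eq S (braid_relations W S) w u"
  shows "tau w = tau u"
  using pres_class_eq_iff[of w S "braid_relations W S" u] assms pres_eq_in_lists[OF assms]
  by (simp add: tau_def)

lemma RH_T_closed [simp]: "s \<in> S \<Longrightarrow> RH_T W S s \<in> carrier H"
  using tau_closed[of "[(s, True)]"] by (simp add: tau_gen)

lemma tau_cancel:
  assumes "s \<in> S"
  shows "tau [(s, b)] \<bullet> tau [(s, \<not> b)] = \<one>\<^bsub>H\<^esub>"
proof -
  have "pres_eq S (braid_relations W S) [(s, b), (s, \<not> b)] []"
    using pres_eq.cancel[of "[]" S "[]" s "braid_relations W S" b] assms by simp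
  then show ?thesis
    using tau_cong[of "[(s, b), (s, \<not> b)]" "[]"] tau_append[of "[(s, b)]" "[(s, \<not> b)]"] assms
    by (simp add: tau_Nil)
qed

lemma RH_T_Units: "s \<in> S \<Longrightarrow> RH_T W S s \<in> Units H"
  using tau_cancel[of s True] tau_cancel[of s False] tau_closed[of "[(s, False)]"]
  unfolding Units_def by (auto simp: tau_gen)

text \<open>Balancedness moves the Laurent coefficient from the Hecke side to the completion, where
  it becomes a power series scalar.\<close>

lemma RH_tensor_hk_single:
  assumes "r \<in> carrier R_ring" "w \<in> lists (S \<times> UNIV)"
  shows "RH_tensor W S r (hk (single (bcl w) k)) =
    RH_tensor W S (r \<otimes>\<^bsub>R_ring\<^esub> R_scalar k) \<one>\<^bsub>hecke_algebra W S\<^esub> \<bullet> tau w"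
proof -
  have "hk (single (bcl w) k) =
      hecke_scalar W S k \<otimes>\<^bsub>hecke_algebra W S\<^esub> hk (single (bcl w) 1)"
    using assms(2) by (simp add: hecke_scalar_eq hk_single_mult)
  then have "RH_tensor W S r (hk (single (bcl w) k)) =
      RH_tensor W S (r \<otimes>\<^bsub>R_ring\<^esub> R_scalar k) (hk (single (bcl w) 1))"
    using assms by (simp add: RH_tensor_balanced)
  also have "\<dots> = RH_tensor W S (r \<otimes>\<^bsub>R_ring\<^esub> R_scalar k) \<one>\<^bsub>hecke_algebra W S\<^esub> \<bullet> tau w"
    using assms by (simp add: tau_def RH_tensor_mult)
  finally show ?thesis .
qed

lemma RH_tensor_hk_single_scale:
  assumes "r \<in> carrier R_ring" "w \<in> lists (S \<times> UNIV)"
  obtains f where "RH_tensor W S r (hk (single (bcl w) k)) = A.scale f (tau w)"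
proof -
  have "r \<otimes>\<^bsub>R_ring\<^esub> R_scalar k \<in> carrier R_ring" using assms by simp
  then obtain f where "r \<otimes>\<^bsub>R_ring\<^esub> R_scalar k = R_of_fps f" by (rule R_of_fps_surj)
  then show ?thesis
    using that[of f] RH_tensor_hk_single[OF assms, of k] by (simp add: A.scale_def phi_def)
qed

text \<open>\<open>a\<close> is an expansion of v - v^-1 in powers of v - 1. It stays existential
  because the spanning argument asks for some scalar only.\<close>

lemma RH_T_quadratic:
  assumes "s \<in> S"
  obtains a where
    "RH_T W S s \<bullet> RH_T W S s = A.scale a (RH_T W S s) \<oplus>\<^bsub>H\<^esub> \<one>\<^bsub>H\<^esub>"
proof -
  have s: "[(s, True)] \<in> lists (S \<times> UNIV)" using assms by auto
  obtain a where a: "RH_tensor W S \<one>\<^bsub>R_ring\<^esub>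
      (hk (single (bcl [(s, True)]) (v_pow 1 - v_pow (- 1)))) = A.scale a (tau [(s, True)])"
    by (rule RH_tensor_hk_single_scale[OF RHt.R.one_closed s])
  have "RH_T W S s \<bullet> RH_T W S s = tau ([(s, True)] @ [(s, True)])"
    using tau_append[OF s s] by (simp only: tau_gen)
  also have "\<dots> = RH_tensor W S \<one>\<^bsub>R_ring\<^esub> (hk (single (bcl [(s, True), (s, True)]) 1))"
    by (simp add: tau_def)
  also have "\<dots> = A.scale a (RH_T W S s) \<oplus>\<^bsub>H\<^esub> \<one>\<^bsub>H\<^esub>"
    unfolding hecke_quadratic[OF assms] using a assms
    by (simp add: RH_tensor_add_right RH_tensor_one tau_gen)
  finally show ?thesis using that by blast
qed

text \<open>The images of braid words span: each pure tensor is a sum of terms covered by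
  \<open>RH_tensor_hk_single_scale\<close>.\<close>

lemma carrier_RH_subset:
  assumes N: "A.submod N" and tau: "\<And>w. w \<in> lists (S \<times> UNIV) \<Longrightarrow> tau w \<in> N"
  shows "carrier H \<subseteq> N"
proof
  have Nc: "N \<subseteq> carrier H" "\<zero>\<^bsub>H\<^esub> \<in> N"
    "\<And>x y. x \<in> N \<Longrightarrow> y \<in> N \<Longrightarrow> x \<oplus>\<^bsub>H\<^esub> y \<in> N" "\<And>f x. x \<in> N \<Longrightarrow> A.scale f x \<in> N"
    using N unfolding A.submod_def by auto
  interpret h: ring_hom_ring "braid_ring W S" "hecke_algebra W S" hk by (rule hk_hom)
  fix x assume "x \<in> carrier H"
  then show "x \<in> N"
  proof (induction x rule: RH_tensor_induct)
    case (pure r h)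
    obtain f where f: "f \<in> carrier (braid_ring W S)" "h = hk f"
      using pure(2) unfolding hecke_algebra_def FactRing_def A_RCOSETS_def' by auto
    have "keys f \<subseteq> bcl ` lists (S \<times> UNIV)"
      using f(1) by (simp add: braid_ring_def braid_group_def presented_group_carrier)
    then have "f \<in> carrier (braid_ring W S) \<and> RH_tensor W S r (hk f) \<in> N"
    proof (induction f rule: poly_mapping_keys_induct)
      case zero
      \<comment> \<open>An element equal to its own double is zero.\<close>
      have "RH_tensor W S r \<zero>\<^bsub>hecke_algebra W S\<^esub> \<oplus>\<^bsub>H\<^esub> RH_tensor W S r \<zero>\<^bsub>hecke_algebra W S\<^esub> =
          RH_tensor W S r \<zero>\<^bsub>hecke_algebra W S\<^esub>"
        using RH_tensor_add_right[OF pure(1) RHt.H.zero_closed RHt.H.zero_closed] by simp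
      then have "RH_tensor W S r \<zero>\<^bsub>hecke_algebra W S\<^esub> = \<zero>\<^bsub>H\<^esub>"
        using RH_tensor_closed[OF pure(1) RHt.H.zero_closed] by simp
      then show ?case using h.hom_zero Nc(2) by (simp add: braid_ring_def)
    next
      case (single b k)
      then obtain w where w: "w \<in> lists (S \<times> UNIV)" "b = bcl w" by auto
      obtain f where "RH_tensor W S r (hk (single (bcl w) k)) = A.scale f (tau w)"
        by (rule RH_tensor_hk_single_scale[OF pure(1) w(1)])
      then show ?case using w tau Nc(4) by simp
    next
      case (add f g)
      then have c: "f \<in> carrier (braid_ring W S)" "g \<in> carrier (braid_ring W S)" by auto
      then have "hk (f + g) = hk f \<oplus>\<^bsub>hecke_algebra W S\<^esub> hk g"
        using h.hom_add[OF c] by (simp add: braid_ring_def)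
      moreover have "f + g \<in> carrier (braid_ring W S)"
        using h.R.a_closed[OF c] by (simp add: braid_ring_def)
      ultimately show ?case
        using add pure(1) h.hom_closed[OF c(1)] h.hom_closed[OF c(2)] Nc(3) by (simp add: RH_tensor_add_right)
    qed
    then show ?case using f by simp
  next
    case (minus x)
    then show ?case using A.submod_minus[OF N] by simp
  qed (use Nc in auto)
qed

end

context coxeter_group
begin

section \<open>The elements T_w and their span\<close>

definition Tword :: "'a list \<Rightarrow> 'a RH_elt" where
  "Tword us = foldr (\<lambda>s. (\<otimes>\<^bsub>H\<^esub>) (RH_T W S s)) us \<one>\<^bsub>H\<^esub>"

lemma Tword_simps [simp]:
  "Tword [] = \<one>\<^bsub>H\<^esub>" "Tword (s # us) = RH_T W S s \<bullet> Tword us"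
  by (simp_all add: Tword_def)

lemma positive_word_in_lists: "us \<in> lists S \<Longrightarrow> map (\<lambda>s. (s, True)) us \<in> lists (S \<times> UNIV)"
  by (induction us) auto

lemma Tword_eq_tau: "us \<in> lists S \<Longrightarrow> Tword us = tau (map (\<lambda>s. (s, True)) us)"
proof (induction us rule: list.induct)
  case Nil
  then show ?case by (simp add: tau_Nil)
next
  case (Cons s us)
  then have "tau ([(s, True)] @ map (\<lambda>s. (s, True)) us) = RH_T W S s \<bullet> tau (map (\<lambda>s. (s, True)) us)"
    using positive_word_in_lists by (subst tau_append) (auto simp: tau_gen)
  then show ?case using Cons by simp
qed

lemma Tword_closed [simp]: "us \<in> lists S \<Longrightarrow> Tword us \<in> carrier H"
  by (simp add: Tword_eq_tau positive_word_in_lists)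

lemma Tword_append:
  "us \<in> lists S \<Longrightarrow> vs \<in> lists S \<Longrightarrow> Tword (us @ vs) = Tword us \<bullet> Tword vs"
  by (simp add: Tword_eq_tau positive_word_in_lists tau_append)

lemma Tword_Units: "us \<in> lists S \<Longrightarrow> Tword us \<in> Units H"
  by (induction us rule: list.induct) (auto simp: RH_T_Units)

lemma map_alternating: "map (\<lambda>s. (s, True)) (map fst (alternating n s t)) = alternating n s t"
  by (induction n arbitrary: s t) auto

lemma Tword_braid:
  assumes "s \<in> S" "t \<in> S" "s \<noteq> t"
  shows "Tword (map fst (alternating (cox_m W s t) s t)) = Tword (map fst (alternating (cox_m W s t) t s))"
proof -
  let ?m = "cox_m W s t"
  have l: "map fst (alternating ?m s t) \<in> lists S" "map fst (alternating ?m t s) \<in> lists S"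
    using assms alternating_in_lists by auto
  have "alternating ?m s t \<in> lists (S \<times> UNIV)" "alternating ?m t s \<in> lists (S \<times> UNIV)"
    using positive_word_in_lists[OF l(1)] positive_word_in_lists[OF l(2)] by (simp_all only: map_alternating)
  moreover have "(alternating ?m s t, alternating ?m t s) \<in> braid_relations W S"
    using assms unfolding braid_relations_def by blast
  ultimately have "pres_eq S (braid_relations W S) ([] @ alternating ?m s t @ []) ([] @ alternating ?m t s @ [])"
    by (intro pres_eq.rel) auto
  then have "tau (alternating ?m s t) = tau (alternating ?m t s)" using tau_cong by simp
  then show ?thesis by (simp only: Tword_eq_tau[OF l(1)] Tword_eq_tau[OF l(2)] map_alternating)
qed

lemma Tword_reduced_cong:
  assumes "reduced us" "reduced vs" "wprod us = wprod vs"
  shows "Tword us = Tword vs"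
  unfolding Tword_def
  by (rule matsumoto[OF A.monoid_axioms RH_T_closed Tword_braid[unfolded Tword_def] assms]) auto

definition rword :: "'a \<Rightarrow> 'a list" where
  "rword w = (SOME us. reduced us \<and> wprod us = w)"

lemma rword:
  assumes "w \<in> carrier W"
  shows "reduced (rword w)" "wprod (rword w) = w"
proof -
  obtain us where "us \<in> lists S" "length us = len w" "wprod us = w"
    using reduced_word_exists[OF assms] .
  then have "reduced us \<and> wprod us = w" by (simp add: reduced_def)
  then have "reduced (rword w) \<and> wprod (rword w) = w" unfolding rword_def by (rule someI)
  then show "reduced (rword w)" "wprod (rword w) = w" by auto
qed

lemma rword_in_lists: "w \<in> carrier W \<Longrightarrow> rword w \<in> lists S"
  using rword(1)[of w] by (simp add: reduced_def)

text \<open>The standard element T_w. \<open>Tb_wprod\<close> shows that the choice of reduced word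
  does not matter.\<close>

definition Tb :: "'a \<Rightarrow> 'a RH_elt" where
  "Tb w = Tword (rword w)"

lemma Tb_closed [simp]: "w \<in> carrier W \<Longrightarrow> Tb w \<in> carrier H"
  by (simp add: Tb_def rword_in_lists)

lemma Tb_wprod: "reduced us \<Longrightarrow> Tb (wprod us) = Tword us"
  unfolding Tb_def by (rule Tword_reduced_cong) (simp_all add: rword reduced_def[of us])

lemma Tb_Units: "w \<in> carrier W \<Longrightarrow> Tb w \<in> Units H"
  by (simp add: Tb_def Tword_Units rword_in_lists)

lemma RH_T_mult_Tb:
  assumes "s \<in> S" "w \<in> carrier W" "len w < len (s \<otimes> w)"
  shows "RH_T W S s \<bullet> Tb w = Tb (s \<otimes> w)"
proof -
  have "reduced (s # rword w)"
    using assms rword[OF assms(2)] by (intro reducedI) (auto simp: reduced_def)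
  from Tb_wprod[OF this] show ?thesis using rword(2)[OF assms(2)] by (simp add: Tb_def)
qed

text \<open>If \<open>s\<close> lengthens \<open>w\<close>, the scalar is 0. Otherwise T_w = T_s
  T_{sw}, and the quadratic relation applies to T_s T_s T_{sw}.\<close>

lemma RH_T_mult_Tb_cases:
  assumes "s \<in> S" "w \<in> carrier W"
  shows "\<exists>a. RH_T W S s \<bullet> Tb w = A.scale a (Tb w) \<oplus>\<^bsub>H\<^esub> Tb (s \<otimes> w)"
proof (cases "len w < len (s \<otimes> w)")
  case True
  then show ?thesis using assms RH_T_mult_Tb[OF assms True] by (intro exI[of _ 0]) simp
next
  case False
  then have "len (s \<otimes> w) < len (s \<otimes> (s \<otimes> w))"
    using assms len_gen_mult_less[of s w] by simp
  then have w: "RH_T W S s \<bullet> Tb (s \<otimes> w) = Tb w"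
    using RH_T_mult_Tb[of s "s \<otimes> w"] assms by simp
  obtain a where a: "RH_T W S s \<bullet> RH_T W S s = A.scale a (RH_T W S s) \<oplus>\<^bsub>H\<^esub> \<one>\<^bsub>H\<^esub>"
    using RH_T_quadratic[OF assms(1)] .
  have "RH_T W S s \<bullet> Tb w =
      RH_T W S s \<bullet> RH_T W S s \<bullet> Tb (s \<otimes> w)"
    unfolding w[symmetric] using assms by (subst A.m_assoc) auto
  also have "\<dots> = A.scale a (Tb w) \<oplus>\<^bsub>H\<^esub> Tb (s \<otimes> w)"
    unfolding a using assms w by (simp add: A.l_distr A.scale_mult_left)
  finally show ?thesis by blast
qed

lemma Tb_one: "Tb \<one> = \<one>\<^bsub>H\<^esub>"
  using Tb_wprod[of "[]"] reducedI[of "[]"] by simp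

text \<open>Stability under T_s handles positive letters. For formal inverses the quadratic
  relation, multiplied by the inverse of T_s, gives T_s = a + T_s^-1, so a submodule stable under
  T_s is stable under its inverse.\<close>

lemma submod_contains_tau:
  assumes N: "A.submod N" "\<And>w. w \<in> carrier W \<Longrightarrow> Tb w \<in> N"
    and stable: "\<And>s x. s \<in> S \<Longrightarrow> x \<in> N \<Longrightarrow> RH_T W S s \<bullet> x \<in> N"
    and "w \<in> lists (S \<times> UNIV)"
  shows "tau w \<in> N"
  using assms(4)
proof (induction w rule: list.induct)
  case Nil
  then show ?case using N(2)[of \<one>] by (simp add: tau_Nil Tb_one)
next
  case (Cons x w)
  then obtain s b where x: "x = (s, b)" "s \<in> S" "tau w \<in> N" "w \<in> lists (S \<times> UNIV)" by auto
  have Nc: "N \<subseteq> carrier H" "\<And>x y. x \<in> N \<Longrightarrow> y \<in> N \<Longrightarrow> x \<oplus>\<^bsub>H\<^esub> y \<in> N"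
    "\<And>f x. x \<in> N \<Longrightarrow> A.scale f x \<in> N"
    using N(1) unfolding A.submod_def by auto
  have xw: "tau (x # w) = tau [(s, b)] \<bullet> tau w"
    using tau_append[of "[(s, b)]" w] x by simp
  show ?case
  proof (cases b)
    case True
    then show ?thesis using xw stable x by (simp add: tau_gen)
  next
    case False
    let ?t = "RH_T W S s" and ?u = "tau [(s, False)]"
    have u: "?u \<in> carrier H" "?u \<bullet> ?t = \<one>\<^bsub>H\<^esub>"
      using tau_cancel[OF x(2), of False] x(2) by (auto simp: tau_gen)
    obtain a where a: "?t \<bullet> ?t = A.scale a ?t \<oplus>\<^bsub>H\<^esub> \<one>\<^bsub>H\<^esub>"
      using RH_T_quadratic[OF x(2)] .
    have "?t = ?u \<bullet> (?t \<bullet> ?t)"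
      using u x(2) by (simp add: A.m_assoc[symmetric])
    also have "\<dots> = A.scale a \<one>\<^bsub>H\<^esub> \<oplus>\<^bsub>H\<^esub> ?u"
      unfolding a using u x(2) by (simp add: A.r_distr A.scale_mult_right)
    finally have t: "?t = A.scale a \<one>\<^bsub>H\<^esub> \<oplus>\<^bsub>H\<^esub> ?u" .
    have c: "tau w \<in> carrier H" using x by simp
    have "?t \<bullet> tau w = A.scale a (tau w) \<oplus>\<^bsub>H\<^esub> ?u \<bullet> tau w"
      by (subst t) (use u c in \<open>simp add: A.l_distr A.scale_mult_left\<close>)
    then have "?u \<bullet> tau w = \<ominus>\<^bsub>H\<^esub> A.scale a (tau w) \<oplus>\<^bsub>H\<^esub> ?t \<bullet> tau w"
      using u c by (simp add: A.r_neg1)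
    also have "\<dots> \<in> N"
      by (intro Nc(2) A.submod_minus[OF N(1)] Nc(3) stable x)
    finally show ?thesis using xw False by simp
  qed
qed

lemma lspan_member: "set bs \<subseteq> carrier H \<Longrightarrow> b \<in> set bs \<Longrightarrow> b \<in> A.lspan bs"
proof (induction bs)
  case (Cons a bs)
  have sub: "A.submod (A.lspan bs)" using A.submod_lspan Cons.prems(1) by simp
  show ?case
  proof (cases "b = a")
    case True
    have "a = A.scale 1 a \<oplus>\<^bsub>H\<^esub> \<zero>\<^bsub>H\<^esub>" using Cons.prems(1) by simp
    moreover have "\<zero>\<^bsub>H\<^esub> \<in> A.lspan bs" using sub unfolding A.submod_def by simp
    ultimately show ?thesis using True unfolding A.lspan.simps by blast
  next
    case False
    then have b: "b \<in> A.lspan bs" using Cons by auto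
    then have "b \<in> carrier H" using A.lspan_subset Cons.prems(1) by auto
    then have "b = A.scale 0 a \<oplus>\<^bsub>H\<^esub> b" using Cons.prems(1) by simp
    then show ?thesis using b unfolding A.lspan.simps by blast
  qed
qed simp

lemma lspan_subset_submod:
  assumes "A.submod N" "set bs \<subseteq> N"
  shows "A.lspan bs \<subseteq> N"
  using assms(2) assms(1)[unfolded A.submod_def] by (induction bs) auto

text \<open>Reduces stability of a span under left multiplication to a check on its
  generators.\<close>

lemma submod_vimage_mult:
  assumes "A.submod N" "x \<in> carrier H"
  shows "A.submod {y \<in> carrier H. x \<bullet> y \<in> N}"
  using assms unfolding A.submod_def by (auto simp: A.r_distr A.scale_mult_right)

text \<open>By \<open>RH_T_mult_Tb_cases\<close> the span is stable under left multiplication by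
  each T_s, so it contains every braid word and hence everything.\<close>

lemma carrier_RH_eq_lspan:
  assumes "set ws = carrier W"
  shows "carrier H = A.lspan (map Tb ws)"
proof
  have bs: "set (map Tb ws) \<subseteq> carrier H" using assms by auto
  have sub: "A.submod (A.lspan (map Tb ws))" by (rule A.submod_lspan[OF bs])
  then have add: "\<And>x y. x \<in> A.lspan (map Tb ws) \<Longrightarrow> y \<in> A.lspan (map Tb ws) \<Longrightarrow> x \<oplus>\<^bsub>H\<^esub> y \<in> A.lspan (map Tb ws)"
    and sc: "\<And>f x. x \<in> A.lspan (map Tb ws) \<Longrightarrow> A.scale f x \<in> A.lspan (map Tb ws)"
    unfolding A.submod_def by auto
  have mem: "Tb w \<in> A.lspan (map Tb ws)" if "w \<in> carrier W" for w
    using lspan_member[OF bs, of "Tb w"] that assms by simp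
  have stable: "RH_T W S s \<bullet> x \<in> A.lspan (map Tb ws)"
    if "s \<in> S" "x \<in> A.lspan (map Tb ws)" for s x
  proof -
    let ?V = "{y \<in> carrier H. RH_T W S s \<bullet> y \<in> A.lspan (map Tb ws)}"
    have "Tb w \<in> ?V" if w: "w \<in> carrier W" for w
    proof -
      obtain a where "RH_T W S s \<bullet> Tb w = A.scale a (Tb w) \<oplus>\<^bsub>H\<^esub> Tb (s \<otimes> w)"
        using RH_T_mult_Tb_cases[OF \<open>s \<in> S\<close> w] by blast
      then show ?thesis using w \<open>s \<in> S\<close> mem[OF w] mem[of "s \<otimes> w"] add sc by simp
    qed
    then have "set (map Tb ws) \<subseteq> ?V" using assms by auto
    then have "A.lspan (map Tb ws) \<subseteq> ?V"
      using lspan_subset_submod[OF submod_vimage_mult[OF sub RH_T_closed[OF \<open>s \<in> S\<close>]]] by blast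
    then show ?thesis using that by blast
  qed
  show "carrier H \<subseteq> A.lspan (map Tb ws)"
    by (rule carrier_RH_subset[OF sub submod_contains_tau[OF sub mem stable]])
  show "A.lspan (map Tb ws) \<subseteq> carrier H" by (rule A.lspan_subset[OF bs])
qed

section \<open>Construction of the specialization at v = 1\<close>

lemma ring_QW: "ring (QW W)"
  unfolding QW_def by (rule ring_monoid_ring[OF monoid_axioms])

lemma braid_wprod:
  assumes "pres_eq S (braid_relations W S) w w'"
  shows "wprod (map fst w) = wprod (map fst w')"
  using assms
proof (induction rule: pres_eq.induct)
  case (cancel x y s b)
  then have "map fst x \<in> lists S" "map fst y \<in> lists S" using fst_lists by auto
  then show ?case using cancel(3) by (simp add: wprod_append)
next
  case (rel x y l r)
  then have l: "map fst x \<in> lists S" "map fst y \<in> lists S" "map fst l \<in> lists S" "map fst r \<in> lists S"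
    using fst_lists by auto
  have "wprod (map fst l) = wprod (map fst r)"
    using rel(3) wprod_braid unfolding braid_relations_def by auto
  then show ?case using l by (simp add: wprod_append)
qed auto

text \<open>Sending a braid to its value in W and v to 1 respects the quadratic relation, because v
  - v^-1 becomes 0 and the generators square to 1.\<close>

lemma specialization_hecke:
  obtains \<pi> where "\<pi> \<in> ring_hom (hecke_algebra W S) (monoid_ring W :: ('a \<Rightarrow>\<^sub>0 rat) ring)"
    and "\<And>w k. w \<in> lists (S \<times> UNIV) \<Longrightarrow>
      \<pi> (hk (single (bcl w) k)) = single (wprod (map fst w)) (of_int (aug k))"
proof -
  \<comment> \<open>A braid is a class of words; \<open>braid_wprod\<close> makes the chosen
    representative irrelevant.\<close>
  define bval where "bval c = wprod (map fst (SOME w. w \<in> c))" for c :: "'a word set"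
  have bval: "bval (bcl w) = wprod (map fst w)" if "w \<in> lists (S \<times> UNIV)" for w
  proof -
    have "w \<in> bcl w" using that by (simp add: pres_class_def pres_eq.refl)
    then have "(SOME w'. w' \<in> bcl w) \<in> bcl w" by (rule someI)
    then show ?thesis using braid_wprod unfolding bval_def pres_class_def by fastforce
  qed
  define \<psi> where "\<psi> c k = single (bval c) (of_int (aug k) :: rat)" for c and k :: "int laurent"
  have add: "\<psi> c (x + y) = \<psi> c x + \<psi> c y" for c x y by (simp add: \<psi>_def aug_add single_add)
  have rep: "\<exists>w. w \<in> lists (S \<times> UNIV) \<and> c = bcl w" if "c \<in> carrier (braid_group W S)" for c
    using that by (auto simp: braid_group_def presented_group_carrier)
  have hom: "pm_lift \<psi> \<in> ring_hom (braid_ring W S) (monoid_ring W)"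
    unfolding braid_ring_def
  proof (rule pm_lift_ring_hom[OF monoid_braid_group monoid_axioms add])
    fix a b :: "'a word set" and x y :: "int laurent"
    assume a: "a \<in> carrier (braid_group W S)" and b: "b \<in> carrier (braid_group W S)"
    obtain w u where w: "w \<in> lists (S \<times> UNIV)" "a = bcl w" and u: "u \<in> lists (S \<times> UNIV)" "b = bcl u"
      using rep[OF a] rep[OF b] by auto
    have l: "map fst w \<in> lists S" "map fst u \<in> lists S" using w u fst_lists by auto
    show "\<psi> a x \<in> carrier (monoid_ring W)"
      using l w by (auto simp: \<psi>_def bval)
    have "bval (bcl (w @ u)) = wprod (map fst w) \<otimes> wprod (map fst u)"
      using w u l by (simp add: bval wprod_append)
    then show "\<psi> (a \<otimes>\<^bsub>braid_group W S\<^esub> b) (x * y) = \<psi> a x \<otimes>\<^bsub>monoid_ring W\<^esub> \<psi> b y"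
      using w u by (simp add: \<psi>_def bval bcl_mult aug_mult monoid_ring_single_mult)
  next
    show "\<psi> \<one>\<^bsub>braid_group W S\<^esub> 1 = \<one>\<^bsub>monoid_ring W\<^esub>"
      by (simp add: \<psi>_def one_braid_group bval)
  qed
  have "pm_lift \<psi> x = \<zero>\<^bsub>monoid_ring W\<^esub>" if x: "x \<in> hecke_relation W S ` S" for x
  proof -
    obtain s where s: "s \<in> S" "x = hecke_relation W S s" using x by blast
    have "aug (v_pow n :: int laurent) = 1" for n by (simp add: v_pow_def)
    then show ?thesis
      unfolding s(2) hecke_relation_eq[OF s(1)] using s(1)
      by (simp add: pm_lift_diff[of \<psi>, OF add] pm_lift_single[of \<psi>, OF add] \<psi>_def bval aug_diff involution)
  qed
  then obtain \<pi> where \<pi>: "\<pi> \<in> ring_hom (braid_ring W S Quot hecke_ideal W S) (monoid_ring W)"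
    "\<And>x. x \<in> carrier (braid_ring W S) \<Longrightarrow> \<pi> (hk x) = pm_lift \<psi> x"
    using genideal_quot_lift[OF ring_braid_ring ring_QW[unfolded QW_def] hom hecke_relation_closed]
    unfolding hecke_ideal_def by blast
  show ?thesis
  proof
    show "\<pi> \<in> ring_hom (hecke_algebra W S) (monoid_ring W)" using \<pi>(1) by (simp only: hecke_algebra_def)
    show "\<pi> (hk (single (bcl w) k)) = single (wprod (map fst w)) (of_int (aug k))"
      if "w \<in> lists (S \<times> UNIV)" for w k
      using \<pi>(2)[OF braid_single_closed[OF that]] that
      by (simp add: pm_lift_single[of \<psi>, OF add] \<psi>_def bval)
  qed
qed

text \<open>A pure tensor of \<open>r\<close> and \<open>h\<close> goes to r(1) times the image of
  \<open>h\<close>. This is balanced because both sides evaluate a Laurent polynomial at v =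
  1.\<close>

lemma specialization_RH:
  obtains F where "F \<in> ring_hom H (QW W)"
    and "\<And>f. F (phi f) = single \<one> (fps_nth f 0)"
    and "\<And>s. s \<in> S \<Longrightarrow> F (RH_T W S s) = QW_elt s"
proof -
  obtain \<pi> where \<pi>: "\<pi> \<in> ring_hom (hecke_algebra W S) (monoid_ring W :: ('a \<Rightarrow>\<^sub>0 rat) ring)"
    and \<pi>_single: "\<And>w k. w \<in> lists (S \<times> UNIV) \<Longrightarrow>
      \<pi> (hk (single (bcl w) k)) = single (wprod (map fst w)) (of_int (aug k))"
    using specialization_hecke by blast
  interpret Q: ring "monoid_ring W :: ('a \<Rightarrow>\<^sub>0 rat) ring" using ring_QW by (simp only: QW_def)
  let ?sc = "\<lambda>c. single \<one> c :: 'a \<Rightarrow>\<^sub>0 rat"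
  note sc = monoid_ring_single_mult[where a = \<one> and b = \<one> and G = W, simplified]
  have sc_closed: "?sc c \<in> carrier (monoid_ring W)" for c by simp
  have \<pi>_closed: "\<pi> h \<in> carrier (monoid_ring W)" if "h \<in> carrier (hecke_algebra W S)" for h
    by (rule ring_hom_closed[OF \<pi> that])
  define \<mu> where "\<mu> r h = ?sc (R_ev r) \<otimes>\<^bsub>monoid_ring W\<^esub> \<pi> h" for r h
  obtain F where F: "F \<in> ring_hom H (monoid_ring W)"
    "\<And>r h. r \<in> carrier R_ring \<Longrightarrow> h \<in> carrier (hecke_algebra W S) \<Longrightarrow> F (RH_tensor W S r h) = \<mu> r h"
  proof (rule RH_tensor_lift[OF monoid_axioms, of \<mu>])
    fix r h r' h' k
    assume r: "r \<in> carrier R_ring" and h: "h \<in> carrier (hecke_algebra W S)"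
    show "\<mu> r h \<in> carrier (monoid_ring W)"
      unfolding \<mu>_def by (rule Q.m_closed[OF sc_closed \<pi>_closed[OF h]])
    have "\<pi> (hecke_scalar W S k) = ?sc (of_int (aug k))"
      by (simp add: hecke_scalar_eq \<pi>_single)
    then have "\<pi> (hecke_scalar W S k \<otimes>\<^bsub>hecke_algebra W S\<^esub> h) = ?sc (of_int (aug k)) \<otimes>\<^bsub>monoid_ring W\<^esub> \<pi> h"
      using ring_hom_mult[OF \<pi> hecke_scalar_closed h] by simp
    then show "\<mu> (r \<otimes>\<^bsub>R_ring\<^esub> R_scalar k) h = \<mu> r (hecke_scalar W S k \<otimes>\<^bsub>hecke_algebra W S\<^esub> h)"
      unfolding \<mu>_def R_ev_hom(1)[OF r R_scalar_closed] R_ev_scalar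
      using Q.m_assoc[OF sc_closed sc_closed \<pi>_closed[OF h]] by (simp only: sc)
    show "\<mu> (r \<oplus>\<^bsub>R_ring\<^esub> r') h = \<mu> r h + \<mu> r' h" if r': "r' \<in> carrier R_ring"
      unfolding \<mu>_def R_ev_hom(2)[OF r r'] by (simp add: single_add monoid_ring_add_left)
    show "\<mu> r (h \<oplus>\<^bsub>hecke_algebra W S\<^esub> h') = \<mu> r h + \<mu> r h'" if h': "h' \<in> carrier (hecke_algebra W S)"
      unfolding \<mu>_def ring_hom_add[OF \<pi> h h'] by (simp add: monoid_ring_add_right)
    show "\<mu> (r \<otimes>\<^bsub>R_ring\<^esub> r') (h \<otimes>\<^bsub>hecke_algebra W S\<^esub> h') = \<mu> r h \<otimes>\<^bsub>monoid_ring W\<^esub> \<mu> r' h'"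
      if r': "r' \<in> carrier R_ring" and h': "h' \<in> carrier (hecke_algebra W S)"
    proof -
      let ?a = "?sc (R_ev r)" and ?b = "?sc (R_ev r')"
      note c = sc_closed[of "R_ev r"] sc_closed[of "R_ev r'"] \<pi>_closed[OF h] \<pi>_closed[OF h']
      have "\<mu> r h \<otimes>\<^bsub>monoid_ring W\<^esub> \<mu> r' h' =
          ?a \<otimes>\<^bsub>monoid_ring W\<^esub> (\<pi> h \<otimes>\<^bsub>monoid_ring W\<^esub> ?b) \<otimes>\<^bsub>monoid_ring W\<^esub> \<pi> h'"
        unfolding \<mu>_def using c by (simp only: Q.m_assoc Q.m_closed)
      also have "\<dots> = ?a \<otimes>\<^bsub>monoid_ring W\<^esub> ?b \<otimes>\<^bsub>monoid_ring W\<^esub> (\<pi> h \<otimes>\<^bsub>monoid_ring W\<^esub> \<pi> h')"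
        unfolding monoid_ring_scalar_central[OF monoid_axioms c(3)] using c by (simp only: Q.m_assoc Q.m_closed)
      finally show ?thesis
        unfolding \<mu>_def R_ev_hom(1)[OF r r'] ring_hom_mult[OF \<pi> h h'] by (simp only: sc)
    qed
  next
    show "\<mu> \<one>\<^bsub>R_ring\<^esub> \<one>\<^bsub>hecke_algebra W S\<^esub> = \<one>\<^bsub>monoid_ring W\<^esub>"
      using ring_hom_one[OF \<pi>] by (simp add: \<mu>_def R_ev_one monoid_ring_single_mult)
  qed blast
  show ?thesis
  proof
    show "F \<in> ring_hom H (QW W)" using F(1) by (simp only: QW_def)
    show "F (phi f) = ?sc (fps_nth f 0)" for f
      unfolding phi_def F(2)[OF R_of_fps_closed RHt.H.one_closed] \<mu>_def ring_hom_one[OF \<pi>] R_ev_R_of_fps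
      by (simp add: monoid_ring_single_mult)
    show "F (RH_T W S s) = QW_elt s" if "s \<in> S" for s
    proof -
      have l: "[(s, True)] \<in> lists (S \<times> UNIV)" using that by simp
      show ?thesis
        unfolding tau_gen[symmetric] tau_def F(2)[OF RHt.R.one_closed hk_single_closed[OF l]] \<mu>_def
          \<pi>_single[OF l] R_ev_one
        using that by (simp add: monoid_ring_single_mult QW_elt_def)
    qed
  qed
qed

end


section \<open>Existence and uniqueness of the lift\<close>

text \<open>Cauchy's equation over the rationals, applied below to each coefficient of the image of
  a constant.\<close>

lemma rat_additive_linear:
  fixes f :: "rat \<Rightarrow> rat"
  assumes add: "\<And>x y. f (x + y) = f x + f y"
  shows "f q = q * f 1"
proof -
  have zero: "f 0 = 0" using add[of 0 0] by simp
  have minus: "f (- x) = - f x" for x using add[of x "- x"] zero by simp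
  have nat: "f (of_nat n * x) = of_nat n * f x" for n x
    by (induction n) (simp_all add: zero add distrib_right)
  have int: "f (of_int n * x) = of_int n * f x" for n x
  proof (cases n)
    case (neg m)
    then have n: "of_int n = - (of_nat (Suc m) :: rat)" by simp
    show ?thesis unfolding n using nat[of "Suc m" x] minus[of "of_nat (Suc m) * x"]
      by (simp only: mult_minus_left)
  qed (use nat in simp)
  obtain a b where q: "q = of_int a / of_int b" "b > 0"
    by (cases q) (auto simp: Fract_of_int_quotient)
  have "of_int b * f q = f (of_int b * q)" by (simp only: int)
  also have "of_int b * q = of_int a * 1" using q by simp
  also have "f (of_int a * 1) = of_int a * f 1" by (rule int)
  finally have "of_int b * f q = of_int a * f 1" .
  moreover have a: "of_int a = of_int b * q" using q by simp
  ultimately have "of_int b * f q = of_int b * (q * f 1)" by (simp only: a mult.assoc)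
  then show ?thesis using q(2) by simp
qed

context coxeter_group
begin

section \<open>Kernel and uniqueness of a specialization\<close>

lemma zero_QW: "\<zero>\<^bsub>QW W\<^esub> = 0"
  by (simp add: QW_def)

lemma add_QW: "f \<oplus>\<^bsub>QW W\<^esub> g = f + g"
  by (simp add: QW_def)

lemma hom_Tword:
  assumes "F \<in> ring_hom H (QW W)" "\<And>s. s \<in> S \<Longrightarrow> F (RH_T W S s) = QW_elt s" "us \<in> lists S"
  shows "F (Tword us) = QW_elt (wprod us)"
  using assms(3)
proof (induction us rule: list.induct)
  case Nil
  then show ?case using ring_hom_one[OF assms(1)] by (simp add: QW_def QW_elt_def)
next
  case (Cons s us)
  then have "F (Tword (s # us)) = QW_elt s \<otimes>\<^bsub>QW W\<^esub> QW_elt (wprod us)"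
    using ring_hom_mult[OF assms(1), of "RH_T W S s" "Tword us"] assms(2) by simp
  then show ?case by (simp add: QW_def QW_elt_def monoid_ring_single_mult)
qed

lemma hom_Tb:
  assumes "F \<in> ring_hom H (QW W)" "\<And>s. s \<in> S \<Longrightarrow> F (RH_T W S s) = QW_elt s" "w \<in> carrier W"
  shows "F (Tb w) = QW_elt w"
  using hom_Tword[OF assms(1,2) rword_in_lists[OF assms(3)]] rword(2)[OF assms(3)] by (simp add: Tb_def)

lemma phi_split: "phi f = phi (fps_const (fps_nth f 0)) \<oplus>\<^bsub>H\<^esub> phi fps_X \<bullet> phi (fps_shift 1 f)"
proof -
  have "f = fps_const (fps_nth f 0) + fps_X * fps_shift 1 f"
    by (rule fps_ext) (simp add: fps_X_mult_nth split: nat_diff_split)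
  then show ?thesis using A.scalar_add A.scalar_mult by metis
qed

text \<open>Rationality makes a unital additive map on the constants automatically linear, so the
  images of the \<open>T\<^sub>s\<close> already determine a specialization at \<open>v = 1\<close>.\<close>

lemma hom_phi:
  assumes F: "F \<in> ring_hom H (QW W)" and X: "F (phi fps_X) = 0"
  shows "F (phi f) = single \<one> (fps_nth f 0)"
proof -
  let ?c = "\<lambda>q. F (phi (fps_const q))"
  have add: "?c (p + q) = ?c p + ?c q" for p q
    using ring_hom_add[OF F phi_closed phi_closed, of "fps_const p" "fps_const q"]
    by (simp add: A.scalar_add[symmetric] QW_def)
  have one: "?c 1 = single \<one> 1"
    using ring_hom_one[OF F] by (simp add: A.scalar_one QW_def)
  have "?c q = single \<one> q" for q
  proof (rule poly_mapping_eqI)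
    fix k
    have "lookup (?c q) k = q * lookup (?c 1) k"
      by (rule rat_additive_linear) (simp only: add lookup_add)
    then show "lookup (?c q) k = lookup (single \<one> q) k"
      by (simp only: one lookup_single) (simp add: when_def)
  qed
  moreover have "F (phi f) = ?c (fps_nth f 0) + F (phi fps_X) \<otimes>\<^bsub>QW W\<^esub> F (phi (fps_shift 1 f))"
    using ring_hom_add[OF F] ring_hom_mult[OF F] by (subst phi_split) (simp add: QW_def)
  ultimately show ?thesis by (simp add: X QW_def)
qed

lemma hom_scale_Tb:
  assumes F: "F \<in> ring_hom H (QW W)" and X: "F (phi fps_X) = 0"
    and T: "\<And>s. s \<in> S \<Longrightarrow> F (RH_T W S s) = QW_elt s" and w: "w \<in> carrier W"
  shows "F (A.scale f (Tb w)) = single w (fps_nth f 0)"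
  using ring_hom_mult[OF F phi_closed Tb_closed[OF w]] hom_phi[OF F X] hom_Tb[OF F T w] w
  by (simp add: A.scale_def QW_def QW_elt_def monoid_ring_single_mult)

text \<open>Distinct group elements are independent in the group algebra. The claim about keys
  isolates the coefficient of the new element \<open>w\<close>: it is the constant term of
  \<open>f\<close>, so it vanishes when the image does, and X then divides \<open>f\<close>.\<close>

lemma hom_kernel_subset:
  assumes F: "F \<in> ring_hom H (QW W)" and X: "F (phi fps_X) = 0"
    and T: "\<And>s. s \<in> S \<Longrightarrow> F (RH_T W S s) = QW_elt s"
    and "distinct ws" "set ws \<subseteq> carrier W" "x \<in> A.lspan (map Tb ws)"
  shows "keys (F x) \<subseteq> set ws \<and> (F x = 0 \<longrightarrow> x \<in> A.adic 1)"
  using assms(4-6)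
proof (induction ws arbitrary: x)
  case Nil
  have "F \<zero>\<^bsub>H\<^esub> = \<zero>\<^bsub>QW W\<^esub>"
    by (rule ring_hom_zero[OF F ring_RH ring_QW])
  moreover have "\<zero>\<^bsub>H\<^esub> \<in> A.adic 1"
    unfolding A.adic_def by (rule image_eqI[of _ _ "\<zero>\<^bsub>H\<^esub>"]) auto
  ultimately show ?case using Nil by (simp add: QW_def)
next
  case (Cons w ws)
  then obtain f y where x: "x = A.scale f (Tb w) \<oplus>\<^bsub>H\<^esub> y" "y \<in> A.lspan (map Tb ws)" by auto
  have w: "w \<in> carrier W" "w \<notin> set ws" using Cons.prems by auto
  have "set (map Tb ws) \<subseteq> carrier H" using Cons.prems(2) by auto
  then have y: "y \<in> carrier H" using A.lspan_subset x(2) by blast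
  have IH: "keys (F y) \<subseteq> set ws" "F y = 0 \<Longrightarrow> y \<in> A.adic 1"
    using Cons.IH[of y] Cons.prems x(2) by auto
  have Fx: "F x = single w (fps_nth f 0) + F y"
    using ring_hom_add[OF F, of "A.scale f (Tb w)" y] hom_scale_Tb[OF F X T w(1)] w y
    by (simp add: x(1) QW_def)
  have "x \<in> A.adic 1" if z: "F x = 0"
  proof -
    have "lookup (F y) w = 0" using IH(1) w(2) by (auto simp: in_keys_iff)
    then have f0: "fps_nth f 0 = 0"
      using arg_cong[OF z, of "\<lambda>p. lookup p w"] by (simp add: Fx lookup_add)
    then have y1: "y \<in> A.adic 1" using z IH(2) by (simp add: Fx)
    have "f = fps_X ^ 1 * fps_shift 1 f"
      by (rule fps_ext) (simp add: fps_X_mult_nth f0 split: nat_diff_split)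
    then have "A.scale f (Tb w) = A.scale (fps_X ^ 1) (A.scale (fps_shift 1 f) (Tb w))"
      using w by (simp only: A.scale_scale Tb_closed)
    then have "A.scale f (Tb w) \<in> A.adic 1"
      unfolding A.adic_def by (rule image_eqI) (simp add: w(1))
    then show ?thesis unfolding x(1) using y1 by (rule A.adic_add)
  qed
  moreover have "keys (F x) \<subseteq> set (w # ws)"
    unfolding Fx using IH(1) by (intro keys_add_subset) auto
  ultimately show ?case by blast
qed

context
  assumes finite_W: "finite (carrier W)"
begin

lemma enumeration:
  obtains ws where "set ws = carrier W" "distinct ws"
  using finite_distinct_list[OF finite_W] by blast

lemma finite_fps_algebra_RH: "\<exists>bs. finite_fps_algebra H phi bs"
proof -
  obtain ws where "set ws = carrier W" by (rule enumeration)
  then have "finite_fps_algebra H phi (map Tb ws)"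
    using carrier_RH_eq_lspan[of ws]
    by (intro finite_fps_algebra.intro A.fps_algebra_axioms finite_fps_algebra_axioms.intro) auto
  then show ?thesis by blast
qed

lemma hom_kernel:
  assumes F: "F \<in> ring_hom H (QW W)" and X: "F (phi fps_X) = 0"
    and T: "\<And>s. s \<in> S \<Longrightarrow> F (RH_T W S s) = QW_elt s" and x: "x \<in> carrier H"
  shows "F x = 0 \<longleftrightarrow> x \<in> A.adic 1"
proof
  obtain ws where "set ws = carrier W" "distinct ws" by (rule enumeration)
  then show "F x = 0 \<Longrightarrow> x \<in> A.adic 1"
    using hom_kernel_subset[OF F X T, of ws x] x carrier_RH_eq_lspan[of ws] by auto
  assume "x \<in> A.adic 1"
  then obtain y where "x = phi fps_X \<bullet> y" "y \<in> carrier H"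
    by (auto simp: A.adic_def A.scale_def)
  then show "F x = 0" using ring_hom_mult[OF F, of "phi fps_X" y] X by (simp add: QW_def)
qed

lemma hom_kernel_eq:
  assumes F: "F \<in> ring_hom H (QW W)" and X: "F (phi fps_X) = 0"
    and T: "\<And>s. s \<in> S \<Longrightarrow> F (RH_T W S s) = QW_elt s"
  shows "a_kernel H (QW W) F = A.adic 1"
  unfolding a_kernel_def' zero_QW using hom_kernel[OF F X T] A.adic_closed by blast

text \<open>Both maps send f T_w to the constant term of \<open>f\<close> times \<open>w\<close>,
  and such elements span. This yields the uniqueness in the definition of
  \<open>QW_identification\<close>.\<close>

lemma hom_unique:
  assumes F: "F \<in> ring_hom H (QW W)" "F (phi fps_X) = 0"
      "\<And>s. s \<in> S \<Longrightarrow> F (RH_T W S s) = QW_elt s"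
    and G: "G \<in> ring_hom H (QW W)" "G (phi fps_X) = 0"
      "\<And>s. s \<in> S \<Longrightarrow> G (RH_T W S s) = QW_elt s"
    and x: "x \<in> carrier H"
  shows "F x = G x"
proof -
  obtain ws where ws: "set ws = carrier W" by (rule enumeration)
  have "x \<in> carrier H \<and> F x = G x" if "x \<in> A.lspan (map Tb us)" "set us \<subseteq> carrier W" for us x
    using that
  proof (induction us arbitrary: x)
    case Nil
    then show ?case
      using ring_hom_zero[OF F(1) ring_RH ring_QW] ring_hom_zero[OF G(1) ring_RH ring_QW] by simp
  next
    case (Cons w us)
    then obtain f y where x: "x = A.scale f (Tb w) \<oplus>\<^bsub>H\<^esub> y" "y \<in> A.lspan (map Tb us)" by auto
    have w: "w \<in> carrier W" using Cons.prems by auto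
    have y: "y \<in> carrier H" "F y = G y" using Cons.IH[OF x(2)] Cons.prems by auto
    have c: "A.scale f (Tb w) \<in> carrier H" using w by simp
    show ?case
      using hom_scale_Tb[OF F w, of f] hom_scale_Tb[OF G w, of f] y c
      by (simp add: x(1) ring_hom_add[OF F(1) c y(1)] ring_hom_add[OF G(1) c y(1)])
  qed
  then show ?thesis using x carrier_RH_eq_lspan[OF ws] ws by blast
qed

text \<open>The multiples of X form a two-sided ideal, being the kernel of a specialization, so the
  ideal generated by X contains nothing else.\<close>

lemma RH_ideal_eq: "RH_v_minus_1_ideal W S = A.adic 1"
proof
  obtain F where F: "F \<in> ring_hom H (QW W)"
    and phi: "\<And>f. F (phi f) = single \<one> (fps_nth f 0)"
    and T: "\<And>s. s \<in> S \<Longrightarrow> F (RH_T W S s) = QW_elt s"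
    using specialization_RH by blast
  have X: "F (phi fps_X) = 0" by (simp add: phi)
  interpret F: ring_hom_ring H "QW W" F
    by (rule ring_hom_ringI2[OF ring_RH ring_QW F])
  have ker: "a_kernel H (QW W) F = A.adic 1"
    by (rule hom_kernel_eq[OF F X T])
  have I: "RH_v_minus_1_ideal W S = Idl\<^bsub>H\<^esub> {phi fps_X}"
    by (simp add: RH_v_minus_1_ideal_def phi_def R_of_fps_X)
  have mem: "phi fps_X \<in> A.adic 1" using hom_kernel[OF F X T phi_closed] X by simp
  show "RH_v_minus_1_ideal W S \<subseteq> A.adic 1"
    unfolding I ker[symmetric] by (rule A.genideal_minimal[OF F.kernel_is_ideal]) (use ker mem in simp)
  interpret J: ideal "Idl\<^bsub>H\<^esub> {phi fps_X}" H
    by (rule A.genideal_ideal) simp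
  show "A.adic 1 \<subseteq> RH_v_minus_1_ideal W S"
  proof
    fix x assume "x \<in> A.adic 1"
    then obtain y where "x = phi fps_X \<bullet> y" "y \<in> carrier H"
      by (auto simp: A.adic_def A.scale_def)
    moreover have "phi fps_X \<in> Idl\<^bsub>H\<^esub> {phi fps_X}" by (rule A.genideal_self') simp
    ultimately show "x \<in> RH_v_minus_1_ideal W S" unfolding I by (simp only: J.I_r_closed)
  qed
qed

text \<open>Resolves the definite description: the map induced by \<open>F\<close> on the quotient
  is the required isomorphism, and any competitor composed with the projection is a specialization,
  hence equals \<open>F\<close>.\<close>

lemma at_v_1_eq:
  assumes F: "F \<in> ring_hom H (QW W)"
    and phi: "\<And>f. F (phi f) = single \<one> (fps_nth f 0)"
    and T: "\<And>s. s \<in> S \<Longrightarrow> F (RH_T W S s) = QW_elt s"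
    and x: "x \<in> carrier H"
  shows "at_v_1 W S x = F x"
proof -
  let ?I = "RH_v_minus_1_ideal W S"
  let ?Q = "H Quot ?I"
  let ?p = "\<lambda>x. ?I +>\<^bsub>H\<^esub> x"
  have X: "F (phi fps_X) = 0" by (simp add: phi)
  interpret F: ring_hom_ring H "QW W" F
    by (rule ring_hom_ringI2[OF ring_RH ring_QW F])
  have ker: "a_kernel H (QW W) F = ?I"
    unfolding RH_ideal_eq by (rule hom_kernel_eq[OF F X T])
  interpret I: ideal ?I H using F.kernel_is_ideal by (simp only: ker)
  have surj: "F ` carrier H = carrier (QW W)"
  proof
    show "carrier (QW W) \<subseteq> F ` carrier H"
    proof
      fix f assume "f \<in> carrier (QW W)"
      then have "keys f \<subseteq> carrier W" by (simp add: QW_def)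
      then show "f \<in> F ` carrier H"
      proof (induction f rule: poly_mapping_keys_induct)
        case zero
        show ?case
          by (rule image_eqI[OF _ A.zero_closed]) (simp only: F.hom_zero zero_QW)
      next
        case (single w q)
        then show ?case
          using hom_scale_Tb[OF F X T single, of "fps_const q"]
          by (intro image_eqI[of _ _ "A.scale (fps_const q) (Tb w)"]) auto
      next
        case (add f g)
        then obtain x y where "f = F x" "g = F y" "x \<in> carrier H" "y \<in> carrier H" by auto
        then show ?case
          by (intro image_eqI[of _ _ "x \<oplus>\<^bsub>H\<^esub> y"]) (simp_all add: add_QW)
      qed
    qed
  qed auto
  \<comment> \<open>The restriction makes the induced map extensional, as the identification
    demands.\<close>
  define f where "f = restrict (\<lambda>Y. the_elem (F ` Y)) (carrier ?Q)"
  have closed: "?p x \<in> carrier ?Q" if "x \<in> carrier H" for x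
    by (rule ring_hom_closed[OF I.rcos_ring_hom that])
  have f_eq: "f (?p x) = F x" if "x \<in> carrier H" for x
    using F.the_elem_simp[OF that] closed[OF that] by (simp add: f_def ker)
  have iso: "f \<in> ring_iso ?Q (QW W)"
  proof (rule ring.ring_iso_restrict[OF I.quotient_is_ring])
    show "(\<lambda>Y. the_elem (F ` Y)) \<in> ring_iso ?Q (QW W)"
      using F.FactRing_iso_set[OF surj] by (simp only: ker)
  qed (simp add: f_def)
  have ext: "f \<in> extensional (carrier ?Q)" unfolding f_def by (rule restrict_extensional)
  have "QW_identification W S = f"
    unfolding QW_identification_def
  proof (rule the_equality)
    show "f \<in> ring_iso ?Q (QW W) \<and> f \<in> extensional (carrier ?Q) \<and> (\<forall>s\<in>S. f (?p (RH_T W S s)) = QW_elt s)"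
      by (intro conjI iso ext ballI) (simp only: f_eq RH_T_closed T)
  next
    fix g assume g: "g \<in> ring_iso ?Q (QW W) \<and> g \<in> extensional (carrier ?Q) \<and> (\<forall>s\<in>S. g (?p (RH_T W S s)) = QW_elt s)"
    then have hom: "g \<in> ring_hom ?Q (QW W)" by (simp add: ring_iso_def)
    have comp: "g \<circ> ?p \<in> ring_hom H (QW W)"
      by (rule ring_hom_trans[OF I.rcos_ring_hom hom])
    have "phi fps_X \<in> ?I" unfolding RH_ideal_eq using hom_kernel[OF F X T phi_closed] X by simp
    then have "?p (phi fps_X) = ?I" by (rule I.a_rcos_const)
    also have "?I = \<zero>\<^bsub>?Q\<^esub>" by (simp add: FactRing_def)
    finally have "?p (phi fps_X) = \<zero>\<^bsub>?Q\<^esub>" .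
    then have gX: "(g \<circ> ?p) (phi fps_X) = 0"
      using ring_hom_zero[OF hom I.quotient_is_ring ring_QW] by (simp add: zero_QW)
    have g_eq: "g (?p x) = F x" if x: "x \<in> carrier H" for x
    proof -
      have "(g \<circ> ?p) x = F x"
        by (rule hom_unique[OF comp gX _ F X _ x]) (use g T in simp_all)
      then show ?thesis by simp
    qed
    show "g = f"
    proof (rule extensionalityI)
      show "g \<in> extensional (carrier ?Q)" using g by blast
      fix Y assume "Y \<in> carrier ?Q"
      then obtain x where "x \<in> carrier H" "Y = ?p x"
        unfolding FactRing_def A_RCOSETS_def' by auto
      then show "g Y = f Y" by (simp only: g_eq f_eq)
    qed (rule ext)
  qed
  then show ?thesis unfolding at_v_1_def by (simp only: f_eq[OF x])
qed

section \<open>The lift of the longest element\<close>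

lemma RH_T_mult_Tb_longest:
  assumes "longest_element W S w0" "s \<in> S"
  shows "RH_T W S (w0 \<otimes> s \<otimes> w0) \<bullet> Tb w0 = Tb w0 \<bullet> RH_T W S s"
proof -
  let ?s = "w0 \<otimes> s \<otimes> w0"
  have w0: "w0 \<in> carrier W" "w0 \<otimes> w0 = \<one>"
    using assms longest_element_involution unfolding longest_element_def by auto
  have s: "?s \<in> S" by (rule longest_element_conj_gen[OF assms])
  \<comment> \<open>Appending \<open>s\<close> or prepending
    \<open>w0 \<otimes> s \<otimes> w0\<close> to this word gives two reduced words of
    \<open>w0\<close>. They factor T_{w0} in two ways, and the claim compares them.\<close>
  define us where "us = rword (w0 \<otimes> s)"
  have us: "us \<in> lists S" "length us = len (w0 \<otimes> s)" "wprod us = w0 \<otimes> s"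
    using rword[of "w0 \<otimes> s"] w0 assms(2) by (auto simp: us_def reduced_def)
  have len: "length us + 1 = len w0" using len_longest_mult_gen[OF assms] us by simp
  have "wprod (us @ [s]) = w0" using us w0 assms(2) by (simp add: wprod_append m_assoc involution)
  then have 1: "Tb w0 = Tword us \<bullet> RH_T W S s"
    using Tb_wprod[of "us @ [s]"] us len assms(2) by (simp add: reduced_def Tword_append)
  have "wprod (?s # us) = w0 \<otimes> s \<otimes> (w0 \<otimes> w0) \<otimes> s"
    using us w0(1) assms(2) by (simp add: m_assoc)
  also have "\<dots> = w0" using w0 assms(2) by (simp add: m_assoc involution)
  finally have 2: "Tb w0 = RH_T W S ?s \<bullet> Tword us"
    using Tb_wprod[of "?s # us"] us len s by (simp add: reduced_def)
  have "RH_T W S ?s \<bullet> Tb w0 = RH_T W S ?s \<bullet> Tword us \<bullet> RH_T W S s"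
    unfolding 1 using us s assms(2) by (simp add: A.m_assoc)
  then show ?thesis by (simp only: 2[symmetric])
qed

text \<open>The centralizer of \<open>z\<close> is a submodule closed under products, so it contains
  every T_w and therefore the whole algebra.\<close>

lemma commute_all:
  assumes z: "z \<in> carrier H"
    and T: "\<And>s. s \<in> S \<Longrightarrow> z \<bullet> RH_T W S s = RH_T W S s \<bullet> z"
    and x: "x \<in> carrier H"
  shows "z \<bullet> x = x \<bullet> z"
proof -
  obtain ws where ws: "set ws = carrier W" by (rule enumeration)
  let ?N = "{x \<in> carrier H. z \<bullet> x = x \<bullet> z}"
  have sub: "A.submod ?N"
    unfolding A.submod_def using z
    by (auto simp: A.l_distr A.r_distr A.scale_mult_left A.scale_mult_right)
  have word: "z \<bullet> Tword us = Tword us \<bullet> z" if "us \<in> lists S" for us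
    using that
  proof (induction us rule: list.induct)
    case (Cons s us)
    then have c: "s \<in> S" "us \<in> lists S" by auto
    have "z \<bullet> (RH_T W S s \<bullet> Tword us) = RH_T W S s \<bullet> z \<bullet> Tword us"
      using c z T[OF c(1)] by (simp add: A.m_assoc[symmetric])
    also have "\<dots> = RH_T W S s \<bullet> Tword us \<bullet> z"
      using c z Cons.IH by (simp add: A.m_assoc)
    finally show ?case by simp
  qed (use z in simp)
  have "set (map Tb ws) \<subseteq> ?N" using word rword_in_lists ws by (auto simp: Tb_def)
  then have "A.lspan (map Tb ws) \<subseteq> ?N" by (rule lspan_subset_submod[OF sub])
  moreover have "x \<in> A.lspan (map Tb ws)" using x by (simp only: carrier_RH_eq_lspan[OF ws])
  ultimately show ?thesis by blast
qed

theorem longest_element_lift: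
  assumes w0: "longest_element W S w0"
  shows "\<exists>!w. w \<in> carrier H \<and>
    w \<bullet> w = \<one>\<^bsub>H\<^esub> \<and>
    at_v_1 W S w = QW_elt w0 \<and>
    (\<forall>s\<in>S. w \<bullet> RH_T W S s \<bullet> inv\<^bsub>H\<^esub> w = RH_T W S (w0 \<otimes> s \<otimes> w0))"
    (is "\<exists>!w. ?P w")
proof -
  obtain bs where "finite_fps_algebra H phi bs" using finite_fps_algebra_RH by blast
  then interpret fin: finite_fps_algebra H phi bs .
  obtain F where F: "F \<in> ring_hom H (QW W)"
    and phi: "\<And>f. F (phi f) = single \<one> (fps_nth f 0)"
    and T: "\<And>s. s \<in> S \<Longrightarrow> F (RH_T W S s) = QW_elt s"
    using specialization_RH by blast
  interpret F: ring_hom_ring H "QW W" F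
    by (rule ring_hom_ringI2[OF ring_RH ring_QW F])
  have at: "at_v_1 W S x = F x" if "x \<in> carrier H" for x
    using F phi T that by (rule at_v_1_eq)
  have X: "F (phi fps_X) = 0" by (simp add: phi)
  have w0c: "w0 \<in> carrier W" and w0w0: "w0 \<otimes> w0 = \<one>"
    using w0 longest_element_involution unfolding longest_element_def by auto
  \<comment> \<open>Translates closeness to 1 in the X-adic sense into a condition on the
    specialization, in both directions.\<close>
  have near_one: "x \<ominus>\<^bsub>H\<^esub> \<one>\<^bsub>H\<^esub> \<in> A.adic 1 \<longleftrightarrow> F x = \<one>\<^bsub>QW W\<^esub>" if "x \<in> carrier H" for x
  proof -
    have "F (x \<ominus>\<^bsub>H\<^esub> \<one>\<^bsub>H\<^esub>) = F x \<ominus>\<^bsub>QW W\<^esub> \<one>\<^bsub>QW W\<^esub>"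
      using that by (simp add: A.minus_eq F.S.minus_eq)
    moreover have "F x \<ominus>\<^bsub>QW W\<^esub> \<one>\<^bsub>QW W\<^esub> = 0 \<longleftrightarrow> F x = \<one>\<^bsub>QW W\<^esub>"
      using F.S.r_right_minus_eq[OF F.hom_closed[OF that] F.S.one_closed] by (simp only: zero_QW)
    ultimately show ?thesis
      using hom_kernel[OF F X T A.minus_closed[OF that A.one_closed]] by (simp only:)
  qed
  have QW_w0: "QW_elt w0 \<otimes>\<^bsub>QW W\<^esub> QW_elt w0 = \<one>\<^bsub>QW W\<^esub>"
    by (simp add: QW_def QW_elt_def monoid_ring_single_mult w0w0)
  define conj where "conj s = w0 \<otimes> s \<otimes> w0" for s
  have conj: "conj s \<in> S" "conj (conj s) = s" if "s \<in> S" for s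
  proof -
    show "conj s \<in> S" unfolding conj_def by (rule longest_element_conj_gen[OF w0 that])
    have "conj (conj s) = (w0 \<otimes> w0) \<otimes> s \<otimes> (w0 \<otimes> w0)"
      unfolding conj_def using w0c that by (simp only: m_assoc m_closed gen_closed)
    then show "conj (conj s) = s" using that by (simp add: w0w0)
  qed
  define T0 where "T0 = Tb w0"
  have T0: "T0 \<in> carrier H" "T0 \<in> Units H"
    using w0c Tb_Units by (auto simp: T0_def)
  have T0_conj: "T0 \<bullet> RH_T W S s = RH_T W S (conj s) \<bullet> T0" if "s \<in> S" for s
    using RH_T_mult_Tb_longest[OF w0 that] by (simp add: conj_def T0_def)
  define c where "c = T0 \<bullet> T0"
  have c: "c \<in> carrier H" "c \<in> Units H" using T0 by (auto simp: c_def)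
  have "F T0 = QW_elt w0" unfolding T0_def by (rule hom_Tb[OF F T w0c])
  then have "F c = \<one>\<^bsub>QW W\<^esub>" using T0 QW_w0 by (simp add: c_def)
  then obtain r where r: "r \<in> carrier H" "r \<bullet> r = c"
    "r \<ominus>\<^bsub>H\<^esub> \<one>\<^bsub>H\<^esub> \<in> A.adic 1"
    and r_comm: "\<And>z. z \<in> carrier H \<Longrightarrow> c \<bullet> z = z \<bullet> c \<Longrightarrow>
      r \<bullet> z = z \<bullet> r"
    using fin.square_root[of c] near_one[of c] c by blast
  define u where "u = r \<bullet> inv\<^bsub>H\<^esub> c"
  \<comment> \<open>Moving \<open>T0\<close> past T_s conjugates the index by \<open>w0\<close>;
    doing so twice restores it.\<close>
  have c_central: "c \<bullet> z = z \<bullet> c" if "z \<in> carrier H" for z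
  proof (rule commute_all[OF c(1) _ that])
    fix s assume s: "s \<in> S"
    have "c \<bullet> RH_T W S s = T0 \<bullet> (RH_T W S (conj s) \<bullet> T0)"
      using T0 s by (simp add: c_def A.m_assoc T0_conj)
    also have "\<dots> = RH_T W S (conj (conj s)) \<bullet> T0 \<bullet> T0"
      using T0 s conj(1)[OF s] by (simp add: A.m_assoc[symmetric] T0_conj)
    also have "\<dots> = RH_T W S s \<bullet> c"
      using T0 s by (simp add: c_def conj(2) A.m_assoc)
    finally show "c \<bullet> RH_T W S s = RH_T W S s \<bullet> c" .
  qed
  have r_central: "r \<bullet> z = z \<bullet> r" if "z \<in> carrier H" for z
    using r_comm[OF that c_central[OF that]] .
  have ic: "inv\<^bsub>H\<^esub> c \<in> carrier H" using c by simp
  have u: "u \<in> carrier H" "r \<bullet> u = \<one>\<^bsub>H\<^esub>" "u \<bullet> r = \<one>\<^bsub>H\<^esub>"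
  proof -
    show "u \<in> carrier H" using r ic by (simp add: u_def)
    show "r \<bullet> u = \<one>\<^bsub>H\<^esub>"
      using r c ic by (simp add: u_def A.m_assoc[symmetric])
    then show "u \<bullet> r = \<one>\<^bsub>H\<^esub>" using r_central[of u] \<open>u \<in> carrier H\<close> by simp
  qed
  have u_central: "u \<bullet> z = z \<bullet> u" if z: "z \<in> carrier H" for z
  proof -
    have "u \<bullet> z = u \<bullet> (z \<bullet> r) \<bullet> u"
      using u r z by (simp add: A.m_assoc)
    also have "\<dots> = u \<bullet> (r \<bullet> z) \<bullet> u"
      by (simp only: r_central[OF z])
    also have "\<dots> = u \<bullet> r \<bullet> (z \<bullet> u)"
      using u(1) r(1) z by (simp only: A.m_assoc A.m_closed)
    finally show ?thesis using u z by simp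
  qed
  define w where "w = T0 \<bullet> u"
  have w: "w \<in> carrier H" using T0 u by (simp add: w_def)
  have ww: "w \<bullet> w = \<one>\<^bsub>H\<^esub>"
  proof -
    have "w \<bullet> w = T0 \<bullet> (u \<bullet> T0) \<bullet> u"
      using T0 u by (simp add: w_def A.m_assoc)
    also have "\<dots> = c \<bullet> u \<bullet> u"
      using T0 u by (simp add: u_central[OF T0(1)] c_def A.m_assoc)
    also have "\<dots> = r \<bullet> (r \<bullet> u) \<bullet> u"
      using r u(1) by (simp add: r(2)[symmetric] A.m_assoc)
    finally show ?thesis using u r by simp
  qed
  \<comment> \<open>For an element of square 1 the conjugation condition becomes an intertwining
    relation without inverses.\<close>
  have inv_eq: "inv\<^bsub>H\<^esub> x = x" if "x \<in> carrier H" "x \<bullet> x = \<one>\<^bsub>H\<^esub>" for x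
    using that by (intro A.inv_char) auto
  have conj_iff: "x \<bullet> RH_T W S s \<bullet> inv\<^bsub>H\<^esub> x = RH_T W S (conj s) \<longleftrightarrow>
      x \<bullet> RH_T W S s = RH_T W S (conj s) \<bullet> x"
    if x: "x \<in> carrier H" "x \<bullet> x = \<one>\<^bsub>H\<^esub>" and s: "s \<in> S" for x s
  proof
    assume "x \<bullet> RH_T W S s \<bullet> inv\<^bsub>H\<^esub> x = RH_T W S (conj s)"
    then have "x \<bullet> RH_T W S s \<bullet> x \<bullet> x = RH_T W S (conj s) \<bullet> x"
      by (simp add: inv_eq[OF x])
    then show "x \<bullet> RH_T W S s = RH_T W S (conj s) \<bullet> x"
      using x s by (simp add: A.m_assoc)
  next
    assume "x \<bullet> RH_T W S s = RH_T W S (conj s) \<bullet> x"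
    then show "x \<bullet> RH_T W S s \<bullet> inv\<^bsub>H\<^esub> x = RH_T W S (conj s)"
      using x conj(1)[OF s] by (simp add: inv_eq[OF x] A.m_assoc)
  qed
  have exists: "?P w"
  proof (intro conjI ballI w ww)
    have "F r = \<one>\<^bsub>QW W\<^esub>" using near_one r by simp
    moreover have "F u \<otimes>\<^bsub>QW W\<^esub> F r = \<one>\<^bsub>QW W\<^esub>" using u r F.hom_mult[of u r] by simp
    ultimately have "F u = \<one>\<^bsub>QW W\<^esub>" using u by simp
    then show "at_v_1 W S w = QW_elt w0"
      using at[OF w] T0 u \<open>F T0 = QW_elt w0\<close> F.hom_closed[OF T0(1)] by (simp add: w_def)
    fix s assume s: "s \<in> S"
    have "w \<bullet> RH_T W S s = T0 \<bullet> RH_T W S s \<bullet> u"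
      using T0 u s by (simp add: w_def A.m_assoc u_central[OF RH_T_closed[OF s]])
    also have "\<dots> = RH_T W S (conj s) \<bullet> w"
      using T0 u s conj(1)[OF s] by (simp add: T0_conj w_def A.m_assoc)
    finally show "w \<bullet> RH_T W S s \<bullet> inv\<^bsub>H\<^esub> w = RH_T W S (w0 \<otimes> s \<otimes> w0)"
      using conj_iff[OF w ww s] by (simp add: conj_def)
  qed
  have unique: "x = y" if "?P x" "?P y" for x y
  proof -
    have x: "x \<in> carrier H" "x \<bullet> x = \<one>\<^bsub>H\<^esub>" "F x = QW_elt w0"
      and y: "y \<in> carrier H" "y \<bullet> y = \<one>\<^bsub>H\<^esub>" "F y = QW_elt w0"
      using that at[of x] at[of y] by auto
    have xs: "x \<bullet> RH_T W S s = RH_T W S (conj s) \<bullet> x"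
      and ys: "y \<bullet> RH_T W S s = RH_T W S (conj s) \<bullet> y" if "s \<in> S" for s
      using conj_iff[OF x(1,2) that] conj_iff[OF y(1,2) that] \<open>?P x\<close> \<open>?P y\<close> that by (auto simp: conj_def)
    define z where "z = x \<bullet> y"
    have z: "z \<in> carrier H" using x y by (simp add: z_def)
    \<comment> \<open>Each factor of \<open>z\<close> conjugates the index by \<open>w0\<close>, so
      \<open>z\<close> fixes every T_s.\<close>
    have central: "z \<bullet> a = a \<bullet> z" if "a \<in> carrier H" for a
    proof (rule commute_all[OF z _ that])
      fix s assume s: "s \<in> S"
      have "z \<bullet> RH_T W S s = x \<bullet> RH_T W S (conj s) \<bullet> y"
        using x y s conj(1)[OF s] by (simp add: z_def A.m_assoc ys)
      also have "\<dots> = RH_T W S s \<bullet> z"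
        using x y s conj(1)[OF s] by (simp add: xs conj(2) z_def A.m_assoc)
      finally show "z \<bullet> RH_T W S s = RH_T W S s \<bullet> z" .
    qed
    \<comment> \<open>Centrality of \<open>z\<close> turns x y z into x z y, which is the product of
      the squares of \<open>x\<close> and \<open>y\<close>.\<close>
    have "z \<bullet> z = x \<bullet> (y \<bullet> z)"
      using x y z by (simp add: z_def A.m_assoc)
    also have "y \<bullet> z = z \<bullet> y" by (rule central[OF y(1), symmetric])
    also have "x \<bullet> (z \<bullet> y) = (x \<bullet> x) \<bullet> (y \<bullet> y)"
      using x(1) y(1) by (simp add: z_def A.m_assoc)
    finally have zz: "z \<bullet> z = \<one>\<^bsub>H\<^esub>" using x y by simp
    have "F z = \<one>\<^bsub>QW W\<^esub>" using x y QW_w0 by (simp add: z_def)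
    then have "z = \<one>\<^bsub>H\<^esub>" using fin.involution_near_one[OF z zz] near_one[OF z] by simp
    then have "x \<bullet> y \<bullet> y = y" using y by (simp add: z_def)
    then show ?thesis using x y by (simp add: A.m_assoc)
  qed
  show ?thesis using exists unique by blast
qed

end

end

theorem proposition3p2:
  fixes W :: "('a, 'b) monoid_scheme" and S :: "'a set" and w0 :: 'a
  assumes "coxeter_system W S"
    and "finite (carrier W)"
    and "longest_element W S w0"
  shows "\<exists>!w. w \<in> carrier (RH W S) \<and>
    w \<otimes>\<^bsub>RH W S\<^esub> w = \<one>\<^bsub>RH W S\<^esub> \<and>
    at_v_1 W S w = QW_elt w0 \<and>
    (\<forall>s\<in>S. w \<otimes>\<^bsub>RH W S\<^esub> RH_T W S s \<otimes>\<^bsub>RH W S\<^esub> inv\<^bsub>RH W S\<^esub> w =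
      RH_T W S (w0 \<otimes>\<^bsub>W\<^esub> s \<otimes>\<^bsub>W\<^esub> w0))"
  by (rule coxeter_group.longest_element_lift[OF coxeter_system_imp_coxeter_group[OF assms(1)] assms(2,3)])

end
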